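(* Let $W$ be an irreducible finite Coxeter group, $B$ its Artin group, $P=\ker(B\to W)$ its pure Artin group and $B^2=\ker(\epsilon\circ\pi)$. Let $\rho\in\mathrm{Irr}(W)$ and let $R_0:B\to\mathrm{GL}_N(\mathbb R[q,q^{-1}])$ be a matrix model of the irreducible representation of the generic Hecke algebra (relations $(\sigma-q)(\sigma+q^{-1})=0$ for the Artin generators $\sigma$) specializing at $q=1$ to $\rho$. For a transcendental number $u\in\mathbb C$ with $|u|=1$ and $u$ close enough to 1, let $\hat R_u:B\to\mathrm{GL}_N(\mathbb C)$ be the specialization at $q=u$. Then the closure (for the usual topology) of $\hat R_u(P)$, and likewise of $\hat R_u(B^2)$, is a connected compact Lie group whose Lie algebra is a compact real form of $\rho(\mathcal H)$, isomorphic to $\rho(\mathcal H^c)$.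
   Context: $W$ acts as a finite reflection group (generated by reflections of order 2); $\mathcal R$ is its set of reflections, $\epsilon$ its sign character, $\pi:B\to W$ the natural projection. $\mathcal H$ is the complex Lie subalgebra of $\mathbb CW$ (bracket $xy-yx$) generated by $\mathcal R$, and $\mathcal H^c$ is the real Lie subalgebra of $\mathbb CW$ generated by $\mathrm i s$, $s\in\mathcal R$. Such models $R_0$ exist (e.g. via $W$-graphs). *)

theory Defs
  imports "HOL-Analysis.Analysis" "HOL-Computational_Algebra.Polynomial"
begin

type_synonym 'n cmat = "complex^'n^'n"

text \<open>Simple reflections are indexed by a finite type 'i; m is the Coxeter matrix
 (finite entries suffice since W is assumed finite).\<close>

definition coxeter_matrix :: "('i \<Rightarrow> 'i \<Rightarrow> nat) \<Rightarrow> bool" where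
  "coxeter_matrix m \<longleftrightarrow> (\<forall>s. m s s = 1) \<and> (\<forall>s t. m s t = m t s)
     \<and> (\<forall>s t. s \<noteq> t \<longrightarrow> m s t \<ge> 2)"

fun alt :: "'a \<Rightarrow> 'a \<Rightarrow> nat \<Rightarrow> 'a list" where
  "alt s t 0 = []"
| "alt s t (Suc k) = s # alt t s k"

inductive weq :: "('i \<Rightarrow> 'i \<Rightarrow> nat) \<Rightarrow> 'i list \<Rightarrow> 'i list \<Rightarrow> bool" for m where
  weq_refl: "weq m w w"
| weq_sym: "weq m u v \<Longrightarrow> weq m v u"
| weq_trans: "weq m u v \<Longrightarrow> weq m v w \<Longrightarrow> weq m u w"
| weq_ctxt: "weq m u v \<Longrightarrow> weq m (a @ u @ b) (a @ v @ b)"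
| weq_sq: "weq m [s, s] []"
| weq_braid: "weq m (alt s t (m s t)) (alt t s (m s t))"

definition coxeter_group_finite :: "('i \<Rightarrow> 'i \<Rightarrow> nat) \<Rightarrow> bool" where
  "coxeter_group_finite m \<longleftrightarrow> finite (range (\<lambda>w. {v. weq m w v}))"

definition coxeter_irreducible :: "('i \<Rightarrow> 'i \<Rightarrow> nat) \<Rightarrow> bool" where
  "coxeter_irreducible m \<longleftrightarrow> (\<forall>s t. (\<lambda>a b. m a b \<ge> 3)\<^sup>*\<^sup>* s t)"

text \<open>Elements of the Artin group B are represented by words in the generators
  sigma_s and their inverses: (s, True) = sigma_s, (s, False) = sigma_s^-1.
  pi : B \<rightarrow> W sends sigma_s^{\<plusminus>1} to s.\<close>
definition pure_words :: "('i \<Rightarrow> 'i \<Rightarrow> nat) \<Rightarrow> ('i \<times> bool) list set" where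
  "pure_words m = {w. weq m (map fst w) []}"

text \<open>B^2 = ker(epsilon o pi); epsilon(s) = -1, so epsilon(pi(w)) = (-1)^length w.\<close>
definition even_words :: "('i \<times> bool) list set" where
  "even_words = {w. even (length w)}"

definition csmult :: "complex \<Rightarrow> 'n::finite cmat \<Rightarrow> 'n cmat" where
  "csmult c A = (\<chi> i j. c * A $ i $ j)"

definition comm :: "'n::finite cmat \<Rightarrow> 'n cmat \<Rightarrow> 'n cmat" where
  "comm A B = A ** B - B ** A"

fun mpow :: "'n::finite cmat \<Rightarrow> nat \<Rightarrow> 'n cmat" where
  "mpow A 0 = mat 1"
| "mpow A (Suc k) = A ** mpow A k"

definition mexp :: "'n::finite cmat \<Rightarrow> 'n cmat" where
  "mexp A = (\<Sum>k. (1 / fact k) *\<^sub>R mpow A k)"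

definition word_prod :: "('a \<Rightarrow> 'n::finite cmat) \<Rightarrow> 'a list \<Rightarrow> 'n cmat" where
  "word_prod f w = foldr (\<lambda>a M. f a ** M) w (mat 1)"

definition artin_eval :: "('i \<Rightarrow> 'n::finite cmat) \<Rightarrow> ('i \<times> bool) list \<Rightarrow> 'n cmat" where
  "artin_eval R w = word_prod (\<lambda>(s, b). if b then R s else matrix_inv (R s)) w"

definition complex_subspace :: "'n::finite cmat set \<Rightarrow> bool" where
  "complex_subspace L \<longleftrightarrow> 0 \<in> L \<and> (\<forall>A\<in>L. \<forall>B\<in>L. A + B \<in> L)
     \<and> (\<forall>c. \<forall>A\<in>L. csmult c A \<in> L)"

definition real_subspace :: "'n::finite cmat set \<Rightarrow> bool" where
  "real_subspace L \<longleftrightarrow> 0 \<in> L \<and> (\<forall>A\<in>L. \<forall>B\<in>L. A + B \<in> L)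
     \<and> (\<forall>c::real. \<forall>A\<in>L. c *\<^sub>R A \<in> L)"

definition bracket_closed :: "'n::finite cmat set \<Rightarrow> bool" where
  "bracket_closed L \<longleftrightarrow> (\<forall>A\<in>L. \<forall>B\<in>L. comm A B \<in> L)"

definition complex_lie_gen :: "'n::finite cmat set \<Rightarrow> 'n cmat set" where
  "complex_lie_gen X = \<Inter>{L. X \<subseteq> L \<and> complex_subspace L \<and> bracket_closed L}"

definition real_lie_gen :: "'n::finite cmat set \<Rightarrow> 'n cmat set" where
  "real_lie_gen X = \<Inter>{L. X \<subseteq> L \<and> real_subspace L \<and> bracket_closed L}"

definition lie_algebra_of :: "'n::finite cmat set \<Rightarrow> 'n cmat set" where
  "lie_algebra_of G = {X. \<forall>t::real. mexp (t *\<^sub>R X) \<in> G}"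

text \<open>Closed subgroup of GL_N(C) (hence a Lie group, by Cartan's theorem).\<close>
definition matrix_group :: "'n::finite cmat set \<Rightarrow> bool" where
  "matrix_group G \<longleftrightarrow> mat 1 \<in> G \<and> (\<forall>A\<in>G. invertible A \<and> matrix_inv A \<in> G)
     \<and> (\<forall>A\<in>G. \<forall>B\<in>G. A ** B \<in> G)"

definition real_lie_iso :: "('n::finite cmat \<Rightarrow> 'm::finite cmat) \<Rightarrow> 'n cmat set \<Rightarrow> 'm cmat set \<Rightarrow> bool" where
  "real_lie_iso \<phi> L M \<longleftrightarrow> bij_betw \<phi> L M
     \<and> (\<forall>A\<in>L. \<forall>B\<in>L. \<phi> (A + B) = \<phi> A + \<phi> B)
     \<and> (\<forall>c::real. \<forall>A\<in>L. \<phi> (c *\<^sub>R A) = c *\<^sub>R \<phi> A)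
     \<and> (\<forall>A\<in>L. \<forall>B\<in>L. \<phi> (comm A B) = comm (\<phi> A) (\<phi> B))"

definition complex_lie_iso :: "('n::finite cmat \<Rightarrow> 'm::finite cmat) \<Rightarrow> 'n cmat set \<Rightarrow> 'm cmat set \<Rightarrow> bool" where
  "complex_lie_iso \<phi> L M \<longleftrightarrow> bij_betw \<phi> L M
     \<and> (\<forall>A\<in>L. \<forall>B\<in>L. \<phi> (A + B) = \<phi> A + \<phi> B)
     \<and> (\<forall>c. \<forall>A\<in>L. \<phi> (csmult c A) = csmult c (\<phi> A))
     \<and> (\<forall>A\<in>L. \<forall>B\<in>L. \<phi> (comm A B) = comm (\<phi> A) (\<phi> B))"

definition compact_lie_algebra :: "'n::finite cmat set \<Rightarrow> bool" where
  "compact_lie_algebra L \<longleftrightarrow> (\<exists>Bf :: 'n cmat \<Rightarrow> 'n cmat \<Rightarrow> real.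
     (\<forall>x\<in>L. \<forall>y\<in>L. Bf x y = Bf y x)
     \<and> (\<forall>x\<in>L. \<forall>y\<in>L. \<forall>z\<in>L. Bf (x + y) z = Bf x z + Bf y z)
     \<and> (\<forall>c. \<forall>x\<in>L. \<forall>z\<in>L. Bf (c *\<^sub>R x) z = c * Bf x z)
     \<and> (\<forall>x\<in>L. x \<noteq> 0 \<longrightarrow> Bf x x > 0)
     \<and> (\<forall>x\<in>L. \<forall>y\<in>L. \<forall>z\<in>L. Bf (comm x y) z + Bf y (comm x z) = 0))"

definition compact_real_form_of :: "'n::finite cmat set \<Rightarrow> 'm::finite cmat set \<Rightarrow> bool" where
  "compact_real_form_of L g \<longleftrightarrow> real_subspace L \<and> bracket_closed L
     \<and> (\<forall>A\<in>L. csmult \<i> A \<in> L \<longrightarrow> A = 0)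
     \<and> (\<exists>\<phi>. complex_lie_iso \<phi> {A + csmult \<i> B | A B. A \<in> L \<and> B \<in> L} g)
     \<and> compact_lie_algebra L"

definition complex_irreducible :: "('i \<Rightarrow> 'n::finite cmat) \<Rightarrow> bool" where
  "complex_irreducible \<rho> \<longleftrightarrow> \<not> (\<exists>V :: (complex^'n) set.
      0 \<in> V \<and> (\<forall>x\<in>V. \<forall>y\<in>V. x + y \<in> V) \<and> (\<forall>c. \<forall>x\<in>V. c *s x \<in> V)
      \<and> V \<noteq> {0} \<and> V \<noteq> UNIV \<and> (\<forall>s. \<forall>x\<in>V. \<rho> s *v x \<in> V))"

text \<open>A matrix with entries in R[q,q^-1] is given as q^-d * P(q) with P a matrix of real
  polynomials; evaluation at q \<noteq> 0.\<close>
definition laurent_eval :: "(real poly)^'n^'n \<Rightarrow> nat \<Rightarrow> complex \<Rightarrow> 'n::finite cmat" where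
  "laurent_eval P d q = (\<chi> i j. poly (map_poly complex_of_real (P $ i $ j)) q / q ^ d)"

text \<open>Identities in GL_N(R[q,q^-1]) are identities of Laurent polynomials, i.e. they hold
  at every q \<noteq> 0.\<close>
definition hecke_model :: "('i \<Rightarrow> 'i \<Rightarrow> nat) \<Rightarrow> ('i \<Rightarrow> (real poly)^'n^'n) \<Rightarrow> nat \<Rightarrow> bool" where
  "hecke_model m P d \<longleftrightarrow> (\<forall>q::complex. q \<noteq> 0 \<longrightarrow>
      (\<forall>s. (laurent_eval (P s) d q - csmult q (mat 1)) **
           (laurent_eval (P s) d q + csmult (inverse q) (mat 1)) = 0)
    \<and> (\<forall>s t. word_prod (\<lambda>a. laurent_eval (P a) d q) (alt s t (m s t))
           = word_prod (\<lambda>a. laurent_eval (P a) d q) (alt t s (m s t))))"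

definition refl_images :: "('i \<Rightarrow> 'n::finite cmat) \<Rightarrow> 'n cmat set" where
  "refl_images \<rho> = {word_prod \<rho> w ** \<rho> s ** word_prod \<rho> (rev w) | w s. True}"

end

theory Submission
  imports Defs
begin

text \<open>For \<open>u = cis \<theta>\<close> near 1 write \<open>\<i> R\<^sub>s = cos \<theta> Y\<^sub>s - sin \<theta> = exp ((\<pi>/2 + \<theta>) Y\<^sub>s)\<close> with
  \<open>Y\<^sub>s\<^sup>2 = -1\<close>. Since \<open>u\<close> is not a root of unity, the powers of the squares of the Artin generators
  are dense in the circles \<open>exp (\<real> Y\<^sub>s)\<close>, so both closures equal the closure of the connected group
  generated by these circles. At \<open>\<theta> = 0\<close>, after unitarisation, \<open>Y\<^sub>s\<close> is \<open>\<eta>\<^sub>s = \<i> \<rho>(s)\<close>; these generate the real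
  Lie algebra H, and Schur's lemma shows that the closed group K generated by the circles
  \<open>exp (\<real> \<eta>\<^sub>s)\<close> has Lie algebra H.

  The main point is a rigidity statement: for \<open>u\<close> close to 1 a single conjugation moves every
  \<open>Y\<^sub>s\<close> into the K-orbit of \<open>\<eta>\<^sub>s\<close>. Modulo H, the first-order error of such a conjugation is a cocycle of
  the finite group W with values in the orthogonal complement of H, because all relations hold
  exactly and the error inside K is tangent to H. By averaging it is a coboundary and can be removed
  by a further conjugation. Hence after conjugation the group lies in K, and its Lie algebra is all
  of H by semicontinuity of the dimension.\<close>

text \<open>Semicontinuity of the dimension gives only a lower bound: a perturbation of the
  generators could well generate a larger Lie algebra than H. Containment in a conjugate of K
  supplies the upper bound, and this is what rigidity is for. The obstacle is that the perturbed
  units satisfy the braid relations only through their circle elements at the angle pi/2 + \<theta>,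
  and no invariant Hermitian form is given for them in advance. Points of the K-orbits that
  approximate these units need not satisfy the braid relations at all. Their failure, however,
  compares two elements of K, so its rescaled limit is tangent to K. Working orthogonally to H is
  what removes this failure and leaves a genuine cocycle. The conjugation itself is found by
  minimising a defect over a compact set; criticality of the minimiser supplies the orthogonality
  conditions under which averaging applies. All limits run along sequences of parameters tending to
  1, so the radius around 1 comes out of an argument by contradiction and is not explicit.\<close>

section \<open>Matrices as a Banach algebra, and the exponential\<close>

lemma bounded_bilinear_matrix_matrix_mult:
  "bounded_bilinear ((**) :: 'n::finite cmat \<Rightarrow> 'n cmat \<Rightarrow> 'n cmat)"
proof -
  have "bilinear ((**) :: 'n cmat \<Rightarrow> 'n cmat \<Rightarrow> 'n cmat)"
    unfolding bilinear_def
    by (auto intro!: linearI simp: matrix_matrix_mult_def vec_eq_iff sum.distrib scaleR_sum_right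
        algebra_simps)
  then show ?thesis by (simp add: bilinear_conv_bounded_bilinear)
qed

interpretation mm: bounded_bilinear "(**) :: 'n::finite cmat \<Rightarrow> 'n cmat \<Rightarrow> 'n cmat"
  by (rule bounded_bilinear_matrix_matrix_mult)

lemmas mat_ring = mm.add_left mm.add_right mm.diff_left mm.diff_right mm.minus_left mm.minus_right
  mm.scaleR_left mm.scaleR_right matrix_mul_assoc

lemma bounded_bilinear_matrix_vector_mult:
  "bounded_bilinear ((*v) :: 'n::finite cmat \<Rightarrow> complex^'n \<Rightarrow> complex^'n)"
proof -
  have "bilinear ((*v) :: 'n cmat \<Rightarrow> complex^'n \<Rightarrow> complex^'n)"
    unfolding bilinear_def
    by (auto intro!: linearI simp: matrix_vector_mult_def vec_eq_iff sum.distrib scaleR_sum_right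
        algebra_simps)
  then show ?thesis by (simp add: bilinear_conv_bounded_bilinear)
qed

interpretation mv: bounded_bilinear "(*v) :: 'n::finite cmat \<Rightarrow> complex^'n \<Rightarrow> complex^'n"
  by (rule bounded_bilinear_matrix_vector_mult)

text \<open>A copy of the matrix type carrying the operator norm, which unlike the Euclidean norm makes it
  a unital Banach algebra; the library exponential lives there.\<close>

typedef 'n::finite mop = "UNIV :: 'n cmat set"
  by simp

setup_lifting type_definition_mop

instantiation mop :: (finite) real_algebra_1
begin
lift_definition zero_mop :: "'a mop" is "0" .
lift_definition one_mop :: "'a mop" is "mat 1" .
lift_definition plus_mop :: "'a mop \<Rightarrow> 'a mop \<Rightarrow> 'a mop" is "(+)" .
lift_definition minus_mop :: "'a mop \<Rightarrow> 'a mop \<Rightarrow> 'a mop" is "(-)" .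
lift_definition uminus_mop :: "'a mop \<Rightarrow> 'a mop" is "uminus" .
lift_definition times_mop :: "'a mop \<Rightarrow> 'a mop \<Rightarrow> 'a mop" is "(**)" .
lift_definition scaleR_mop :: "real \<Rightarrow> 'a mop \<Rightarrow> 'a mop" is "scaleR" .
instance
proof
  show "(0::'a mop) \<noteq> 1"
  proof transfer
    have "(mat 1 :: 'a cmat) $ undefined $ undefined = 1" by (simp add: mat_def)
    then show "(0 :: 'a cmat) \<noteq> mat 1" by (metis zero_index zero_neq_one)
  qed
qed (transfer; simp add: mat_ring scaleR_add_right scaleR_add_left)+
end

instantiation mop :: (finite) real_normed_algebra_1
begin
lift_definition norm_mop :: "'a mop \<Rightarrow> real" is "\<lambda>A. onorm ((*v) A)" .
definition dist_mop :: "'a mop \<Rightarrow> 'a mop \<Rightarrow> real" where "dist_mop A B = norm (A - B)"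
definition sgn_mop :: "'a mop \<Rightarrow> 'a mop" where "sgn_mop A = A /\<^sub>R norm A"
definition uniformity_mop :: "('a mop \<times> 'a mop) filter" where
  "uniformity_mop = (INF e\<in>{0 <..}. principal {(x, y). dist x y < e})"
definition open_mop :: "'a mop set \<Rightarrow> bool" where
  "open_mop S = (\<forall>x\<in>S. \<forall>\<^sub>F (x', y) in uniformity. x' = x \<longrightarrow> y \<in> S)"
instance
proof
  fix A B :: "'a mop" and r :: real
  show "dist A B = norm (A - B)" by (rule dist_mop_def)
  show "sgn A = A /\<^sub>R norm A" by (rule sgn_mop_def)
  show "uniformity = (INF e\<in>{0 <..}. principal {(x, y). dist x (y :: 'a mop) < e})"
    by (rule uniformity_mop_def)
  show "open U = (\<forall>x\<in>U. \<forall>\<^sub>F (x', y) in uniformity. x' = x \<longrightarrow> y \<in> U)" for U :: "'a mop set"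
    by (rule open_mop_def)
  show "norm A = 0 \<longleftrightarrow> A = 0"
    by transfer (auto simp: onorm_eq_0[OF mv.bounded_linear_right] matrix_eq)
  show "norm (A + B) \<le> norm A + norm B"
  proof transfer
    fix A B :: "'a cmat"
    show "onorm ((*v) (A + B)) \<le> onorm ((*v) A) + onorm ((*v) B)"
      using onorm_triangle[OF mv.bounded_linear_right[of A] mv.bounded_linear_right[of B]]
      unfolding mv.add_left[abs_def] .
  qed
  show "norm (r *\<^sub>R A) = \<bar>r\<bar> * norm A"
  proof transfer
    fix A :: "'a cmat" and r :: real
    show "onorm ((*v) (r *\<^sub>R A)) = \<bar>r\<bar> * onorm ((*v) A)"
      using onorm_scaleR[OF mv.bounded_linear_right[of A], of r]
      unfolding mv.scaleR_left[abs_def] .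
  qed
  show "norm (A * B) \<le> norm A * norm B"
  proof transfer
    fix A B :: "'a cmat"
    show "onorm ((*v) (A ** B)) \<le> onorm ((*v) A) * onorm ((*v) B)"
      using onorm_compose[OF mv.bounded_linear_right[of A] mv.bounded_linear_right[of B]]
      by (simp add: o_def matrix_vector_mul_assoc)
  qed
  show "norm (1 :: 'a mop) = 1"
  proof transfer
    have "(*v) (mat 1 :: 'a cmat) = (\<lambda>x. x)" by (simp add: fun_eq_iff)
    then show "onorm ((*v) (mat 1 :: 'a cmat)) = 1" by (simp only: onorm_id)
  qed
qed
end

text \<open>Together with boundedness of \<open>Rep_mop\<close> this is the equivalence of the
  operator norm and the Euclidean norm, so limits can be moved freely between the two types.\<close>

lemma bounded_linear_Abs_mop: "bounded_linear (Abs_mop :: 'n::finite cmat \<Rightarrow> 'n mop)"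
proof -
  obtain K where K: "norm (A *v x) \<le> norm A * norm x * K" for A :: "'n cmat" and x :: "complex^'n"
    using mv.bounded by blast
  show ?thesis
  proof
    show "\<exists>K. \<forall>A::'n cmat. norm (Abs_mop A) \<le> norm A * K"
    proof (intro exI allI)
      fix A :: "'n cmat"
      have "onorm ((*v) A) \<le> norm A * K"
        by (rule onorm_le) (metis K mult.commute mult.left_commute)
      then show "norm (Abs_mop A) \<le> norm A * K" by (simp add: norm_mop.abs_eq)
    qed
  qed (auto simp: plus_mop.abs_eq scaleR_mop.abs_eq)
qed

lemma bounded_linear_Rep_mop: "bounded_linear (Rep_mop :: 'n::finite mop \<Rightarrow> 'n cmat)"
proof
  show "\<exists>K. \<forall>A::'n mop. norm (Rep_mop A) \<le> norm A * K"
  proof (intro exI allI)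
    fix M :: "'n mop"
    define A where "A = Rep_mop M"
    \<comment> \<open>An entry is a coordinate of the image of a unit basis vector. Summing over
      rows and columns costs a factor \<open>CARD('n)\<close> each time.\<close>
    have "cmod (A $ i $ j) \<le> onorm ((*v) A)" for i j
    proof -
      have "A $ i $ j = (A *v axis j 1) $ i"
        by (simp add: matrix_vector_mult_def axis_def if_distrib cong: if_cong)
      also have "cmod \<dots> \<le> norm (A *v axis j 1)" by (rule Finite_Cartesian_Product.norm_nth_le)
      also have "\<dots> \<le> onorm ((*v) A) * norm (axis j 1 :: complex^'n)"
        by (rule onorm[OF mv.bounded_linear_right])
      finally show ?thesis by simp
    qed
    then have "norm (A $ i) \<le> real CARD('n) * onorm ((*v) A)" for i
      unfolding norm_vec_def[of "A $ i"]
      by (intro order_trans[OF L2_set_le_sum] order_trans[OF sum_bounded_above]) auto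
    then have "norm A \<le> real CARD('n) * (real CARD('n) * onorm ((*v) A))"
      unfolding norm_vec_def[of A]
      by (intro order_trans[OF L2_set_le_sum] order_trans[OF sum_bounded_above]) auto
    then show "norm (Rep_mop M) \<le> norm M * (real CARD('n) * real CARD('n))"
      by (simp add: A_def norm_mop.rep_eq algebra_simps)
  qed
qed (auto simp: plus_mop.rep_eq scaleR_mop.rep_eq)

instance mop :: (finite) banach
proof
  fix X :: "nat \<Rightarrow> 'a mop"
  assume "Cauchy X"
  then have "Cauchy (\<lambda>n. Rep_mop (X n))"
    by (rule bounded_linear.Cauchy[OF bounded_linear_Rep_mop])
  then obtain L where "(\<lambda>n. Rep_mop (X n)) \<longlonglongrightarrow> L"
    using Cauchy_convergent_iff convergent_def by blast
  then have "(\<lambda>n. Abs_mop (Rep_mop (X n))) \<longlonglongrightarrow> Abs_mop L"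
    by (rule bounded_linear.tendsto[OF bounded_linear_Abs_mop])
  then show "convergent X" by (auto simp: Rep_mop_inverse convergent_def)
qed

lemma Rep_mop_power: "Rep_mop (A ^ k) = mpow (Rep_mop A) k"
  by (induction k) (simp_all add: one_mop.rep_eq times_mop.rep_eq)

lemma mexp_eq_Rep_exp: "mexp A = Rep_mop (exp (Abs_mop A))"
proof -
  have "(\<lambda>k. Rep_mop (Abs_mop A ^ k /\<^sub>R fact k)) sums Rep_mop (exp (Abs_mop A))"
    unfolding exp_def
    by (intro bounded_linear.sums[OF bounded_linear_Rep_mop] summable_sums summable_exp_generic)
  then show ?thesis
    by (simp add: mexp_def scaleR_mop.rep_eq Rep_mop_power Abs_mop_inverse sums_iff inverse_eq_divide)
qed

lemma mexp_0 [simp]: "mexp (0 :: 'n::finite cmat) = mat 1"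
proof -
  have "Abs_mop 0 = (0 :: 'n mop)" by (simp add: zero_mop_def)
  then show ?thesis by (simp add: mexp_eq_Rep_exp one_mop.rep_eq)
qed

lemma Abs_mop_scaleR: "Abs_mop (r *\<^sub>R A) = r *\<^sub>R Abs_mop A"
  by (simp add: scaleR_mop.abs_eq)

lemma mexp_scaleR_add: "mexp ((s + t) *\<^sub>R A) = mexp (s *\<^sub>R A) ** mexp (t *\<^sub>R A)"
proof -
  have "exp ((s + t) *\<^sub>R Abs_mop A) = exp (s *\<^sub>R Abs_mop A) * exp (t *\<^sub>R Abs_mop A)"
    unfolding scaleR_add_left by (rule exp_add_commuting) simp
  then show ?thesis by (simp add: mexp_eq_Rep_exp Abs_mop_scaleR times_mop.rep_eq)
qed

text \<open>The derivative at 0 is put in quotient form because every tangent vector below arises as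
  a limit of difference quotients.\<close>

lemma exp_scaleR_diff_quotient:
  fixes A :: "'a::{real_normed_algebra_1, banach}"
  shows "((\<lambda>t. (exp (t *\<^sub>R A) - 1) /\<^sub>R t) \<longlongrightarrow> A) (at 0)"
proof -
  have "((\<lambda>t. exp (t *\<^sub>R A)) has_derivative (\<lambda>t. t *\<^sub>R A)) (at 0)"
    using exp_scaleR_has_vector_derivative_right[of A 0 UNIV] by (simp add: has_vector_derivative_def)
  then have "((\<lambda>t. norm (exp (t *\<^sub>R A) - 1 - t *\<^sub>R A) / norm t) \<longlongrightarrow> 0) (at 0)"
    by (simp add: has_derivative_at)
  moreover have "\<forall>\<^sub>F t in at 0. norm (exp (t *\<^sub>R A) - 1 - t *\<^sub>R A) / norm t
      = norm ((exp (t *\<^sub>R A) - 1) /\<^sub>R t - A)"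
  proof -
    have "norm (exp (t *\<^sub>R A) - 1 - t *\<^sub>R A) / norm t = norm ((exp (t *\<^sub>R A) - 1) /\<^sub>R t - A)"
      if "t \<noteq> 0" for t
    proof -
      have "(exp (t *\<^sub>R A) - 1) /\<^sub>R t - A = (exp (t *\<^sub>R A) - 1 - t *\<^sub>R A) /\<^sub>R t"
        using that by (simp add: scaleR_diff_right)
      then show ?thesis by (simp add: divide_inverse)
    qed
    then show ?thesis by (auto simp: eventually_at intro: exI[of _ 1])
  qed
  ultimately have "((\<lambda>t. norm ((exp (t *\<^sub>R A) - 1) /\<^sub>R t - A)) \<longlongrightarrow> 0) (at 0)"
    by (rule Lim_transform_eventually)
  then show ?thesis
    by (rule LIM_zero_cancel[OF tendsto_norm_zero_cancel])
qed

text \<open>Telescoping. The point is the factor \<open>M ^ n\<close>: for \<open>M\<close> of size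
  \<open>exp (C / n)\<close> it stays bounded while \<open>n\<close> grows.\<close>

lemma norm_power_diff_le:
  fixes a b :: "'a::real_normed_algebra_1"
  assumes "norm a \<le> M" "norm b \<le> M" "1 \<le> M"
  shows "norm (a ^ n - b ^ n) \<le> real n * M ^ n * norm (a - b)"
proof (induction n)
  case (Suc n)
  have M: "M ^ n \<le> M ^ Suc n" "0 \<le> M ^ n"
    using assms by (auto simp: mult_le_cancel_right1)
  have "norm (b ^ n) \<le> norm b ^ n" by (rule norm_power_ineq)
  also have "\<dots> \<le> M ^ n" using assms by (intro power_mono) auto
  finally have Mb: "norm (b ^ n) \<le> M ^ n" .
  have "a ^ Suc n - b ^ Suc n = a * (a ^ n - b ^ n) + (a - b) * b ^ n"
    by (simp add: algebra_simps)
  also have "norm \<dots> \<le> norm a * norm (a ^ n - b ^ n) + norm (a - b) * norm (b ^ n)"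
    by (intro norm_triangle_mono norm_mult_ineq)
  also have "\<dots> \<le> M * (real n * M ^ n * norm (a - b)) + norm (a - b) * M ^ Suc n"
  proof (rule add_mono)
    show "norm a * norm (a ^ n - b ^ n) \<le> M * (real n * M ^ n * norm (a - b))"
      using assms by (intro mult_mono Suc.IH) auto
    show "norm (a - b) * norm (b ^ n) \<le> norm (a - b) * M ^ Suc n"
      by (rule mult_left_mono[OF order_trans[OF Mb M(1)]]) simp
  qed
  also have "\<dots> = real (Suc n) * M ^ Suc n * norm (a - b)"
    by (simp add: field_simps)
  finally show ?case .
qed simp

lemma exp_scaleR_power:
  fixes x :: "'a::{real_normed_algebra_1, banach}"
  shows "exp (t *\<^sub>R x) ^ k = exp ((real k * t) *\<^sub>R x)"
proof (induction k)
  case (Suc k)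
  have "exp ((real (Suc k) * t) *\<^sub>R x) = exp (t *\<^sub>R x + (real k * t) *\<^sub>R x)"
    by (simp add: algebra_simps)
  also have "\<dots> = exp (t *\<^sub>R x) * exp ((real k * t) *\<^sub>R x)"
    by (rule exp_add_commuting) simp
  finally show ?case unfolding power_Suc Suc.IH by (rule sym)
qed simp

text \<open>The classical limit of \<open>(1 + x / m) ^ m\<close>, with a base known only to first
  order. The comparison sequence \<open>b n = exp (x / m n)\<close> agrees with \<open>a n\<close>
  to that order, and its \<open>m n\<close>-th power is exactly \<open>exp x\<close>.\<close>

lemma power_tendsto_exp:
  fixes a :: "nat \<Rightarrow> 'a::{real_normed_algebra_1, banach}"
  assumes m: "filterlim m at_top sequentially"
    and lim: "(\<lambda>n. real (m n) *\<^sub>R (a n - 1)) \<longlonglongrightarrow> x"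
  shows "(\<lambda>n. a n ^ m n) \<longlonglongrightarrow> exp x"
proof -
  define b where "b n = exp ((1 / real (m n)) *\<^sub>R x)" for n
  have pos: "\<forall>\<^sub>F n in sequentially. 0 < m n"
    by (rule eventually_compose_filterlim[OF eventually_gt_at_top m])
  have inv0: "filterlim (\<lambda>n. 1 / real (m n)) (at 0) sequentially"
  proof -
    have "filterlim (\<lambda>n. real (m n)) at_top sequentially"
      by (rule filterlim_compose[OF filterlim_real_sequentially m])
    then have "(\<lambda>n. 1 / real (m n)) \<longlonglongrightarrow> 0"
      by (intro tendsto_divide_0[OF tendsto_const] filterlim_at_top_imp_at_infinity)
    then show ?thesis
      using pos by (auto simp: filterlim_at elim: eventually_mono)
  qed
  have "(\<lambda>n. (b n - 1) /\<^sub>R (1 / real (m n))) \<longlonglongrightarrow> x"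
    unfolding b_def by (rule filterlim_compose[OF exp_scaleR_diff_quotient inv0])
  then have limb: "(\<lambda>n. real (m n) *\<^sub>R (b n - 1)) \<longlonglongrightarrow> x"
    by (simp add: inverse_eq_divide)
  have bm: "\<forall>\<^sub>F n in sequentially. b n ^ m n = exp x"
    using pos
  proof eventually_elim
    case (elim n)
    then show ?case by (simp add: b_def exp_scaleR_power)
  qed
  \<comment> \<open>The norms of \<open>m n *\<^sub>R (c n - 1)\<close> tend to
    \<open>norm x\<close>, hence are eventually below \<open>C\<close>. Then
    \<open>norm (c n) \<le> 1 + C / m n \<le> exp (C / m n)\<close>, and the \<open>m n\<close>-th
    power of the last term is the fixed bound \<open>exp C\<close>.\<close>
  define C where "C = norm x + 1"
  have le: "\<forall>\<^sub>F n in sequentially. norm (c n) \<le> exp (C / real (m n))"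
    if "(\<lambda>n. real (m n) *\<^sub>R (c n - 1)) \<longlonglongrightarrow> x" for c :: "nat \<Rightarrow> 'a"
  proof -
    have "\<forall>\<^sub>F n in sequentially. norm (real (m n) *\<^sub>R (c n - 1)) < C"
      using order_tendstoD(2)[OF tendsto_norm[OF that]] by (simp add: C_def)
    then show ?thesis
      using pos
    proof eventually_elim
      case (elim n)
      have "norm (c n) \<le> 1 + norm (c n - 1)"
        using norm_triangle_ineq[of 1 "c n - 1"] by simp
      also have "\<dots> \<le> 1 + C / real (m n)"
      proof -
        have "real (m n) * norm (c n - 1) < C"
          using elim(1) unfolding norm_scaleR by simp
        then show ?thesis
          using elim(2) by (simp add: pos_le_divide_eq mult.commute)
      qed
      also have "\<dots> \<le> exp (C / real (m n))"
        by (rule exp_ge_add_one_self)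
      finally show ?case .
    qed
  qed
  have "\<forall>\<^sub>F n in sequentially. norm (a n ^ m n - exp x)
      \<le> exp C * norm (real (m n) *\<^sub>R (a n - 1) - real (m n) *\<^sub>R (b n - 1))"
    using le[OF lim] le[OF limb] pos bm
  proof eventually_elim
    case (elim n)
    have "0 \<le> C" by (simp add: C_def)
    then have "norm (a n ^ m n - b n ^ m n)
        \<le> real (m n) * exp (C / real (m n)) ^ m n * norm (a n - b n)"
      using elim by (intro norm_power_diff_le) auto
    also have "\<dots> = exp C * norm (real (m n) *\<^sub>R (a n - b n))"
      using elim by (simp add: exp_divide_power_eq)
    finally show ?case
      using elim by (simp add: scaleR_diff_right)
  qed
  moreover have "(\<lambda>n. exp C * norm (real (m n) *\<^sub>R (a n - 1) - real (m n) *\<^sub>R (b n - 1))) \<longlonglongrightarrow> exp C * norm (x - x)"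
    by (intro tendsto_intros lim limb)
  ultimately have "(\<lambda>n. norm (a n ^ m n - exp x)) \<longlonglongrightarrow> 0"
    using Lim_null_comparison[of "\<lambda>n. norm (a n ^ m n - exp x)"] by simp
  then show ?thesis
    by (rule LIM_zero_cancel[OF tendsto_norm_zero_cancel])
qed

lemma mpow_tendsto_mexp:
  assumes "filterlim m at_top sequentially"
    and "(\<lambda>n. real (m n) *\<^sub>R (A n - mat 1)) \<longlonglongrightarrow> X"
  shows "(\<lambda>n. mpow (A n) (m n)) \<longlonglongrightarrow> mexp X"
proof -
  have "(\<lambda>n. Abs_mop (real (m n) *\<^sub>R (A n - mat 1))) \<longlonglongrightarrow> Abs_mop X"
    by (rule bounded_linear.tendsto[OF bounded_linear_Abs_mop assms(2)])
  then have "(\<lambda>n. real (m n) *\<^sub>R (Abs_mop (A n) - 1)) \<longlonglongrightarrow> Abs_mop X"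
    by (simp add: Abs_mop_scaleR minus_mop.abs_eq one_mop.abs_eq)
  then have "(\<lambda>n. Rep_mop (Abs_mop (A n) ^ m n)) \<longlonglongrightarrow> Rep_mop (exp (Abs_mop X))"
    by (intro bounded_linear.tendsto[OF bounded_linear_Rep_mop] power_tendsto_exp assms(1))
  then show ?thesis
    by (simp add: mexp_eq_Rep_exp Rep_mop_power Abs_mop_inverse)
qed

lemma mexp_diff_quotient:
  "((\<lambda>t. (mexp (t *\<^sub>R A) - mat 1) /\<^sub>R t) \<longlongrightarrow> A) (at 0)"
  using bounded_linear.tendsto[OF bounded_linear_Rep_mop exp_scaleR_diff_quotient[of "Abs_mop A"]]
  by (simp add: mexp_eq_Rep_exp Abs_mop_scaleR Abs_mop_inverse scaleR_mop.rep_eq minus_mop.rep_eq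
      one_mop.rep_eq)

section \<open>Adjoints\<close>

definition adj :: "'n::finite cmat \<Rightarrow> 'n cmat" where
  "adj A = (\<chi> i j. cnj (A $ j $ i))"

lemma adj_simps [simp]:
  "adj (adj A) = A" "adj (mat 1) = mat 1" "adj 0 = 0"
  "adj (A + B :: 'n::finite cmat) = adj A + adj B" "adj (A - B) = adj A - adj B" "adj (- A) = - adj A"
  "adj (r *\<^sub>R A) = r *\<^sub>R adj A"
  by (simp_all add: adj_def vec_eq_iff mat_def)

lemma adj_csmult: "adj (csmult c A) = csmult (cnj c) (adj A)"
  by (simp add: adj_def csmult_def vec_eq_iff)

lemma adj_mult: "adj ((A :: 'n::finite cmat) ** (B :: 'n cmat)) = adj B ** adj A"
  by (simp add: adj_def matrix_matrix_mult_def vec_eq_iff mult.commute)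

lemma bounded_linear_adj: "bounded_linear (adj :: 'n::finite cmat \<Rightarrow> 'n cmat)"
proof -
  have "linear (adj :: 'n cmat \<Rightarrow> 'n cmat)" by (intro linearI) simp_all
  then show ?thesis by (simp add: linear_conv_bounded_linear)
qed

lemmas tendsto_adj [tendsto_intros] = bounded_linear.tendsto[OF bounded_linear_adj]

lemma inner_cmat: "(A :: 'n::finite cmat) \<bullet> B = Re (\<Sum>i\<in>UNIV. \<Sum>j\<in>UNIV. A $ i $ j * cnj (B $ i $ j))"
  by (simp add: inner_vec_def inner_complex_def)

lemma inner_mult_right: "((A :: 'n::finite cmat) ** (B :: 'n cmat)) \<bullet> C = A \<bullet> (C ** adj B)"
proof -
  have "(\<Sum>j\<in>UNIV. (A ** B) $ i $ j * cnj (C $ i $ j))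
      = (\<Sum>k\<in>UNIV. A $ i $ k * cnj ((C ** adj B) $ i $ k))" for i
    unfolding matrix_matrix_mult_def adj_def
    by (simp add: sum_distrib_left sum_distrib_right)
       (subst sum.swap, simp add: algebra_simps)
  then show ?thesis by (simp add: inner_cmat)
qed

lemma inner_adj: "adj (A :: 'n::finite cmat) \<bullet> adj B = A \<bullet> B"
proof -
  have "adj A \<bullet> adj B = Re (\<Sum>j\<in>UNIV. \<Sum>i\<in>UNIV. cnj (A $ i $ j * cnj (B $ i $ j)))"
    by (simp add: inner_cmat adj_def)
  also have "\<dots> = Re (cnj (\<Sum>i\<in>UNIV. \<Sum>j\<in>UNIV. A $ i $ j * cnj (B $ i $ j)))"
    unfolding cnj_sum by (subst sum.swap) simp
  finally show ?thesis by (simp add: inner_cmat)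
qed

lemma inner_mult_left: "((A :: 'n::finite cmat) ** (B :: 'n cmat)) \<bullet> C = B \<bullet> (adj A ** C)"
proof -
  have "(A ** B) \<bullet> C = adj (A ** B) \<bullet> adj C" by (simp only: inner_adj)
  also have "\<dots> = (adj B ** adj A) \<bullet> adj C" by (simp only: adj_mult)
  also have "\<dots> = adj B \<bullet> (adj C ** A)" by (simp add: inner_mult_right)
  also have "\<dots> = adj B \<bullet> adj (adj A ** C)" by (simp add: adj_mult)
  also have "\<dots> = B \<bullet> (adj A ** C)" by (rule inner_adj)
  finally show ?thesis .
qed

lemma unitary_commute: "U ** adj U = mat 1 \<Longrightarrow> adj U ** U = mat 1"
  by (rule matrix_left_right_inverse1)

lemma norm_mult_unitary:
  fixes U :: "'n::finite cmat"
  assumes "U ** adj U = mat 1"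
  shows "norm (U ** A) = norm A" "norm (A ** U) = norm A"
proof -
  have "(U ** A) \<bullet> (U ** A) = A \<bullet> A"
    using unitary_commute[OF assms] by (simp add: inner_mult_left matrix_mul_assoc)
  then show "norm (U ** A) = norm A" by (simp add: norm_eq)
  have "(A ** U) \<bullet> (A ** U) = A \<bullet> A"
    using assms by (simp add: inner_mult_right flip: matrix_mul_assoc)
  then show "norm (A ** U) = norm A" by (simp add: norm_eq)
qed

section \<open>One-parameter groups\<close>

lemma mpow_homomorphism:
  fixes E :: "real \<Rightarrow> 'n::finite cmat"
  assumes "\<And>s t :: real. E (s + t) = E s ** E t" "E 0 = mat 1"
  shows "mpow (E t) k = E (real k * t)"
  by (induction k) (simp_all add: assms distrib_right flip: assms(1))

text \<open>\<open>E t\<close> is an exact power of \<open>E (t / k)\<close> for every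
  \<open>k > 0\<close>, and by the derivative at 0 such powers tend to
  \<open>mexp (t *\<^sub>R X)\<close>.\<close>

lemma mexp_unique:
  fixes E :: "real \<Rightarrow> 'n::finite cmat"
  assumes hom: "\<And>s t :: real. E (s + t) = E s ** E t" "E 0 = mat 1"
    and lim: "((\<lambda>t. (E t - mat 1) /\<^sub>R t) \<longlongrightarrow> X) (at 0)"
  shows "mexp (t *\<^sub>R X) = E t"
proof (cases "t = 0")
  case False
  \<comment> \<open>The shift to \<open>Suc n\<close> keeps the divisor nonzero, so that the
    identity for powers holds at every index.\<close>
  have "(\<lambda>n. t / real (Suc n)) \<longlonglongrightarrow> 0"
    by (intro tendsto_divide_0[OF tendsto_const] filterlim_at_top_imp_at_infinity
        filterlim_compose[OF filterlim_real_sequentially filterlim_Suc])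
  then have "filterlim (\<lambda>n. t / real (Suc n)) (at 0) sequentially"
    using False by (auto simp: filterlim_at)
  from filterlim_compose[OF lim this]
  have "(\<lambda>n. t *\<^sub>R ((E (t / real (Suc n)) - mat 1) /\<^sub>R (t / real (Suc n)))) \<longlonglongrightarrow> t *\<^sub>R X"
    by (intro tendsto_intros)
  then have "(\<lambda>n. real (Suc n) *\<^sub>R (E (t / real (Suc n)) - mat 1)) \<longlonglongrightarrow> t *\<^sub>R X"
    using False by simp
  from mpow_tendsto_mexp[OF filterlim_Suc this]
  have "(\<lambda>n. mpow (E (t / real (Suc n))) (Suc n)) \<longlonglongrightarrow> mexp (t *\<^sub>R X)" .
  moreover have "mpow (E (t / real (Suc n))) (Suc n) = E t" for n
    by (subst mpow_homomorphism) (simp_all only: hom, simp)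
  ultimately have "(\<lambda>n. E t) \<longlonglongrightarrow> mexp (t *\<^sub>R X)" by (simp only:)
  then show ?thesis by (simp add: LIMSEQ_const_iff)
qed (simp add: hom)

lemma mexp_minus: "mexp (- (A :: 'n::finite cmat)) ** mexp A = mat 1" "mexp A ** mexp (- A) = mat 1"
  using mexp_scaleR_add[of "-1" 1 A] mexp_scaleR_add[of 1 "-1" A] by simp_all

text \<open>The conjugated one-parameter group has derivative \<open>g ** A ** h\<close> at 0, so
  uniqueness identifies it.\<close>

lemma mexp_conj:
  fixes g :: "'n::finite cmat"
  assumes "h ** g = mat 1"
  shows "mexp (g ** A ** h) = g ** mexp A ** h"
proof -
  have gh: "g ** h = mat 1" using assms by (rule matrix_left_right_inverse1)
  have "mexp (1 *\<^sub>R (g ** A ** h)) = g ** mexp (1 *\<^sub>R A) ** h"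
  proof (rule mexp_unique)
    show "g ** mexp ((s + t) *\<^sub>R A) ** h = g ** mexp (s *\<^sub>R A) ** h ** (g ** mexp (t *\<^sub>R A) ** h)"
      for s t :: real
    proof -
      have "g ** mexp (s *\<^sub>R A) ** h ** (g ** mexp (t *\<^sub>R A) ** h)
          = g ** mexp (s *\<^sub>R A) ** (h ** g) ** mexp (t *\<^sub>R A) ** h"
        by (simp only: matrix_mul_assoc)
      then show ?thesis by (simp add: assms mexp_scaleR_add matrix_mul_assoc)
    qed
    show "g ** mexp (0 *\<^sub>R A) ** h = mat 1" by (simp add: gh)
    have "((\<lambda>t. g ** ((mexp (t *\<^sub>R A) - mat 1) /\<^sub>R t) ** h) \<longlongrightarrow> g ** A ** h) (at 0)"
      by (intro mm.tendsto tendsto_const mexp_diff_quotient)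
    then show "((\<lambda>t. (g ** mexp (t *\<^sub>R A) ** h - mat 1) /\<^sub>R t) \<longlongrightarrow> g ** A ** h) (at 0)"
      by (simp add: mat_ring gh)
  qed
  then show ?thesis by simp
qed

lemma sequentially_inverse_Suc: "filterlim (\<lambda>n. inverse (real (Suc n))) (at 0) sequentially"
  using LIMSEQ_inverse_real_of_nat by (auto simp: filterlim_at)

lemma diff_quotient_mult:
  fixes q :: "'n::finite cmat"
  assumes "t \<noteq> 0"
  shows "((mat 1 + t *\<^sub>R q) ** (mat 1 + t *\<^sub>R r) - mat 1) /\<^sub>R t = q + r + t *\<^sub>R (q ** r)"
  using assms by (simp add: mat_ring scaleR_add_right)

lemma Lim_transform_at_0:
  fixes f g :: "real \<Rightarrow> 'a::topological_space"
  assumes "(f \<longlongrightarrow> l) (at 0)" "\<And>t. t \<noteq> 0 \<Longrightarrow> f t = g t"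
  shows "(g \<longlongrightarrow> l) (at 0)"
  by (rule Lim_transform_eventually[OF assms(1)]) (simp add: eventually_at_filter assms(2))

section \<open>Closed groups of unitary matrices\<close>

text \<open>Inverses are expressed by \<open>adj\<close>. This map is continuous and linear over the
  reals, so the group laws pass to closures and inverses can be differentiated easily.\<close>

locale closed_unitary_group =
  fixes G :: "'n::finite cmat set"
  assumes closed: "closed G"
    and one_mem: "mat 1 \<in> G"
    and mult_mem: "A \<in> G \<Longrightarrow> B \<in> G \<Longrightarrow> A ** B \<in> G"
    and adj_mem: "A \<in> G \<Longrightarrow> adj A \<in> G"
    and unitary: "A \<in> G \<Longrightarrow> A ** adj A = mat 1"
begin

lemma mpow_mem: "A \<in> G \<Longrightarrow> mpow A k \<in> G"
  by (induction k) (simp_all add: one_mem mult_mem)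

lemma mexp_mem: "X \<in> lie_algebra_of G \<Longrightarrow> mexp (t *\<^sub>R X) \<in> G"
  by (simp add: lie_algebra_of_def)

text \<open>If \<open>m\<^sub>n \<epsilon>\<^sub>n\<close> tends to t, then the powers \<open>\<kappa>\<^sub>n ^ m\<^sub>n\<close> tend to \<open>exp (t X)\<close>.\<close>

lemma tangent_mem_lie_algebra:
  assumes \<kappa>: "\<And>n. \<kappa> n \<in> G" and pos: "\<And>n. 0 < \<epsilon> n" and \<epsilon>: "\<epsilon> \<longlonglongrightarrow> 0"
    and lim: "(\<lambda>n. (\<kappa> n - mat 1) /\<^sub>R \<epsilon> n) \<longlonglongrightarrow> X"
  shows "X \<in> lie_algebra_of G"
proof -
  have mexp_pos: "mexp (t *\<^sub>R X) \<in> G" if "0 < t" for t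
  proof -
    \<comment> \<open>Rounding down places \<open>m n * \<epsilon> n\<close> between
      \<open>t - \<epsilon> n\<close> and \<open>t\<close>.\<close>
    define m where "m n = nat \<lfloor>t / \<epsilon> n\<rfloor>" for n
    have bounds: "t / \<epsilon> n - 1 \<le> real (m n)" "real (m n) \<le> t / \<epsilon> n" for n
    proof -
      have "0 \<le> \<lfloor>t / \<epsilon> n\<rfloor>" using that pos[of n] by simp
      then have "real (m n) = of_int \<lfloor>t / \<epsilon> n\<rfloor>" by (simp add: m_def)
      then show "t / \<epsilon> n - 1 \<le> real (m n)" "real (m n) \<le> t / \<epsilon> n" by linarith+
    qed
    have "filterlim (\<lambda>n. t * inverse (\<epsilon> n)) at_top sequentially"
      using that pos
      by (intro filterlim_tendsto_pos_mult_at_top[OF tendsto_const] filterlim_inverse_at_top \<epsilon>) auto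
    then have "filterlim (\<lambda>n. t / \<epsilon> n) at_top sequentially"
      by (simp only: divide_inverse)
    then have "filterlim (\<lambda>n. - 1 + t / \<epsilon> n) at_top sequentially"
      by (intro filterlim_tendsto_add_at_top[OF tendsto_const])
    then have "filterlim (\<lambda>n. real (m n)) at_top sequentially"
      by (rule filterlim_at_top_mono) (use bounds in \<open>simp add: algebra_simps\<close>)
    then have m: "filterlim m at_top sequentially"
      by (simp add: filterlim_sequentially_iff_filterlim_real)
    have m\<epsilon>: "(\<lambda>n. real (m n) * \<epsilon> n) \<longlonglongrightarrow> t"
    proof (rule tendsto_sandwich)
      show "(\<lambda>n. t - \<epsilon> n) \<longlonglongrightarrow> t" using tendsto_diff[OF tendsto_const \<epsilon>, of t] by simp
      show "\<forall>\<^sub>F n in sequentially. t - \<epsilon> n \<le> real (m n) * \<epsilon> n"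
        using bounds(1) pos by (auto simp: field_simps intro!: always_eventually)
      show "\<forall>\<^sub>F n in sequentially. real (m n) * \<epsilon> n \<le> t"
        using bounds(2) pos by (auto simp: field_simps intro!: always_eventually)
    qed (rule tendsto_const)
    have "(\<lambda>n. (real (m n) * \<epsilon> n) *\<^sub>R ((\<kappa> n - mat 1) /\<^sub>R \<epsilon> n)) \<longlonglongrightarrow> t *\<^sub>R X"
      by (intro tendsto_scaleR m\<epsilon> lim)
    moreover have "(real (m n) * \<epsilon> n) *\<^sub>R ((\<kappa> n - mat 1) /\<^sub>R \<epsilon> n) = real (m n) *\<^sub>R (\<kappa> n - mat 1)" for n
      using pos[of n] by simp
    ultimately have "(\<lambda>n. real (m n) *\<^sub>R (\<kappa> n - mat 1)) \<longlonglongrightarrow> t *\<^sub>R X" by (simp only:)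
    from mpow_tendsto_mexp[OF m this] show ?thesis
      by (rule closed_sequentially[OF closed, rotated]) (simp add: mpow_mem \<kappa>)
  qed
  have "mexp (t *\<^sub>R X) \<in> G" for t
  proof (cases t "0 :: real" rule: linorder_cases)
    \<comment> \<open>For negative times the matrix is the inverse, hence the adjoint, of an element
      already treated.\<close>
    case less
    then have "mexp (- (t *\<^sub>R X)) \<in> G" using mexp_pos[of "- t"] by simp
    moreover from this have "mexp (t *\<^sub>R X) = adj (mexp (- (t *\<^sub>R X)))"
      using unitary mexp_minus[of "t *\<^sub>R X"] by (metis matrix_mul_assoc matrix_mul_lid matrix_mul_rid)
    ultimately show ?thesis using adj_mem by simp
  qed (use mexp_pos one_mem in auto)
  then show ?thesis by (simp add: lie_algebra_of_def)
qed

lemma curve_tangent_mem: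
  assumes \<kappa>: "\<And>t :: real. \<kappa> t \<in> G" and lim: "((\<lambda>t. (\<kappa> t - mat 1) /\<^sub>R t) \<longlongrightarrow> X) (at 0)"
  shows "X \<in> lie_algebra_of G"
  using tangent_mem_lie_algebra[of "\<lambda>n. \<kappa> (inverse (real (Suc n)))", OF \<kappa> _ LIMSEQ_inverse_real_of_nat
      filterlim_compose[OF lim sequentially_inverse_Suc]]
  by simp

text \<open>Additivity is the substantial part: the curve
  \<open>mexp (t *\<^sub>R X) ** mexp (t *\<^sub>R Y)\<close> stays in \<open>G\<close>, and its
  tangent at 0 is \<open>X + Y\<close>.\<close>

lemma subspace_lie_algebra: "subspace (lie_algebra_of G)"
  unfolding subspace_def
proof (intro conjI ballI allI)
  show "0 \<in> lie_algebra_of G" by (simp add: lie_algebra_of_def one_mem)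
next
  fix X c assume "X \<in> lie_algebra_of G"
  then show "c *\<^sub>R X \<in> lie_algebra_of G" by (simp add: lie_algebra_of_def)
next
  fix X Y assume XY: "X \<in> lie_algebra_of G" "Y \<in> lie_algebra_of G"
  show "X + Y \<in> lie_algebra_of G"
  proof (rule curve_tangent_mem)
    show "mexp (t *\<^sub>R X) ** mexp (t *\<^sub>R Y) \<in> G" for t
      using XY by (simp add: mult_mem mexp_mem)
    let ?q = "\<lambda>Z t. (mexp (t *\<^sub>R Z) - mat 1) /\<^sub>R t"
    have "((\<lambda>t. ?q X t + ?q Y t + t *\<^sub>R (?q X t ** ?q Y t)) \<longlongrightarrow> X + Y + 0 *\<^sub>R (X ** Y)) (at 0)"
      by (intro tendsto_intros mm.tendsto mexp_diff_quotient)
    then have "((\<lambda>t. ?q X t + ?q Y t + t *\<^sub>R (?q X t ** ?q Y t)) \<longlongrightarrow> X + Y) (at 0)" by simp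
    then show "((\<lambda>t. (mexp (t *\<^sub>R X) ** mexp (t *\<^sub>R Y) - mat 1) /\<^sub>R t) \<longlongrightarrow> X + Y) (at 0)"
    proof (rule Lim_transform_at_0)
      show "?q X t + ?q Y t + t *\<^sub>R (?q X t ** ?q Y t)
        = (mexp (t *\<^sub>R X) ** mexp (t *\<^sub>R Y) - mat 1) /\<^sub>R t" if "t \<noteq> 0" for t
        using diff_quotient_mult[OF that, of "?q X t" "?q Y t"] that by simp
    qed
  qed
qed

lemma lie_algebra_conj_mem:
  assumes "U ** adj U = mat 1" "\<And>A. A \<in> G \<Longrightarrow> U ** A ** adj U \<in> G" "X \<in> lie_algebra_of G"
  shows "U ** X ** adj U \<in> lie_algebra_of G"
  unfolding lie_algebra_of_def
proof (intro CollectI allI)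
  fix t :: real
  have "mexp (U ** (t *\<^sub>R X) ** adj U) = U ** mexp (t *\<^sub>R X) ** adj U"
    by (rule mexp_conj[OF unitary_commute[OF assms(1)]])
  then show "mexp (t *\<^sub>R (U ** X ** adj U)) \<in> G"
    using assms(2)[OF mexp_mem[OF assms(3), of t]] by (simp add: mat_ring)
qed

text \<open>Differentiate the unitarity relation along the one-parameter group at 0.\<close>

lemma lie_algebra_skew:
  assumes "X \<in> lie_algebra_of G"
  shows "adj X = - X"
proof -
  let ?q = "\<lambda>t. (mexp (t *\<^sub>R X) - mat 1) /\<^sub>R t"
  have "((\<lambda>t. ?q t ** adj (mexp (t *\<^sub>R X)) + adj (?q t)) \<longlongrightarrow> X ** adj (mat 1) + adj X) (at 0)"
  proof (intro tendsto_intros mm.tendsto mexp_diff_quotient)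
    have "((\<lambda>t. t *\<^sub>R ?q t + mat 1) \<longlongrightarrow> 0 *\<^sub>R X + mat 1) (at 0)"
      by (intro tendsto_intros mexp_diff_quotient)
    then have "((\<lambda>t. t *\<^sub>R ?q t + mat 1) \<longlongrightarrow> mat 1) (at 0)" by simp
    then show "((\<lambda>t. mexp (t *\<^sub>R X)) \<longlongrightarrow> mat 1) (at 0)"
      by (rule Lim_transform_at_0) simp
  qed
  moreover have "?q t ** adj (mexp (t *\<^sub>R X)) + adj (?q t) = 0" for t
    using unitary[OF mexp_mem[OF assms, of t]] by (simp add: mat_ring algebra_simps flip: scaleR_add_right)
  ultimately have "X + adj X = 0"
    by (simp add: tendsto_const_iff)
  then show ?thesis by (simp add: eq_neg_iff_add_eq_0 add.commute)
qed

lemma adj_mexp: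
  assumes "X \<in> lie_algebra_of G"
  shows "adj (mexp (t *\<^sub>R X)) = mexp (- (t *\<^sub>R X))"
  using unitary[OF mexp_mem[OF assms, of t]] mexp_minus[of "t *\<^sub>R X"]
  by (metis matrix_mul_assoc matrix_mul_lid matrix_mul_rid)

lemma mexp_conj_mem: 
  assumes "X \<in> lie_algebra_of G" "Y \<in> lie_algebra_of G"
  shows "mexp (t *\<^sub>R X) ** Y ** mexp (- (t *\<^sub>R X)) \<in> lie_algebra_of G"
  unfolding adj_mexp[OF assms(1), symmetric]
proof (rule lie_algebra_conj_mem[OF _ _ assms(2)])
  have X: "mexp (t *\<^sub>R X) \<in> G" by (rule mexp_mem[OF assms(1)])
  then show "mexp (t *\<^sub>R X) ** adj (mexp (t *\<^sub>R X)) = mat 1" by (rule unitary)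
  show "mexp (t *\<^sub>R X) ** A ** adj (mexp (t *\<^sub>R X)) \<in> G" if "A \<in> G" for A
    by (intro mult_mem X that adj_mem)
qed

end

text \<open>The derivative of the adjoint action Ad(exp tX) at 0 is ad X; the quadratic remainder
  carries a factor \<open>t\<close>.\<close>

lemma mexp_conj_diff_quotient:
  fixes X :: "'n::finite cmat"
  shows   "((\<lambda>t. (mexp (t *\<^sub>R X) ** Y ** mexp (- (t *\<^sub>R X)) - Y) /\<^sub>R t) \<longlongrightarrow> comm X Y) (at 0)"
proof -
  let ?q = "\<lambda>t. (mexp (t *\<^sub>R X) - mat 1) /\<^sub>R t"
  let ?r = "\<lambda>t. (mexp (t *\<^sub>R (- X)) - mat 1) /\<^sub>R t"
  have "((\<lambda>t. ?q t ** Y + Y ** ?r t + t *\<^sub>R (?q t ** Y ** ?r t))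
      \<longlongrightarrow> X ** Y + Y ** (- X) + 0 *\<^sub>R (X ** Y ** (- X))) (at 0)"
    by (intro tendsto_intros mm.tendsto mexp_diff_quotient)
  moreover have "?q t ** Y + Y ** ?r t + t *\<^sub>R (?q t ** Y ** ?r t)
      = (mexp (t *\<^sub>R X) ** Y ** mexp (- (t *\<^sub>R X)) - Y) /\<^sub>R t"
    if "t \<noteq> 0" for t
  proof -
    have "(((mat 1 + t *\<^sub>R q) ** Y ** (mat 1 + t *\<^sub>R r) - Y) /\<^sub>R t)
        = q ** Y + Y ** r + t *\<^sub>R (q ** Y ** r)" for q r
      using that by (simp add: mat_ring scaleR_add_right)
    from this[of "?q t" "?r t"] show ?thesis using that by simp
  qed
  ultimately have "((\<lambda>t. (mexp (t *\<^sub>R X) ** Y ** mexp (- (t *\<^sub>R X)) - Y) /\<^sub>R t)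
      \<longlongrightarrow> X ** Y + Y ** (- X) + 0 *\<^sub>R (X ** Y ** (- X))) (at 0)"
    by (rule Lim_transform_at_0)
  then show ?thesis by (simp add: comm_def mat_ring)
qed

text \<open>The difference quotients of the conjugates of \<open>Y\<close> stay in \<open>H\<close>,
  and a subspace of a finite-dimensional space is closed.\<close>

lemma subspace_comm_mem:
  assumes "subspace H" and "Y \<in> H" and "\<And>t. mexp (t *\<^sub>R X) ** Y ** mexp (- (t *\<^sub>R X)) \<in> H"
  shows "comm X Y \<in> H"
proof (rule closed_sequentially[OF closed_subspace[OF assms(1)] _
      filterlim_compose[OF mexp_conj_diff_quotient sequentially_inverse_Suc]])
  show "(mexp (inverse (real (Suc n)) *\<^sub>R X) ** Y ** mexp (- (inverse (real (Suc n)) *\<^sub>R X)) - Y) /\<^sub>R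
      inverse (real (Suc n)) \<in> H" for n
    using assms by (intro subspace_scale subspace_diff) auto
qed

lemma (in closed_unitary_group) bracket_closed_lie_algebra: "bracket_closed (lie_algebra_of G)"
  unfolding bracket_closed_def
  by (intro ballI subspace_comm_mem[OF subspace_lie_algebra] mexp_conj_mem) auto

lemma real_subspace_iff: "real_subspace L \<longleftrightarrow> subspace L"
  by (simp add: real_subspace_def subspace_def)

section \<open>Circle subgroups\<close>

text \<open>For \<open>Y\<close> with square -1 this is the exponential of
  \<open>t *\<^sub>R Y\<close> in closed form, so that trigonometric identities replace power
  series.\<close>

definition circ :: "'n::finite cmat \<Rightarrow> real \<Rightarrow> 'n cmat" where
  "circ Y t = cos t *\<^sub>R mat 1 + sin t *\<^sub>R Y"

lemma circ_0 [simp]: "circ Y 0 = mat 1"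
  by (simp add: circ_def)

lemma circ_add:
  assumes "Y ** Y = - mat 1"
  shows "circ Y (s + t) = circ Y s ** circ Y t"
  by (simp add: circ_def mat_ring assms cos_add sin_add algebra_simps)

lemma circ_minus:
  assumes "Y ** Y = - mat 1"
  shows "circ Y t ** circ Y (- t) = mat 1"
  using circ_add[OF assms, of t "- t"] by simp

lemma adj_circ: "adj Y = - Y \<Longrightarrow> adj (circ Y t) = circ Y (- t)"
  by (simp add: circ_def)

lemma circ_conj:
  fixes g :: "'n::finite cmat"
  assumes "g ** h = mat 1"
  shows "g ** circ Y t ** h = circ (g ** Y ** h) t"
  by (simp add: circ_def mat_ring assms)

lemma circ_conj_square:
  fixes g :: "'n::finite cmat"
  assumes "h ** g = mat 1" "Y ** Y = - mat 1"
  shows "(g ** Y ** h) ** (g ** Y ** h) = - mat 1"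
proof -
  have "(g ** Y ** h) ** (g ** Y ** h) = g ** Y ** (h ** g) ** Y ** h"
    by (simp only: matrix_mul_assoc)
  also have "\<dots> = g ** (Y ** Y) ** h"
    by (simp add: assms(1) matrix_mul_assoc)
  also have "\<dots> = - (g ** h)"
    by (simp add: assms(2) mat_ring)
  also have "g ** h = mat 1"
    using assms(1) by (rule matrix_left_right_inverse1)
  finally show ?thesis .
qed

lemma mexp_eq_circ:
  assumes "Y ** Y = - mat 1"
  shows "mexp (t *\<^sub>R Y) = circ Y t"
proof (rule mexp_unique)
  show "circ Y (s + t) = circ Y s ** circ Y t" for s t by (rule circ_add[OF assms])
  have c: "((\<lambda>t. (cos t - 1) / t) \<longlongrightarrow> 0) (at (0 :: real))"
    using DERIV_cos[of "0 :: real"] by (simp add: DERIV_def)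
  have s: "((\<lambda>t. sin t / t) \<longlongrightarrow> 1) (at (0 :: real))"
    using DERIV_sin[of "0 :: real"] by (simp add: DERIV_def)
  have "((\<lambda>t. ((cos t - 1) / t) *\<^sub>R mat 1 + (sin t / t) *\<^sub>R Y) \<longlongrightarrow> 0 *\<^sub>R mat 1 + 1 *\<^sub>R Y) (at 0)"
    by (intro tendsto_intros c s)
  moreover have "((cos t - 1) / t) *\<^sub>R mat 1 + (sin t / t) *\<^sub>R Y = (circ Y t - mat 1) /\<^sub>R t" for t
    by (simp add: circ_def divide_inverse algebra_simps)
  ultimately show "((\<lambda>t. (circ Y t - mat 1) /\<^sub>R t) \<longlongrightarrow> Y) (at 0)" by simp
qed simp

text \<open>Multiplication by generators on one side suffices for a group when each
  \<open>Y s\<close> has square -1: then \<open>circ (Y s) (- t)\<close> inverts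
  \<open>circ (Y s) t\<close>.\<close>

inductive_set circ_group :: "('i \<Rightarrow> 'n::finite cmat) \<Rightarrow> 'n cmat set" for Y where
  one: "mat 1 \<in> circ_group Y"
| step: "A \<in> circ_group Y \<Longrightarrow> circ (Y s) t ** A \<in> circ_group Y"

lemma circ_mem_circ_group: "circ (Y s) t \<in> circ_group Y"
  using circ_group.step[OF circ_group.one, of Y s t] by simp

lemma circ_group_mult:
  assumes "A \<in> circ_group Y" "B \<in> circ_group Y"
  shows "A ** B \<in> circ_group Y"
  using assms by (induction A) (auto simp: circ_group.step simp flip: matrix_mul_assoc)

text \<open>Moving the angle of the leading factor to 0 deletes that factor. By induction every
  element shares with \<open>mat 1\<close> a connected subset of the group.\<close>

lemma connected_circ_group: "connected (circ_group Y)"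
proof -
  have "\<exists>C. connected C \<and> C \<subseteq> circ_group Y \<and> mat 1 \<in> C \<and> A \<in> C" if "A \<in> circ_group Y" for A
    using that
  proof induction
    case one
    show ?case using circ_group.one by (intro exI[of _ "{mat 1}"]) auto
  next
    case (step A s t)
    then obtain C where C: "connected C" "C \<subseteq> circ_group Y" "mat 1 \<in> C" "A \<in> C" by blast
    define D where "D = range (\<lambda>\<tau>. circ (Y s) \<tau> ** A)"
    have "continuous_on UNIV (\<lambda>\<tau>. circ (Y s) \<tau> ** A)"
      unfolding circ_def by (intro mm.continuous_on continuous_intros)
    then have "connected D"
      unfolding D_def by (rule connected_continuous_image) (rule connected_UNIV)
    moreover have "A \<in> D" unfolding D_def by (rule image_eqI[of _ _ 0]) simp_all
    moreover have "D \<subseteq> circ_group Y" using step by (auto simp: D_def circ_group.step)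
    moreover have "circ (Y s) t ** A \<in> D" by (auto simp: D_def)
    ultimately show ?case
      using C by (intro exI[of _ "C \<union> D"]) (auto intro!: connected_Un)
  qed
  then have "circ_group Y = \<Union> {C. connected C \<and> C \<subseteq> circ_group Y \<and> mat 1 \<in> C}" by blast
  moreover have "connected (\<Union> {C. connected C \<and> C \<subseteq> circ_group Y \<and> mat 1 \<in> C})"
    by (rule connected_Union) auto
  ultimately show ?thesis by simp
qed

lemma adj_circ_group:
  assumes "\<And>s. adj (Y s) = - Y s" "A \<in> circ_group Y"
  shows "adj A \<in> circ_group Y"
  using assms(2)
proof induction
  case (step A s t)
  then show ?case by (simp add: adj_mult adj_circ assms(1) circ_group_mult circ_mem_circ_group)
qed (simp add: circ_group.one)

lemma unitary_circ_group:
  assumes "\<And>s. Y s ** Y s = - mat 1" "\<And>s. adj (Y s) = - Y s" "A \<in> circ_group Y"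
  shows "A ** adj A = mat 1"
  using assms(3)
proof induction
  case (step A s t)
  have "circ (Y s) t ** A ** adj (circ (Y s) t ** A) = circ (Y s) t ** (A ** adj A) ** circ (Y s) (- t)"
    by (simp only: adj_mult adj_circ[OF assms(2)] matrix_mul_assoc)
  then show ?case by (simp add: step circ_minus[OF assms(1)])
qed simp

lemma closure_mult_mem:
  fixes \<Gamma> :: "'n::finite cmat set"
  assumes mult: "\<And>A B. A \<in> \<Gamma> \<Longrightarrow> B \<in> \<Gamma> \<Longrightarrow> A ** B \<in> \<Gamma>"
    and AB: "A \<in> closure \<Gamma>" "B \<in> closure \<Gamma>"
  shows "A ** B \<in> closure \<Gamma>"
proof -
  obtain a where a: "\<forall>n. a n \<in> \<Gamma>" "a \<longlonglongrightarrow> A"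
    using iffD1[OF closure_sequential AB(1)] by blast
  obtain b where b: "\<forall>n. b n \<in> \<Gamma>" "b \<longlonglongrightarrow> B"
    using iffD1[OF closure_sequential AB(2)] by blast
  have "(\<lambda>n. a n ** b n) \<longlonglongrightarrow> A ** B" by (intro mm.tendsto a b)
  moreover have "\<forall>n. a n ** b n \<in> \<Gamma>" using a b mult by simp
  ultimately show ?thesis
    by (intro iffD2[OF closure_sequential] exI[of _ "\<lambda>n. a n ** b n"] conjI)
qed

text \<open>Products and adjoints are continuous and unitarity is a closed condition, so everything
  survives sequential limits.\<close>

lemma closed_unitary_group_closure:
  fixes \<Gamma> :: "'n::finite cmat set"
  assumes one: "mat 1 \<in> \<Gamma>" and mult: "\<And>A B. A \<in> \<Gamma> \<Longrightarrow> B \<in> \<Gamma> \<Longrightarrow> A ** B \<in> \<Gamma>"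
    and adj: "\<And>A. A \<in> \<Gamma> \<Longrightarrow> adj A \<in> \<Gamma>" and unitary: "\<And>A. A \<in> \<Gamma> \<Longrightarrow> A ** adj A = mat 1"
  shows "closed_unitary_group (closure \<Gamma>)"
proof
  show "closed (closure \<Gamma>)" "mat 1 \<in> closure \<Gamma>"
    using one closure_subset by auto
  show "A ** B \<in> closure \<Gamma>" if "A \<in> closure \<Gamma>" "B \<in> closure \<Gamma>" for A B
    using mult that by (rule closure_mult_mem)
  show "adj A \<in> closure \<Gamma>" "A ** adj A = mat 1" if A: "A \<in> closure \<Gamma>" for A
  proof -
    obtain a where a: "\<forall>n. a n \<in> \<Gamma>" "a \<longlonglongrightarrow> A"
      using iffD1[OF closure_sequential A] by blast
    have adjA: "(\<lambda>n. adj (a n)) \<longlonglongrightarrow> adj A" by (intro tendsto_intros a)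
    moreover have "\<forall>n. adj (a n) \<in> \<Gamma>" using a adj by simp
    ultimately show "adj A \<in> closure \<Gamma>"
      by (intro iffD2[OF closure_sequential] exI[of _ "\<lambda>n. adj (a n)"] conjI)
    have "(\<lambda>n. a n ** adj (a n)) \<longlonglongrightarrow> A ** adj A" by (intro mm.tendsto a adjA)
    then show "A ** adj A = mat 1" by (simp add: unitary a(1) LIMSEQ_const_iff)
  qed
qed

section \<open>Generated Lie algebras\<close>

lemma subspace_real_lie_gen: "subspace (real_lie_gen X)"
  unfolding real_lie_gen_def by (intro subspace_Inter) (auto simp: real_subspace_iff)

lemma bracket_closed_real_lie_gen: "bracket_closed (real_lie_gen X)"
  unfolding real_lie_gen_def bracket_closed_def by blast

lemma real_lie_gen_superset: "X \<subseteq> real_lie_gen X"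
  unfolding real_lie_gen_def by blast

lemma real_lie_gen_least: "X \<subseteq> L \<Longrightarrow> subspace L \<Longrightarrow> bracket_closed L \<Longrightarrow> real_lie_gen X \<subseteq> L"
  unfolding real_lie_gen_def by (auto simp: real_subspace_iff)

text \<open>For Y with square -1, conjugation by Y is a polynomial in ad Y.\<close>

lemma sandwich_mem:
  assumes L: "subspace L" "bracket_closed L" and Y: "Y ** Y = - mat 1" "Y \<in> L" and Z: "Z \<in> L"
  shows "Y ** Z ** Y \<in> L"
proof -
  have "comm Y (comm Y Z) = Y ** Y ** Z - (Y ** Z ** Y + Y ** Z ** Y) + Z ** (Y ** Y)"
    by (simp add: comm_def mat_ring)
  also have "\<dots> = (- 2) *\<^sub>R Z - 2 *\<^sub>R (Y ** Z ** Y)"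
    by (simp only: Y mm.minus_left mm.minus_right matrix_mul_lid matrix_mul_rid scaleR_2
        scaleR_minus_left) simp
  finally have "Y ** Z ** Y = - Z - (1 / 2) *\<^sub>R comm Y (comm Y Z)"
    by (simp add: scaleR_diff_right)
  moreover have "comm Y (comm Y Z) \<in> L"
    using L Y Z unfolding bracket_closed_def by blast
  ultimately show ?thesis
    using L(1) Z by (auto intro!: subspace_diff subspace_neg subspace_scale)
qed

text \<open>Expanding the conjugation leaves only \<open>Z\<close>, \<open>comm Y Z\<close> and the
  sandwich \<open>Y ** Z ** Y\<close>, all of which lie in \<open>L\<close>.\<close>

lemma circ_conj_mem:
  assumes L: "subspace L" "bracket_closed L" and Y: "Y ** Y = - mat 1" "Y \<in> L" and Z: "Z \<in> L"
  shows "circ Y t ** Z ** circ Y (- t) \<in> L"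
proof -
  have "circ Y t ** Z ** circ Y (- t)
      = (cos t * cos t) *\<^sub>R Z + (sin t * cos t) *\<^sub>R comm Y Z - (sin t * sin t) *\<^sub>R (Y ** Z ** Y)"
    by (simp add: circ_def comm_def mat_ring algebra_simps)
  moreover have "comm Y Z \<in> L"
    using L Y Z unfolding bracket_closed_def by blast
  ultimately show ?thesis
    using L(1) Z sandwich_mem[OF assms] by (auto intro!: subspace_diff subspace_add subspace_scale)
qed

section \<open>Schur's lemma for skew-Hermitian matrices\<close>

lemma inner_matrix_vector_mult: "(A *v v) \<bullet> w = v \<bullet> (adj A *v (w :: complex^'n::finite))"
proof -
  have cart: "x \<bullet> y = Re (\<Sum>i\<in>UNIV. x $ i * cnj (y $ i))" for x y :: "complex^'n"
    by (simp add: inner_vec_def inner_complex_def)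
  have "(\<Sum>i\<in>UNIV. (A *v v) $ i * cnj (w $ i)) = (\<Sum>j\<in>UNIV. v $ j * cnj ((adj A *v w) $ j))"
    unfolding matrix_vector_mult_def adj_def
    by (simp add: sum_distrib_left sum_distrib_right) (subst sum.swap, simp add: algebra_simps)
  then show ?thesis by (simp only: cart)
qed

text \<open>A maximiser of the Rayleigh quotient is an eigenvector.\<close>

lemma hermitian_eigenvector:
  fixes A :: "'n::finite cmat"
  assumes A: "adj A = A"
  obtains \<mu> :: real and v where "v \<noteq> 0" "A *v v = \<mu> *\<^sub>R v"
proof -
  let ?S = "sphere (0 :: complex^'n) 1"
  have "axis undefined 1 \<in> ?S" by simp
  then have ne: "?S \<noteq> {}" by blast
  have cont: "continuous_on ?S (\<lambda>v. (A *v v) \<bullet> v)"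
    by (intro continuous_intros mv.continuous_on)
  obtain v where v: "v \<in> ?S" "\<And>w. w \<in> ?S \<Longrightarrow> (A *v w) \<bullet> w \<le> (A *v v) \<bullet> v"
    using continuous_attains_sup[OF compact_sphere ne cont] by blast
  define \<mu> where "\<mu> = (A *v v) \<bullet> v"
  have vv: "v \<bullet> v = 1" using v(1) by (simp add: norm_eq_1)
  have bound: "(A *v w) \<bullet> w \<le> \<mu> * (w \<bullet> w)" for w
  proof (cases "w = 0")
    case False
    then have "(A *v (w /\<^sub>R norm w)) \<bullet> (w /\<^sub>R norm w) \<le> \<mu>"
      unfolding \<mu>_def by (intro v(2)) simp
    then have "(A *v w) \<bullet> w / (norm w)\<^sup>2 \<le> \<mu>"
      by (simp add: mv.scaleR_right power2_eq_square divide_inverse mult_ac)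
    then show ?thesis using False by (simp add: power2_norm_eq_inner divide_le_eq)
  qed simp
  \<comment> \<open>The residual \<open>r\<close> is half the gradient of the quotient at
    \<open>v\<close>; if it were nonzero, moving \<open>v\<close> in its direction would increase
    the quotient.\<close>
  define r where "r = A *v v - \<mu> *\<^sub>R v"
  have "r \<bullet> r = 0"
  proof (rule ccontr)
    assume "r \<bullet> r \<noteq> 0"
    then have pos: "0 < r \<bullet> r" by simp
    define q where "q = \<mu> * (r \<bullet> r) - (A *v r) \<bullet> r"
    have "2 * t * (r \<bullet> r) \<le> t * t * q" for t
    proof -
      have sym: "(A *v r) \<bullet> v = (A *v v) \<bullet> r"
        by (metis A inner_commute inner_matrix_vector_mult)
      have "(A *v (v + t *\<^sub>R r)) \<bullet> (v + t *\<^sub>R r)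
          = \<mu> + 2 * t * ((A *v v) \<bullet> r) + t * t * ((A *v r) \<bullet> r)"
        by (simp add: mv.add_right mv.scaleR_right inner_add_left inner_add_right sym \<mu>_def
            algebra_simps)
      moreover have "(v + t *\<^sub>R r) \<bullet> (v + t *\<^sub>R r) = 1 + 2 * t * (v \<bullet> r) + t * t * (r \<bullet> r)"
        by (simp add: inner_add_left inner_add_right vv algebra_simps inner_commute)
      moreover have "(A *v v) \<bullet> r = r \<bullet> r + \<mu> * (v \<bullet> r)"
        by (simp add: r_def inner_diff_left)
      ultimately show ?thesis
        using bound[of "v + t *\<^sub>R r"] by (simp add: q_def algebra_simps)
    qed
    note quadratic = this
    \<comment> \<open>Chosen so that \<open>t * (1 + \<bar>q\<bar>) = r \<bullet> r\<close>. Then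
      \<open>t * q\<close> is at most \<open>r \<bullet> r\<close>, against the lower bound
      \<open>2 * (r \<bullet> r)\<close>.\<close>
    define t where "t = (r \<bullet> r) / (1 + \<bar>q\<bar>)"
    have "0 < t" using pos by (simp add: t_def add_pos_nonneg)
    have "t * (2 * (r \<bullet> r)) \<le> t * (t * q)" using quadratic[of t] by (simp add: mult_ac)
    then have "2 * (r \<bullet> r) \<le> t * q" using \<open>0 < t\<close> by simp
    also have "\<dots> \<le> t * (1 + \<bar>q\<bar>)" using \<open>0 < t\<close> by (intro mult_left_mono) auto
    also have "\<dots> = r \<bullet> r"
    proof -
      have "1 + \<bar>q\<bar> \<noteq> 0" by linarith
      then show ?thesis by (simp add: t_def)
    qed
    finally show False using pos by simp
  qed
  then have "A *v v = \<mu> *\<^sub>R v" by (simp add: r_def)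
  moreover have "v \<noteq> 0" using vv by auto
  ultimately show ?thesis using that by blast
qed

lemma csmult_mult: "csmult c A ** B = csmult c (A ** B)" "A ** csmult c B = csmult c (A ** B)"
  by (simp_all add: csmult_def matrix_matrix_mult_def vec_eq_iff sum_distrib_left algebra_simps)

lemma csmult_simps [simp]:
  "csmult c (csmult d A) = csmult (c * d) A" "csmult 1 A = A" "csmult 0 A = 0" "csmult c 0 = 0"
  "csmult (- c) A = - csmult c A" "csmult c (- A) = - csmult c A"
  by (simp_all add: csmult_def vec_eq_iff algebra_simps)

lemma csmult_add: "csmult c (A + B) = csmult c A + csmult c B" "csmult (c + d) A = csmult c A + csmult d A"
  by (simp_all add: csmult_def vec_eq_iff algebra_simps)

lemma csmult_diff: "csmult c (A - B) = csmult c A - csmult c B" "csmult (c - d) A = csmult c A - csmult d A"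
  by (simp_all add: csmult_def vec_eq_iff algebra_simps)

lemma csmult_of_real: "csmult (of_real r) A = r *\<^sub>R A"
  by (simp add: csmult_def vec_eq_iff scaleR_conv_of_real[where 'a = complex])

lemma csmult_scaleR: "csmult c (r *\<^sub>R A) = csmult (c * of_real r) A" "r *\<^sub>R csmult c A = csmult (c * of_real r) A"
  by (simp_all add: csmult_def vec_eq_iff scaleR_conv_of_real[where 'a = complex] algebra_simps)

lemma csmult_vec: "csmult c A *v x = c *s (A *v x)"
  by (simp add: csmult_def matrix_vector_mult_def vec_eq_iff sum_distrib_left algebra_simps)

text \<open>\<open>csmult \<i> X\<close> is Hermitian, so it has a real eigenvalue. The eigenspace
  is invariant under all \<open>\<rho> s\<close> and nonzero, hence everything by irreducibility.
  Skewness makes the resulting scalar imaginary.\<close>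

lemma skew_commutant:
  fixes \<rho> :: "'i \<Rightarrow> 'n::finite cmat"
  assumes irr: "complex_irreducible \<rho>" and X: "adj X = - X" "\<And>s. X ** \<rho> s = \<rho> s ** X"
  obtains r :: real where "X = csmult (\<i> * of_real r) (mat 1)"
proof -
  define A where "A = csmult \<i> X"
  have "adj A = A" by (simp add: A_def adj_csmult X)
  then obtain \<mu> v where v: "v \<noteq> 0" "A *v v = \<mu> *\<^sub>R v" by (rule hermitian_eigenvector)
  define V where "V = {x. A *v x = \<mu> *\<^sub>R x}"
  have "\<rho> s *v x \<in> V" if "x \<in> V" for s x
  proof -
    have "A ** \<rho> s = \<rho> s ** A" by (simp add: A_def csmult_mult X)
    then have "A *v (\<rho> s *v x) = \<rho> s *v (A *v x)" by (simp add: matrix_vector_mul_assoc)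
    then show ?thesis using that by (simp add: V_def mv.scaleR_right)
  qed
  moreover have "c *s x \<in> V" if "x \<in> V" for c x
  proof -
    have "A *v (c *s x) = c *s (A *v x)" by (simp add: vec.scale)
    then show ?thesis using that by (simp add: V_def vec_eq_iff scaleR_conv_of_real[where 'a = complex])
  qed
  moreover have "0 \<in> V" "\<forall>x\<in>V. \<forall>y\<in>V. x + y \<in> V" "V \<noteq> {0}"
    using v by (auto simp: V_def mv.add_right scaleR_add_right)
  moreover have "\<not> (0 \<in> V \<and> (\<forall>x\<in>V. \<forall>y\<in>V. x + y \<in> V) \<and> (\<forall>c. \<forall>x\<in>V. c *s x \<in> V)
      \<and> V \<noteq> {0} \<and> V \<noteq> UNIV \<and> (\<forall>s. \<forall>x\<in>V. \<rho> s *v x \<in> V))"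
    using irr unfolding complex_irreducible_def not_ex by (rule spec)
  ultimately have "V = UNIV" by auto
  then have "A = \<mu> *\<^sub>R mat 1" 
    by (auto simp: V_def matrix_eq mv.scaleR_left)
  then have "csmult (- \<i>) A = csmult (\<i> * of_real (- \<mu>)) (mat 1)"
    by (simp add: csmult_scaleR)
  then have "X = csmult (\<i> * of_real (- \<mu>)) (mat 1)" by (simp add: A_def)
  then show ?thesis by (rule that)
qed

section \<open>Determinants of circle subgroups\<close>

text \<open>Jacobi's formula at the identity, read off from the permutation expansion: only the
  identity permutation contributes to first order.\<close>

lemma det_circ_derivative:
  fixes Y :: "'n::finite cmat"
  shows "((\<lambda>t. det (circ Y t)) has_derivative (\<lambda>h. h *\<^sub>R trace Y)) (at 0)"
proof -
  have entry: "((\<lambda>t. circ Y t $ i $ j) has_derivative (\<lambda>h. h *\<^sub>R (Y $ i $ j))) (at 0)" for i j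
  proof -
    have "((\<lambda>t :: real. cos t *\<^sub>R (mat 1 :: 'n cmat) $ i $ j + sin t *\<^sub>R Y $ i $ j)
        has_derivative (\<lambda>h. h *\<^sub>R (Y $ i $ j))) (at 0)"
      by (auto intro!: derivative_eq_intros)
    then show ?thesis by (simp add: circ_def)
  qed
  have "((\<lambda>t. \<Sum>p | p permutes UNIV. of_int (sign p) * (\<Prod>i\<in>UNIV. circ Y t $ i $ p i)) has_derivative
      (\<lambda>h. \<Sum>p | p permutes UNIV. of_int (sign p) *
        (\<Sum>i\<in>UNIV. h *\<^sub>R (Y $ i $ p i) * (\<Prod>j\<in>UNIV - {i}. circ Y 0 $ j $ p j)))) (at 0)"
    by (intro has_derivative_sum has_derivative_mult_right has_derivative_prod entry)
  moreover have "(\<Sum>p | p permutes (UNIV :: 'n set). of_int (sign p) *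
        (\<Sum>i\<in>UNIV. h *\<^sub>R (Y $ i $ p i) * (\<Prod>j\<in>UNIV - {i}. circ Y 0 $ j $ p j))) = h *\<^sub>R trace Y" for h
  proof -
    \<comment> \<open>A permutation other than the identity moves at least two points. After removal
      of the factor at \<open>i\<close>, an off-diagonal zero of the identity matrix
      remains.\<close>
    have zero: "(\<Prod>j\<in>UNIV - {i}. circ Y 0 $ j $ p j) = 0" if p: "p permutes UNIV" "p \<noteq> id" for p :: "'n \<Rightarrow> 'n" and i
    proof -
      obtain k where k: "p k \<noteq> k" using p(2) by (auto simp: fun_eq_iff)
      have "\<exists>j. j \<noteq> i \<and> p j \<noteq> j"
      proof (cases "k = i")
        case True
        have "p (p k) \<noteq> p k" using k permutes_inj[OF p(1)] by (auto dest: injD)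
        then show ?thesis using True k by metis
      qed (use k in blast)
      then obtain j where "j \<noteq> i" "p j \<noteq> j" by blast
      then show ?thesis by (intro prod_zero bexI[of _ j]) (auto simp: mat_def)
    qed
    have "(\<Sum>p | p permutes (UNIV :: 'n set). of_int (sign p) *
        (\<Sum>i\<in>UNIV. h *\<^sub>R (Y $ i $ p i) * (\<Prod>j\<in>UNIV - {i}. circ Y 0 $ j $ p j)))
      = (\<Sum>p\<in>{id :: 'n \<Rightarrow> 'n}. of_int (sign p) *
        (\<Sum>i\<in>UNIV. h *\<^sub>R (Y $ i $ p i) * (\<Prod>j\<in>UNIV - {i}. circ Y 0 $ j $ p j)))"
    proof (intro sum.mono_neutral_right ballI)
      fix p :: "'n \<Rightarrow> 'n" assume "p \<in> {p. p permutes UNIV} - {id}"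
      then have p: "p permutes UNIV" "p \<noteq> id" by auto
      show "of_int (sign p) * (\<Sum>i\<in>UNIV. h *\<^sub>R (Y $ i $ p i) *
          (\<Prod>j\<in>UNIV - {i}. circ Y 0 $ j $ p j)) = 0"
        by (simp only: zero[OF p] mult_zero_right sum.neutral_const)
    qed (auto simp: permutes_id finite_permutations)
    also have "\<dots> = h *\<^sub>R trace Y" by (simp add: mat_def trace_def scaleR_sum_right)
    finally show ?thesis .
  qed
  ultimately show ?thesis by (simp add: det_def)
qed

text \<open>The determinant is multiplicative along the circle, so the vanishing of its derivative
  at 0 propagates to every angle.\<close>

lemma det_circ:
  assumes Y: "Y ** Y = - mat 1" and tr: "trace Y = 0"
  shows "det (circ Y t) = 1"
proof -
  have "((\<lambda>t. det (circ Y t)) has_derivative (\<lambda>h. 0)) (at s)" for s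
  proof -
    have "((\<lambda>x. x - s) has_derivative (\<lambda>h. h)) (at s)"
      by (auto intro!: derivative_eq_intros)
    moreover have "((\<lambda>t. det (circ Y t)) has_derivative (\<lambda>h. 0)) (at (s - s))"
      using det_circ_derivative[of Y] tr by simp
    ultimately have "((\<lambda>x. det (circ Y (x - s))) has_derivative (\<lambda>h. 0)) (at s)"
      using has_derivative_compose by blast
    then have "((\<lambda>x. det (circ Y s) * det (circ Y (x - s))) has_derivative (\<lambda>h. det (circ Y s) * 0)) (at s)"
      by (rule has_derivative_mult_right)
    moreover have "det (circ Y s) * det (circ Y (x - s)) = det (circ Y x)" for x
      using circ_add[OF Y, of s "x - s"] by (simp add: det_mul)
    ultimately show ?thesis by simp
  qed
  then have "\<exists>c. \<forall>x\<in>UNIV. det (circ Y x) = c"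
    by (intro has_derivative_zero_constant) auto
  then have "det (circ Y t) = det (circ Y 0)" by (metis UNIV_I)
  also have "\<dots> = 1" by simp
  finally show ?thesis .
qed

text \<open>Invariance of the trace form: ad Y is skew-symmetric for skew-Hermitian
  \<open>Y\<close>. It yields both the orthogonality arguments and the form that certifies
  compactness.\<close>

lemma comm_inner_skew:
  assumes "adj Y = - Y"
  shows "comm X Y \<bullet> Z = X \<bullet> comm Y Z"
  by (simp add: comm_def inner_diff_left inner_diff_right inner_mult_right[of X Y] inner_mult_left[of Y X]
      assms mat_ring)

lemma (in closed_unitary_group) compact: "compact G"
proof -
  have "norm A = norm (mat 1 :: 'n cmat)" if "A \<in> G" for A
    using norm_mult_unitary(1)[OF unitary[OF that], of "mat 1"] by simp
  then have "bounded G" by (auto simp: bounded_iff)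
  then show ?thesis using closed by (simp add: compact_eq_bounded_closed)
qed

section \<open>The compact group generated by the circles, and its Lie algebra\<close>

locale skew_reflections =
  fixes \<eta> :: "'i::finite \<Rightarrow> 'n::finite cmat"
  assumes sq: "\<eta> s ** \<eta> s = - mat 1"
    and skew: "adj (\<eta> s) = - \<eta> s"
    and irr: "complex_irreducible \<eta>"
begin

abbreviation H :: "'n cmat set" where "H \<equiv> real_lie_gen (range \<eta>)"
abbreviation K :: "'n cmat set" where "K \<equiv> closure (circ_group \<eta>)"

sublocale K: closed_unitary_group K
  by (rule closed_unitary_group_closure[OF circ_group.one circ_group_mult adj_circ_group[OF skew]
      unitary_circ_group[OF sq skew]])

lemma eta_mem_H: "\<eta> s \<in> H"
  using real_lie_gen_superset[of "range \<eta>"] by blast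

lemma circ_mem_K: "circ (\<eta> s) t \<in> K"
  by (rule subsetD[OF closure_subset circ_mem_circ_group])

text \<open>Each generator is the quarter turn of its own circle.\<close>

lemma eta_mem_K: "\<eta> s \<in> K"
  using circ_mem_K[of s "pi / 2"] by (simp add: circ_def)

lemma H_skew: "Z \<in> H \<Longrightarrow> adj Z = - Z"
proof -
  have "H \<subseteq> {Z. adj Z = - Z}"
    by (rule real_lie_gen_least) (auto simp: subspace_def bracket_closed_def comm_def adj_mult skew mat_ring)
  then show "Z \<in> H \<Longrightarrow> adj Z = - Z" by blast
qed

text \<open>K normalises H: for single circles by the explicit conjugation formula, for products by
  induction, and for limits because H is closed.\<close>

lemma conj_mem_H:
  assumes "A \<in> K" "Z \<in> H"
  shows "A ** Z ** adj A \<in> H"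
proof -
  have "B ** Z ** adj B \<in> H" if "B \<in> circ_group \<eta>" for B
    using that
  proof induction
    case (step B s t)
    have "circ (\<eta> s) t ** B ** Z ** adj (circ (\<eta> s) t ** B)
        = circ (\<eta> s) t ** (B ** Z ** adj B) ** circ (\<eta> s) (- t)"
      by (simp only: adj_mult adj_circ[OF skew] matrix_mul_assoc)
    then show ?case
      using circ_conj_mem[OF subspace_real_lie_gen bracket_closed_real_lie_gen sq eta_mem_H step.IH] by simp
  qed (use assms in simp)
  note on_group = this
  obtain a where a: "\<forall>n. a n \<in> circ_group \<eta>" "a \<longlonglongrightarrow> A"
    using iffD1[OF closure_sequential assms(1)] by blast
  have "(\<lambda>n. a n ** Z ** adj (a n)) \<longlonglongrightarrow> A ** Z ** adj A"
    by (intro mm.tendsto tendsto_intros a)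
  then show ?thesis
    by (rule closed_sequentially[OF closed_subspace[OF subspace_real_lie_gen], rotated])
       (simp add: on_group a)
qed

text \<open>Invariance rewrites the squared norm of \<open>comm z Y\<close> as the product of
  \<open>z\<close> with a bracket inside H. An element normalising H and orthogonal to it therefore
  centralises it.\<close>

lemma orth_commutes:
  assumes z: "\<And>Y. Y \<in> H \<Longrightarrow> z \<bullet> Y = 0" and norm: "\<And>Y. Y \<in> H \<Longrightarrow> comm z Y \<in> H" and Y: "Y \<in> H"
  shows "comm z Y = 0"
proof -
  have "comm z Y \<bullet> comm z Y = z \<bullet> comm Y (comm z Y)"
    by (rule comm_inner_skew[OF H_skew[OF Y]])
  also have "\<dots> = 0"
    using bracket_closed_real_lie_gen[of "range \<eta>"] Y norm
    by (intro z) (auto simp: bracket_closed_def)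
  finally show ?thesis by simp
qed

text \<open>Traceless generators give a group of determinant 1, which contains no circle of scalars.\<close>

lemma scalar_not_in_lie_algebra:
  assumes tr: "\<And>s. trace (\<eta> s) = 0" and mem: "csmult (\<i> * of_real r) (mat 1) \<in> lie_algebra_of K"
  shows "r = 0"
proof (rule ccontr)
  assume r: "r \<noteq> 0"
  define J where "J = csmult \<i> (mat 1 :: 'n cmat)"
  have J: "J ** J = - mat 1" by (simp add: J_def csmult_mult)
  have "det A = 1" if "A \<in> circ_group \<eta>" for A
    using that by induction (simp_all add: det_mul det_circ[OF sq tr])
  then have "circ_group \<eta> \<subseteq> {A. det A = 1}" by blast
  moreover have "closed {A :: 'n cmat. det A = 1}"
    unfolding det_def by (intro closed_Collect_eq continuous_intros)
  ultimately have det1: "K \<subseteq> {A. det A = 1}" by (rule closure_minimal)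
  \<comment> \<open>In dimension \<open>N\<close> the scalar matrix \<open>cis (pi / N)\<close> has
    determinant \<open>cis pi = -1\<close>, which contradicts determinant 1.\<close>
  define N where "N = real CARD('n)"
  have N: "N > 0" by (simp add: N_def)
  have "(pi / (N * r)) *\<^sub>R csmult (\<i> * of_real r) (mat 1) = (pi / N) *\<^sub>R J"
    using r by (simp add: J_def csmult_scaleR mult.commute)
  moreover have "mexp ((pi / (N * r)) *\<^sub>R csmult (\<i> * of_real r) (mat 1)) \<in> K"
    by (rule K.mexp_mem[OF mem])
  ultimately have "circ J (pi / N) \<in> K" by (simp add: mexp_eq_circ[OF J])
  then have "det (circ J (pi / N)) = 1" using det1 by blast
  moreover have "det (circ J (pi / N)) = (\<Prod>i\<in>(UNIV :: 'n set). cis (pi / N))"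
  proof (subst det_diagonal)
    have "cos x *\<^sub>R (1 :: complex) + sin x *\<^sub>R \<i> = cis x" for x by (simp add: complex_eq_iff)
    then show "(\<Prod>i\<in>UNIV. circ J (pi / N) $ i $ i) = (\<Prod>i\<in>(UNIV :: 'n set). cis (pi / N))"
      by (simp add: circ_def J_def csmult_def mat_def)
  qed (simp add: circ_def J_def csmult_def mat_def)
  moreover have "(\<Prod>i\<in>(UNIV :: 'n set). cis (pi / N)) = cis pi"
    using Complex.DeMoivre[of "pi / N" "CARD('n)"] N by (simp add: N_def)
  ultimately show False by simp
qed

text \<open>Closing a group can enlarge its Lie algebra, as for a line winding densely in a torus.
  Here an element \<open>X\<close> of the larger algebra still normalises H, so its component
  \<open>z\<close> orthogonal to H commutes with all \<open>\<eta> s\<close> and is an imaginary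
  scalar; determinants exclude a nonzero one.\<close>

theorem lie_algebra_K: "lie_algebra_of K = H"
proof (intro equalityI subsetI)
  fix X assume X: "X \<in> lie_algebra_of K"
  obtain y z where y: "y \<in> span H" and orth: "\<And>w. w \<in> span H \<Longrightarrow> orthogonal z w" and eq: "X = y + z"
    by (rule orthogonal_subspace_decomp_exists[of H X]) blast
  have spanH: "span H = H" by (simp add: span_eq_iff subspace_real_lie_gen)
  have z: "z \<bullet> Y = 0" if "Y \<in> H" for Y
    using orth that spanH by (simp add: orthogonal_def)
  have "comm z Y \<in> H" if Y: "Y \<in> H" for Y
  proof -
    have "comm X Y \<in> H"
      using conj_mem_H[OF K.mexp_mem[OF X] Y] K.adj_mexp[OF X]
      by (intro subspace_comm_mem[OF subspace_real_lie_gen Y]) simp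
    moreover have "comm y Y \<in> H"
      using bracket_closed_real_lie_gen[of "range \<eta>"] y Y spanH by (simp add: bracket_closed_def)
    moreover have "comm z Y = comm X Y - comm y Y"
      by (simp add: eq comm_def mat_ring)
    ultimately show ?thesis by (simp add: subspace_diff subspace_real_lie_gen)
  qed
  from orth_commutes[OF z this eta_mem_H] have comm: "z ** \<eta> s = \<eta> s ** z" for s
    by (simp add: comm_def)
  have "adj X = - X" "adj y = - y"
    using K.lie_algebra_skew[OF X] H_skew y spanH by auto
  then have "adj z = - z" by (simp add: eq)
  then obtain r :: real where r: "z = csmult (\<i> * of_real r) (mat 1)"
    using comm by (rule skew_commutant[OF irr])
  have "z = 0"
  proof (rule ccontr)
    assume "z \<noteq> 0"
    then have "r \<noteq> 0" using r by auto
    \<comment> \<open>The product of a scalar \<open>\<i> * r\<close> with \<open>\<eta> s\<close>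
      is \<open>r\<close> times the imaginary part of the trace, and skewness kills the real part.
      Orthogonality of a nonzero \<open>z\<close> to H thus makes the generators traceless.\<close>
    have "trace (\<eta> s) = 0" for s
    proof -
      have "z \<bullet> \<eta> s = Re (\<Sum>i\<in>UNIV. \<i> * of_real r * cnj (\<eta> s $ i $ i))"
        unfolding r inner_cmat by (simp add: csmult_def mat_def if_distrib if_distribR cong: if_cong)
      also have "\<dots> = r * Im (trace (\<eta> s))"
        by (simp add: trace_def sum_distrib_left)
      finally have "Im (trace (\<eta> s)) = 0" using z[OF eta_mem_H] \<open>r \<noteq> 0\<close> by simp
      moreover have "Re (trace (\<eta> s)) = 0"
      proof -
        have "cnj (\<eta> s $ i $ i) = - \<eta> s $ i $ i" for i
          using skew[of s] by (simp add: adj_def vec_eq_iff)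
        then have "Re (\<eta> s $ i $ i) = 0" for i by (simp add: complex_eq_iff)
        then show ?thesis by (simp add: trace_def)
      qed
      ultimately show ?thesis by (simp add: complex_eq_iff)
    qed
    moreover have "z \<in> lie_algebra_of K"
    proof -
      have "H \<subseteq> lie_algebra_of K"
        by (rule real_lie_gen_least[OF _ K.subspace_lie_algebra K.bracket_closed_lie_algebra])
           (auto simp: lie_algebra_of_def mexp_eq_circ[OF sq] circ_mem_K)
      then show ?thesis using X y spanH eq K.subspace_lie_algebra
        by (metis add_diff_cancel_left' subset_iff subspace_diff)
    qed
    ultimately show False using scalar_not_in_lie_algebra[of r] r \<open>r \<noteq> 0\<close> by blast
  qed
  then show "X \<in> H" using eq y spanH by simp
next
  fix X assume "X \<in> H"
  moreover have "H \<subseteq> lie_algebra_of K"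
    by (rule real_lie_gen_least[OF _ K.subspace_lie_algebra K.bracket_closed_lie_algebra])
       (auto simp: lie_algebra_of_def mexp_eq_circ[OF sq] circ_mem_K)
  ultimately show "X \<in> lie_algebra_of K" by blast
qed

end

section \<open>Fixed points of affine actions of a finite Coxeter group\<close>

text \<open>Conjugation by a skew unit Y is \<^term>\<open>\<lambda>Z. - (Y ** Z ** Y)\<close>, the inverse of Y being -Y.\<close>

definition cocycle_step :: "('i \<Rightarrow> 'n::finite cmat) \<Rightarrow> ('i \<Rightarrow> 'n cmat) \<Rightarrow> 'i \<Rightarrow> 'n cmat \<Rightarrow> 'n cmat" where
  "cocycle_step \<eta> c s Z = c s - \<eta> s ** Z ** \<eta> s"

definition cocycle :: "('i \<Rightarrow> 'n::finite cmat) \<Rightarrow> ('i \<Rightarrow> 'n cmat) \<Rightarrow> 'i list \<Rightarrow> 'n cmat" where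
  "cocycle \<eta> c w = foldr (cocycle_step \<eta> c) w 0"

lemma cocycle_simps [simp]:
  "cocycle \<eta> c [] = 0" "cocycle \<eta> c (s # w) = c s - \<eta> s ** cocycle \<eta> c w ** \<eta> s"
  by (simp_all add: cocycle_def cocycle_step_def)

text \<open>\<open>f\<close> is constant on the finitely many classes, so its values are found at
  one chosen representative of each.\<close>

lemma weq_imp_finite_range:
  assumes "coxeter_group_finite m" "\<And>u v. weq m u v \<Longrightarrow> f u = f v"
  shows "finite (range f)"
proof -
  have "f w = f (SOME v. v \<in> {v. weq m w v})" for w
    using assms(2) someI[of "weq m w" w] by (simp add: weq_refl)
  then have "range f \<subseteq> (\<lambda>C. f (SOME v. v \<in> C)) ` range (\<lambda>w. {v. weq m w v})" by blast
  then show ?thesis using assms(1) unfolding coxeter_group_finite_def by (rule finite_surj[rotated])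
qed

lemma word_prod_simps [simp]:
  "word_prod f [] = mat 1" "word_prod f (a # w) = f a ** word_prod f w"
  by (simp_all add: word_prod_def)

lemma word_prod_append: "word_prod f (u @ v) = word_prod f u ** word_prod f v"
  by (induction u) (simp_all add: matrix_mul_assoc)

context skew_reflections
begin

lemma word_prod_mem_K:
  assumes "\<And>s. k s \<in> K"
  shows "word_prod k w \<in> K"
  by (induction w) (simp_all add: K.one_mem K.mult_mem assms)

text \<open>A word acts affinely: its translation part is the cocycle, its linear part is
  conjugation by the word product. Two words act alike as soon as both parts agree.\<close>

lemma foldr_cocycle_step:
  "foldr (cocycle_step \<eta> c) w Z
    = cocycle \<eta> c w + word_prod \<eta> w ** Z ** adj (word_prod \<eta> w)"
  by (induction w) (simp_all add: cocycle_step_def adj_mult skew mat_ring)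

text \<open>The affine steps satisfy the Coxeter relations, so they define an action of W. The
  condition \<open>c_sq\<close> is what makes a single step an involution; the sign in
  \<open>\<eta> s ** \<eta> s = - mat 1\<close> cancels under conjugation.\<close>

lemma weq_foldr_cocycle_step:
  assumes braid: "\<And>s t. word_prod \<eta> (alt s t (m s t)) = word_prod \<eta> (alt t s (m s t))"
    and c_sq: "\<And>s. c s = \<eta> s ** c s ** \<eta> s"
    and c_braid: "\<And>s t. cocycle \<eta> c (alt s t (m s t)) = cocycle \<eta> c (alt t s (m s t))"
    and "weq m u v"
  shows "foldr (cocycle_step \<eta> c) u = foldr (cocycle_step \<eta> c) v"
  using assms(4)
proof induction
  case (weq_sq s)
  have "\<eta> s ** (\<eta> s ** Z ** \<eta> s) ** \<eta> s = (\<eta> s ** \<eta> s) ** Z ** (\<eta> s ** \<eta> s)" for Z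
    by (simp only: matrix_mul_assoc)
  then have "\<eta> s ** (\<eta> s ** Z ** \<eta> s) ** \<eta> s = Z" for Z
    by (simp add: sq mat_ring)
  then have "cocycle_step \<eta> c s (cocycle_step \<eta> c s Z) = Z" for Z
    unfolding cocycle_step_def mm.diff_right mm.diff_left c_sq[of s, symmetric] by simp
  then show ?case by (simp add: fun_eq_iff)
next
  case (weq_braid s t)
  show ?case by (rule ext) (simp only: foldr_cocycle_step braid[of s t] c_braid[of s t])
qed (simp_all add: fun_eq_iff)

text \<open>Vanishing of the first cohomology of a finite group with real coefficients. The set
  \<open>Q\<close> is the orbit of 0 under the affine action; it is finite, every step permutes it,
  and so its barycentre is fixed.\<close>

lemma cocycle_fixpoint:
  assumes fin: "coxeter_group_finite m"
    and braid: "\<And>s t. word_prod \<eta> (alt s t (m s t)) = word_prod \<eta> (alt t s (m s t))"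
    and c_sq: "\<And>s. c s = \<eta> s ** c s ** \<eta> s"
    and c_braid: "\<And>s t. cocycle \<eta> c (alt s t (m s t)) = cocycle \<eta> c (alt t s (m s t))"
    and D: "subspace D" "\<And>s. c s \<in> D" "\<And>s Z. Z \<in> D \<Longrightarrow> \<eta> s ** Z ** \<eta> s \<in> D"
  obtains Z where "Z \<in> D" "\<And>s. Z = c s - \<eta> s ** Z ** \<eta> s"
proof -
  define Q where "Q = range (cocycle \<eta> c)"
  have finQ: "finite Q"
    unfolding Q_def
    by (rule weq_imp_finite_range[OF fin])
       (simp add: cocycle_def weq_foldr_cocycle_step[of m c, OF braid c_sq c_braid])
  have QD: "x \<in> D" if "x \<in> Q" for x
  proof -
    have "cocycle \<eta> c w \<in> D" for w
      by (induction w) (simp_all add: D subspace_0 subspace_diff)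
    then show ?thesis using that by (auto simp: Q_def)
  qed
  have "Q \<noteq> {}" by (simp add: Q_def)
  then have card: "real (card Q) \<noteq> 0" using finQ by simp
  define Z where "Z = (1 / real (card Q)) *\<^sub>R (\<Sum>x\<in>Q. x)"
  have "Z = c s - \<eta> s ** Z ** \<eta> s" for s
  proof -
    define f where "f = cocycle_step \<eta> c s"
    have ff: "f (f x) = x" for x
      using fun_cong[OF weq_foldr_cocycle_step[of m c, OF braid c_sq c_braid weq_sq[of m s]], of x] 
      by (simp add: f_def)
    have fQ: "f x \<in> Q" if "x \<in> Q" for x
      using that by (auto simp: Q_def f_def cocycle_step_def simp flip: cocycle_simps(2))
    have "(\<Sum>x\<in>Q. x) = (\<Sum>x\<in>Q. f x)"
      by (rule sum.reindex_bij_witness[of _ f f]) (simp_all add: ff fQ)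
    also have "\<dots> = real (card Q) *\<^sub>R c s - \<eta> s ** (\<Sum>x\<in>Q. x) ** \<eta> s"
      by (simp add: f_def cocycle_step_def sum_subtractf mm.sum_left mm.sum_right sum_constant_scaleR del: sum_constant)
    finally have "(1 / real (card Q)) *\<^sub>R (\<Sum>x\<in>Q. x)
        = (1 / real (card Q)) *\<^sub>R (real (card Q) *\<^sub>R c s - \<eta> s ** (\<Sum>x\<in>Q. x) ** \<eta> s)"
      by (rule arg_cong)
    also have "\<dots> = c s - \<eta> s ** ((1 / real (card Q)) *\<^sub>R (\<Sum>x\<in>Q. x)) ** \<eta> s"
      using card by (simp add: scaleR_diff_right mm.scaleR_left mm.scaleR_right)
    finally show ?thesis unfolding Z_def .
  qed
  moreover have "Z \<in> D" unfolding Z_def by (intro subspace_scale subspace_sum D QD)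
  ultimately show ?thesis using that by blast
qed

end

section \<open>Cancellation, first variation and limits of words\<close>

text \<open>\<open>q\<close> is not known to be bounded in advance. Smallness of \<open>c\<close>
  absorbs the term \<open>q n ** c n\<close> and bounds \<open>q n\<close> by twice the convergent
  product.\<close>

lemma tendsto_cancel_near_one:
  fixes c q :: "nat \<Rightarrow> 'n::finite cmat"
  assumes c: "c \<longlonglongrightarrow> 0" and lim: "(\<lambda>n. q n ** (mat 1 + c n)) \<longlonglongrightarrow> L"
  shows "q \<longlonglongrightarrow> L"
proof -
  obtain M where M: "0 < M" "\<And>(A :: 'n cmat) (B :: 'n cmat). norm (A ** B) \<le> norm A * norm B * M"
    using mm.pos_bounded by blast
  \<comment> \<open>\<open>M\<close> is the constant of matrix multiplication for the Euclidean
    norm; below this threshold \<open>norm (q n ** c n)\<close> is at most half of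
    \<open>norm (q n)\<close>.\<close>
  have "\<forall>\<^sub>F n in sequentially. norm (c n) < 1 / (2 * M)"
    using order_tendstoD(2)[OF tendsto_norm_zero[OF c], of "1 / (2 * M)"] M(1) by simp
  then have "\<forall>\<^sub>F n in sequentially. norm (q n ** c n) \<le> (2 * M) * (norm (q n ** (mat 1 + c n)) * norm (c n))"
  proof eventually_elim
    case (elim n)
    have qc: "norm (q n ** c n) \<le> norm (q n) * norm (c n) * M" by (rule M(2))
    also have "\<dots> \<le> norm (q n) * (1 / 2)"
    proof -
      have "norm (c n) * M \<le> 1 / 2"
        using mult_right_mono[OF less_imp_le[OF elim], of M] M(1) by simp
      from mult_left_mono[OF this, of "norm (q n)"] show ?thesis by (simp add: mult.assoc)
    qed
    finally have half: "norm (q n ** c n) \<le> norm (q n) / 2" by simp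
    have "norm (q n) \<le> norm (q n ** (mat 1 + c n)) + norm (q n ** c n)"
      using norm_triangle_ineq4[of "q n ** (mat 1 + c n)" "q n ** c n"] by (simp add: mat_ring)
    with half have "norm (q n) \<le> 2 * norm (q n ** (mat 1 + c n))" by simp
    then have "norm (q n) * (norm (c n) * M) \<le> 2 * norm (q n ** (mat 1 + c n)) * (norm (c n) * M)"
      by (rule mult_right_mono) (simp add: M(1) less_imp_le)
    then show ?case using qc by (simp add: mult_ac)
  qed
  moreover have "(\<lambda>n. (2 * M) * (norm (q n ** (mat 1 + c n)) * norm (c n))) \<longlonglongrightarrow> (2 * M) * (norm L * norm (0 :: 'n cmat))"
    by (intro tendsto_intros lim c)
  ultimately have "(\<lambda>n. q n ** c n) \<longlonglongrightarrow> 0"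
    using Lim_null_comparison[of "\<lambda>n. q n ** c n"] by simp
  from tendsto_diff[OF lim this] show ?thesis by (simp add: mat_ring)
qed

text \<open>The squared norm changes by \<open>t * g t\<close>, where \<open>g\<close> tends to
  \<open>2 * (v \<bullet> w)\<close>. Minimality forces opposite signs of \<open>g\<close> on the
  two sides of 0.\<close>

lemma first_variation:
  fixes \<gamma> :: "real \<Rightarrow> 'a::real_inner"
  assumes lim: "((\<lambda>t. (\<gamma> t - v) /\<^sub>R t) \<longlongrightarrow> w) (at 0)"
    and min: "\<forall>\<^sub>F t in at 0. norm v \<le> norm (\<gamma> t)"
  shows "v \<bullet> w = 0"
proof -
  define q where "q t = (\<gamma> t - v) /\<^sub>R t" for t
  define g where "g t = 2 * (v \<bullet> q t) + t * (q t \<bullet> q t)" for t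
  have q: "(q \<longlongrightarrow> w) (at 0)" using lim by (simp add: q_def[abs_def])
  have "(g \<longlongrightarrow> 2 * (v \<bullet> w) + 0 * (w \<bullet> w)) (at 0)"
    unfolding g_def by (intro tendsto_intros q)
  then have g: "(g \<longlongrightarrow> 2 * (v \<bullet> w)) (at 0)" by simp
  have nonneg: "\<forall>\<^sub>F t in at 0. 0 \<le> t * g t"
    using min eventually_neq_at_within[of 0]
  proof eventually_elim
    case (elim t)
    then have \<gamma>: "\<gamma> t = v + t *\<^sub>R q t" by (simp add: q_def)
    have "v \<bullet> v \<le> \<gamma> t \<bullet> \<gamma> t" using elim(1) by (simp add: norm_le)
    then show ?case
      unfolding \<gamma> by (simp add: g_def inner_add_left inner_add_right inner_commute algebra_simps)
  qed
  have right: "(g \<longlongrightarrow> 2 * (v \<bullet> w)) (at_right 0)" and left: "(g \<longlongrightarrow> 2 * (v \<bullet> w)) (at_left 0)"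
    using g by (auto simp: filterlim_split_at_real filterlim_at_split)
  have "\<forall>\<^sub>F t in at_right 0. 0 \<le> g t"
  proof -
    have "\<forall>\<^sub>F t in at_right 0. 0 \<le> t * g t" using nonneg by (simp add: eventually_at_split)
    moreover have "\<forall>\<^sub>F t in at_right 0. (0 :: real) < t" by (rule eventually_at_right_less)
    ultimately show ?thesis by eventually_elim (simp add: zero_le_mult_iff)
  qed
  then have "0 \<le> 2 * (v \<bullet> w)" by (intro tendsto_lowerbound[OF right]) auto
  moreover have "\<forall>\<^sub>F t in at_left 0. g t \<le> 0"
  proof -
    have "\<forall>\<^sub>F t in at_left 0. 0 \<le> t * g t" using nonneg by (simp add: eventually_at_split)
    moreover have "\<forall>\<^sub>F t in at_left 0. t < (0 :: real)"
      by (auto simp: eventually_at_filter)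
    ultimately show ?thesis by eventually_elim (auto simp: zero_le_mult_iff)
  qed
  then have "2 * (v \<bullet> w) \<le> 0" by (intro tendsto_upperbound[OF left]) auto
  ultimately show ?thesis by simp
qed

lemma tendsto_word_prod:
  assumes "\<And>s. (\<lambda>n. X n s) \<longlonglongrightarrow> f s"
  shows "(\<lambda>n. word_prod (X n) w) \<longlonglongrightarrow> word_prod f w"
  by (induction w) (simp_all add: mm.tendsto assms)

section \<open>Orbits, the slice and the linearised problem\<close>

context skew_reflections
begin

definition commutant :: "'n cmat set" where
  "commutant = {x. \<forall>s. x ** \<eta> s = \<eta> s ** x}"

text \<open>The gauge directions: orthogonal to the motions along K and to the stabiliser.\<close>

definition slice :: "'n cmat set" where
  "slice = {z. \<forall>x \<in> H \<union> commutant. z \<bullet> x = 0}"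

definition orbit :: "'i \<Rightarrow> 'n cmat set" where
  "orbit s = (\<lambda>k. k ** \<eta> s ** adj k) ` K"

lemma subspace_slice: "subspace slice"
  by (auto simp: slice_def subspace_def inner_add_left)

text \<open>The sandwich map is self-adjoint, as the two signs from skewness cancel. It preserves H,
  acts as -1 on the commutant, and hence preserves their common orthogonal complement.\<close>

lemma sandwich_slice:
  assumes "Z \<in> slice"
  shows "\<eta> s ** Z ** \<eta> s \<in> slice"
  unfolding slice_def
proof (intro CollectI ballI)
  fix x assume x: "x \<in> H \<union> commutant"
  have "\<eta> s ** x ** \<eta> s \<in> H \<union> commutant"
  proof (cases "x \<in> H")
    case True
    then show ?thesis
      using sandwich_mem[OF subspace_real_lie_gen bracket_closed_real_lie_gen sq eta_mem_H] by simp
  next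
    case False
    then have comm: "x ** \<eta> t = \<eta> t ** x" for t using x by (simp add: commutant_def)
    have "\<eta> s ** x ** \<eta> s = \<eta> s ** (x ** \<eta> s)" by (simp only: matrix_mul_assoc)
    also have "\<dots> = \<eta> s ** \<eta> s ** x" by (simp only: comm matrix_mul_assoc)
    also have "\<dots> = - x" by (simp add: sq mat_ring)
    finally show ?thesis using comm by (simp add: commutant_def mat_ring)
  qed
  then have "Z \<bullet> (\<eta> s ** x ** \<eta> s) = 0" using assms by (simp add: slice_def)
  moreover have "(\<eta> s ** Z ** \<eta> s) \<bullet> x = Z \<bullet> (\<eta> s ** x ** \<eta> s)"
    by (simp add: inner_mult_right[of "\<eta> s ** Z"] inner_mult_left[of "\<eta> s" Z] skew mat_ring)
  ultimately show "(\<eta> s ** Z ** \<eta> s) \<bullet> x = 0" by simp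
qed

lemma slice_H_zero: "w \<in> slice \<Longrightarrow> w \<in> H \<Longrightarrow> w = 0"
  using inner_eq_zero_iff[of w] by (auto simp: slice_def)

lemma compact_orbit: "compact (orbit s)"
  unfolding orbit_def
  by (intro compact_continuous_image K.compact mm.continuous_on continuous_intros
      linear_continuous_on[OF bounded_linear_adj])

lemma eta_mem_orbit: "\<eta> s \<in> orbit s"
  unfolding orbit_def by (rule image_eqI[of _ _ "mat 1"]) (simp_all add: K.one_mem)

lemma orbit_square: "y \<in> orbit s \<Longrightarrow> y ** y = - mat 1"
  unfolding orbit_def using circ_conj_square[OF unitary_commute[OF K.unitary] sq] by auto

lemma orbit_circ_mem: "y \<in> orbit s \<Longrightarrow> circ y t \<in> K"
  unfolding orbit_def
  by (auto simp: K.mult_mem K.adj_mem circ_mem_K simp flip: circ_conj[OF K.unitary])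

lemma orbit_mem_K: "y \<in> orbit s \<Longrightarrow> y \<in> K"
  unfolding orbit_def by (auto intro!: K.mult_mem K.adj_mem eta_mem_K)

lemma orbit_mem_H: "y \<in> orbit s \<Longrightarrow> y \<in> H"
  unfolding orbit_def by (auto intro!: conj_mem_H eta_mem_H)

lemma orbit_conj: "y \<in> orbit s \<Longrightarrow> k \<in> K \<Longrightarrow> k ** y ** adj k \<in> orbit s"
proof -
  assume "y \<in> orbit s" and k: "k \<in> K"
  then obtain j where j: "j \<in> K" "y = j ** \<eta> s ** adj j" by (auto simp: orbit_def)
  have "k ** y ** adj k = (k ** j) ** \<eta> s ** adj (k ** j)"
    by (simp only: j adj_mult matrix_mul_assoc)
  then show ?thesis using K.mult_mem[OF k j(1)] unfolding orbit_def by blast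
qed

text \<open>Local uniqueness for the undeformed generators, by blow-up. Otherwise small nonzero
  solutions, scaled to norm 1, have a limit \<open>l\<close> in the slice. The limit
  \<open>w\<close> of their equation is tangent to K and in the slice, so it vanishes; then
  \<open>l\<close> commutes with all generators, and the slice excludes this too.\<close>

lemma slice_transversal:
  obtains \<delta> where "0 < \<delta>"
    "\<And>c. c \<in> slice \<Longrightarrow> norm c \<le> \<delta> \<Longrightarrow> (\<And>s. \<exists>y \<in> orbit s. (mat 1 + c) ** \<eta> s = y ** (mat 1 + c)) \<Longrightarrow> c = 0"
proof (rule ccontr)
  assume "\<not> thesis"
  then have "\<exists>c. c \<in> slice \<and> norm c \<le> inverse (real (Suc n)) \<and> c \<noteq> 0
      \<and> (\<forall>s. \<exists>y \<in> orbit s. (mat 1 + c) ** \<eta> s = y ** (mat 1 + c))" for n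
    using that[of "inverse (real (Suc n))"] by auto
  then obtain c where c: "\<And>n. c n \<in> slice" "\<And>n. norm (c n) \<le> inverse (real (Suc n))" "\<And>n. c n \<noteq> 0"
    "\<And>n s. \<exists>y \<in> orbit s. (mat 1 + c n) ** \<eta> s = y ** (mat 1 + c n)"
    by metis
  have "\<forall>n s. \<exists>y. y \<in> orbit s \<and> (mat 1 + c n) ** \<eta> s = y ** (mat 1 + c n)"
    using c(4) by blast
  then obtain y where y: "\<And>n s. y n s \<in> orbit s"
    "\<And>n s. (mat 1 + c n) ** \<eta> s = y n s ** (mat 1 + c n)"
    unfolding choice_iff by blast
  have c0: "c \<longlonglongrightarrow> 0"
    using Lim_null_comparison[OF always_eventually LIMSEQ_inverse_real_of_nat] c(2) by blast
  define u where "u n = c n /\<^sub>R norm (c n)" for n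
  have "u n \<in> sphere 0 1" for n using c(3) by (simp add: u_def)
  then obtain l r where l: "l \<in> sphere 0 1" and r: "strict_mono r" and ul: "(u \<circ> r) \<longlonglongrightarrow> l"
    using compact_sphere[of "0 :: 'n cmat" 1] unfolding compact_def by blast
  have cr: "(\<lambda>n. c (r n)) \<longlonglongrightarrow> 0"
    using LIMSEQ_subseq_LIMSEQ[OF c0 r] by (simp add: o_def)
  have ur: "(\<lambda>n. u (r n)) \<longlonglongrightarrow> l" using ul by (simp add: o_def)
  have l_slice: "l \<in> slice"
    by (rule closed_sequentially[OF closed_subspace[OF subspace_slice] _ ur])
       (simp add: u_def subspace_scale[OF subspace_slice] c)
  have "l ** \<eta> s = \<eta> s ** l" for s
  proof -
    have "(\<lambda>n. (mat 1 + c (r n)) ** \<eta> s) \<longlonglongrightarrow> (mat 1 + 0) ** \<eta> s"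
      by (intro mm.tendsto tendsto_intros cr)
    then have "(\<lambda>n. y (r n) s ** (mat 1 + c (r n))) \<longlonglongrightarrow> \<eta> s" by (simp add: y(2))
    then have yr: "(\<lambda>n. y (r n) s) \<longlonglongrightarrow> \<eta> s" by (rule tendsto_cancel_near_one[OF cr])
    \<comment> \<open>Right multiplication by the adjoint of \<open>\<eta> s\<close> moves the
      equation to the identity: \<open>w\<close> becomes a limit of rescaled differences between
      elements of K and \<open>mat 1\<close>.\<close>
    define w where "w = (l ** \<eta> s - \<eta> s ** l) ** adj (\<eta> s)"
    have "(\<lambda>n. (u (r n) ** \<eta> s - y (r n) s ** u (r n)) ** adj (\<eta> s)) \<longlonglongrightarrow> w"
      unfolding w_def by (intro mm.tendsto tendsto_intros ur yr)
    moreover have "(u n ** \<eta> s - y n s ** u n) ** adj (\<eta> s) = (y n s ** adj (\<eta> s) - mat 1) /\<^sub>R norm (c n)" for n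
    proof -
      have "c n ** \<eta> s - y n s ** c n = y n s - \<eta> s"
        using y(2)[of n s] by (simp add: mat_ring algebra_simps)
      then have "(u n ** \<eta> s - y n s ** u n) = (y n s - \<eta> s) /\<^sub>R norm (c n)"
        by (simp add: u_def mm.scaleR_left mm.scaleR_right flip: scaleR_diff_right)
      moreover have "(y n s - \<eta> s) ** adj (\<eta> s) = y n s ** adj (\<eta> s) - mat 1"
        by (simp add: mm.diff_left skew sq mm.minus_right)
      ultimately show ?thesis by (simp add: mm.scaleR_left)
    qed
    ultimately have "(\<lambda>n. (y (r n) s ** adj (\<eta> s) - mat 1) /\<^sub>R norm (c (r n))) \<longlonglongrightarrow> w" by simp
    then have "w \<in> lie_algebra_of K"
      by (rule K.tangent_mem_lie_algebra[rotated -1])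
         (use c(3) tendsto_norm_zero[OF cr] in \<open>auto intro!: K.mult_mem K.adj_mem orbit_mem_K[OF y(1)] eta_mem_K\<close>)
    then have "w \<in> H" by (simp add: lie_algebra_K)
    have w: "w = l + \<eta> s ** l ** \<eta> s"
    proof -
      have "w = - (l ** (\<eta> s ** \<eta> s)) + \<eta> s ** l ** \<eta> s"
        unfolding w_def skew by (simp add: mat_ring)
      then show ?thesis by (simp add: sq mat_ring)
    qed
    then have "w \<in> slice"
      using l_slice sandwich_slice[OF l_slice] by (simp add: subspace_add[OF subspace_slice])
    with \<open>w \<in> H\<close> have "w = 0" by (rule slice_H_zero[rotated])
    then have "(l + \<eta> s ** l ** \<eta> s) ** \<eta> s = 0" by (simp add: w)
    then have "l ** \<eta> s + \<eta> s ** l ** (\<eta> s ** \<eta> s) = 0" by (simp add: mat_ring)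
    then show ?thesis by (simp add: sq mat_ring)
  qed
  then have "l \<in> commutant" by (simp add: commutant_def)
  then have "l \<bullet> l = 0" using l_slice by (simp add: slice_def)
  then show False using l by simp
qed

text \<open>\<open>E\<close> is the limit of rescaled defects at minimisers. Criticality along the
  orbits and the relations for squares put its translate \<open>C\<close> into the slice. The braid
  relations make \<open>C\<close> a cocycle up to an element of H, and the slice meets H only in 0.
  The cocycle is then a coboundary, so \<open>E\<close> is itself a gauge direction, and criticality
  along such directions makes \<open>E\<close> orthogonal to itself.\<close>

lemma linearised_relations:
  fixes Y y :: "nat \<Rightarrow> 'i \<Rightarrow> 'n cmat" and c :: "nat \<Rightarrow> 'n cmat" and \<theta> :: "nat \<Rightarrow> real"
  defines "d \<equiv> \<lambda>n s. (mat 1 + c n) ** Y n s - y n s ** (mat 1 + c n)"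
  assumes fin: "coxeter_group_finite m"
    and \<eta>_braid: "\<And>s t. word_prod \<eta> (alt s t (m s t)) = word_prod \<eta> (alt t s (m s t))"
    and Y_sq: "\<And>n s. Y n s ** Y n s = - mat 1" and Y: "\<And>s. (\<lambda>n. Y n s) \<longlonglongrightarrow> \<eta> s"
    and \<theta>: "\<theta> \<longlonglongrightarrow> 0"
    and Y_braid: "\<And>n s t. word_prod (\<lambda>a. circ (Y n a) (pi / 2 + \<theta> n)) (alt s t (m s t))
      = word_prod (\<lambda>a. circ (Y n a) (pi / 2 + \<theta> n)) (alt t s (m s t))"
    and c: "c \<longlonglongrightarrow> 0" and y_orbit: "\<And>n s. y n s \<in> orbit s" and y: "\<And>s. (\<lambda>n. y n s) \<longlonglongrightarrow> \<eta> s"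
    and pos: "\<And>n. 0 < \<epsilon> n" and \<epsilon>: "\<epsilon> \<longlonglongrightarrow> 0" and E: "\<And>s. (\<lambda>n. d n s /\<^sub>R \<epsilon> n) \<longlonglongrightarrow> E s"
    and crit_gauge: "\<And>z. z \<in> slice \<Longrightarrow> \<forall>\<^sub>F n in sequentially. (\<Sum>s\<in>UNIV. d n s \<bullet> (z ** Y n s - y n s ** z)) = 0"
    and crit_orbit: "\<And>n s x. x \<in> H \<Longrightarrow> d n s \<bullet> (comm x (y n s) ** (mat 1 + c n)) = 0"
  shows "E s = 0"
proof -
  have E_orbit: "E s \<bullet> comm x (\<eta> s) = 0" if x: "x \<in> H" for s x
  proof -
    have "(\<lambda>n. (d n s /\<^sub>R \<epsilon> n) \<bullet> (comm x (y n s) ** (mat 1 + c n))) \<longlonglongrightarrow> E s \<bullet> (comm x (\<eta> s) ** (mat 1 + 0))"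
      unfolding comm_def by (intro tendsto_intros mm.tendsto E y c)
    then show ?thesis by (simp add: crit_orbit[OF x] LIMSEQ_const_iff)
  qed
  have E_gauge: "(\<Sum>s\<in>UNIV. E s \<bullet> (z ** \<eta> s - \<eta> s ** z)) = 0" if z: "z \<in> slice" for z
  proof -
    have lim: "(\<lambda>n. \<Sum>s\<in>UNIV. (d n s /\<^sub>R \<epsilon> n) \<bullet> (z ** Y n s - y n s ** z))
        \<longlonglongrightarrow> (\<Sum>s\<in>UNIV. E s \<bullet> (z ** \<eta> s - \<eta> s ** z))"
      by (intro tendsto_intros mm.tendsto E y Y)
    have "\<forall>\<^sub>F n in sequentially. (\<Sum>s\<in>UNIV. (d n s /\<^sub>R \<epsilon> n) \<bullet> (z ** Y n s - y n s ** z)) = 0"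
      using crit_gauge[OF z] by eventually_elim (simp flip: sum_distrib_left)
    from tendsto_unique[OF _ lim tendsto_eventually[OF this]] show ?thesis by simp
  qed
  \<comment> \<open>Both \<open>Y n s\<close> and \<open>y n s\<close> have square -1, which gives
    the exact identity \<open>d n s ** Y n s + y n s ** d n s = 0\<close>.\<close>
  have E_anti: "E s ** \<eta> s = - (\<eta> s ** E s)" for s
  proof -
    have "d n s ** Y n s + y n s ** d n s = 0" for n
    proof -
      have "d n s ** Y n s + y n s ** d n s
          = (mat 1 + c n) ** (Y n s ** Y n s) - (y n s ** y n s) ** (mat 1 + c n)"
        by (simp only: d_def mm.diff_left mm.diff_right matrix_mul_assoc) simp
      then show ?thesis by (simp add: Y_sq orbit_square[OF y_orbit] mat_ring)
    qed
    then have "(d n s /\<^sub>R \<epsilon> n) ** Y n s + y n s ** (d n s /\<^sub>R \<epsilon> n) = 0" for n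
      by (simp add: mm.scaleR_left mm.scaleR_right flip: scaleR_add_right)
    moreover have "(\<lambda>n. (d n s /\<^sub>R \<epsilon> n) ** Y n s + y n s ** (d n s /\<^sub>R \<epsilon> n)) \<longlonglongrightarrow> E s ** \<eta> s + \<eta> s ** E s"
      by (intro tendsto_intros mm.tendsto E y Y)
    ultimately have "E s ** \<eta> s + \<eta> s ** E s = 0" by (simp add: LIMSEQ_const_iff)
    then show ?thesis by (simp add: eq_neg_iff_add_eq_0)
  qed
  \<comment> \<open>Since the inverse of \<open>\<eta> s\<close> is \<open>- \<eta> s\<close>, this
    is \<open>E s\<close> translated back to the identity, where it can be compared with H.\<close>
  define C where "C s = - (E s ** \<eta> s)" for s
  have C_sq: "C s = \<eta> s ** C s ** \<eta> s" for s
  proof -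
    have "\<eta> s ** C s ** \<eta> s = - (\<eta> s ** E s ** (\<eta> s ** \<eta> s))" by (simp add: C_def mat_ring)
    then show ?thesis by (simp add: C_def E_anti sq mat_ring)
  qed
  have C_slice: "C s \<in> slice" for s
    unfolding slice_def
  proof (intro CollectI ballI)
    fix x assume "x \<in> H \<union> commutant"
    then have "E s \<bullet> (x ** \<eta> s) = E s \<bullet> (\<eta> s ** x)"
      using E_orbit[of x s] by (auto simp: commutant_def comm_def inner_diff_right)
    moreover have "(E s ** \<eta> s) \<bullet> x = - (E s \<bullet> (x ** \<eta> s))"
      by (simp add: inner_mult_right skew mat_ring)
    moreover have "(\<eta> s ** E s) \<bullet> x = - (E s \<bullet> (\<eta> s ** x))"
      by (simp add: inner_mult_left skew mat_ring)
    ultimately show "C s \<bullet> x = 0" by (simp add: C_def E_anti)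
  qed
  define a where "a n = pi / 2 + \<theta> n" for n
  define X where "X n s = circ (Y n s) (a n)" for n s
  define k where "k n s = circ (y n s) (a n)" for n s
  have a: "a \<longlonglongrightarrow> pi / 2" unfolding a_def using tendsto_add[OF tendsto_const \<theta>, of "pi / 2"] by simp
  have sin_a: "(\<lambda>n. sin (a n)) \<longlonglongrightarrow> 1" and cos_a: "(\<lambda>n. cos (a n)) \<longlonglongrightarrow> 0"
    using tendsto_sin[OF a] tendsto_cos[OF a] by simp_all
  have X: "(\<lambda>n. X n s) \<longlonglongrightarrow> \<eta> s" and k: "(\<lambda>n. k n s) \<longlonglongrightarrow> \<eta> s" for s
  proof -
    have "(\<lambda>n. X n s) \<longlonglongrightarrow> 0 *\<^sub>R mat 1 + 1 *\<^sub>R \<eta> s" "(\<lambda>n. k n s) \<longlonglongrightarrow> 0 *\<^sub>R mat 1 + 1 *\<^sub>R \<eta> s"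
      unfolding X_def k_def circ_def by (intro tendsto_intros sin_a cos_a Y y)+
    then show "(\<lambda>n. X n s) \<longlonglongrightarrow> \<eta> s" "(\<lambda>n. k n s) \<longlonglongrightarrow> \<eta> s" by simp_all
  qed
  \<comment> \<open>The defect of a whole word. Prepending a letter obeys a Leibniz rule in which
    the cosine parts cancel, so after rescaling the limit is the cocycle times the word
    product.\<close>
  define F where "F n w = (mat 1 + c n) ** word_prod (X n) w - word_prod (k n) w ** (mat 1 + c n)" for n w
  have F_step: "F n (s # w) = sin (a n) *\<^sub>R (d n s ** word_prod (X n) w) + k n s ** F n w" for n s w
  proof -
    have "(mat 1 + c n) ** X n s = sin (a n) *\<^sub>R d n s + k n s ** (mat 1 + c n)"
      by (simp add: X_def k_def d_def circ_def mat_ring algebra_simps)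
    then have "(mat 1 + c n) ** X n s ** word_prod (X n) w
        = sin (a n) *\<^sub>R d n s ** word_prod (X n) w + k n s ** (mat 1 + c n) ** word_prod (X n) w"
      by (simp only: mm.add_left)
    then show ?thesis
      by (simp add: F_def mm.diff_right mm.scaleR_left matrix_mul_assoc)
  qed
  have F_lim: "(\<lambda>n. F n w /\<^sub>R \<epsilon> n) \<longlonglongrightarrow> cocycle \<eta> C w ** word_prod \<eta> w" for w
  proof (induction w)
    case Nil
    show ?case by (simp add: F_def)
  next
    case (Cons s w)
    have "(\<lambda>n. sin (a n) *\<^sub>R ((d n s /\<^sub>R \<epsilon> n) ** word_prod (X n) w) + k n s ** (F n w /\<^sub>R \<epsilon> n))
        \<longlonglongrightarrow> 1 *\<^sub>R (E s ** word_prod \<eta> w) + \<eta> s ** (cocycle \<eta> C w ** word_prod \<eta> w)"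
      by (intro tendsto_intros mm.tendsto E sin_a tendsto_word_prod X k Cons.IH)
    moreover have "sin (a n) *\<^sub>R ((d n s /\<^sub>R \<epsilon> n) ** word_prod (X n) w) + k n s ** (F n w /\<^sub>R \<epsilon> n)
        = F n (s # w) /\<^sub>R \<epsilon> n" for n
      unfolding F_step by (simp add: mm.scaleR_left mm.scaleR_right scaleR_add_right)
    moreover have "1 *\<^sub>R (E s ** word_prod \<eta> w) + \<eta> s ** (cocycle \<eta> C w ** word_prod \<eta> w)
        = cocycle \<eta> C (s # w) ** word_prod \<eta> (s # w)"
    proof -
      have "cocycle \<eta> C (s # w) ** word_prod \<eta> (s # w)
          = - (E s ** (\<eta> s ** \<eta> s) ** word_prod \<eta> w)
            - \<eta> s ** cocycle \<eta> C w ** (\<eta> s ** \<eta> s) ** word_prod \<eta> w"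
        by (simp add: C_def mm.diff_left mm.minus_left matrix_mul_assoc)
      then show ?thesis by (simp add: sq mm.minus_left mm.minus_right matrix_mul_assoc)
    qed
    ultimately show ?case by simp
  qed
  have C_braid: "cocycle \<eta> C (alt s t (m s t)) = cocycle \<eta> C (alt t s (m s t))" for s t
  proof -
    define u v where "u = alt s t (m s t)" and "v = alt t s (m s t)"
    have Xuv: "word_prod (X n) u = word_prod (X n) v" for n
      using Y_braid[of n s t] by (simp add: X_def[abs_def] a_def u_def v_def)
    have \<eta>uv: "word_prod \<eta> u = word_prod \<eta> v"
      using \<eta>_braid by (simp add: u_def v_def)
    \<comment> \<open>The \<open>X\<close> words agree on the two sides of the braid relation, but
      the \<open>k\<close> words, which only lie in K, need not. The difference of the two defects
      is exactly their mismatch times \<open>mat 1 + c n\<close>.\<close>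
    define q where "q n = (word_prod (k n) v - word_prod (k n) u) /\<^sub>R \<epsilon> n" for n
    have "(\<lambda>n. F n u /\<^sub>R \<epsilon> n - F n v /\<^sub>R \<epsilon> n) \<longlonglongrightarrow>
        cocycle \<eta> C u ** word_prod \<eta> u - cocycle \<eta> C v ** word_prod \<eta> v"
      by (intro tendsto_diff F_lim)
    moreover have "F n u /\<^sub>R \<epsilon> n - F n v /\<^sub>R \<epsilon> n = q n ** (mat 1 + c n)" for n
      by (simp add: F_def q_def Xuv mm.scaleR_left mm.diff_left flip: scaleR_diff_right)
    moreover have "cocycle \<eta> C u ** word_prod \<eta> u - cocycle \<eta> C v ** word_prod \<eta> v
        = (cocycle \<eta> C u - cocycle \<eta> C v) ** word_prod \<eta> u"
      by (simp add: \<eta>uv mm.diff_left)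
    ultimately have "(\<lambda>n. q n ** (mat 1 + c n)) \<longlonglongrightarrow> (cocycle \<eta> C u - cocycle \<eta> C v) ** word_prod \<eta> u"
      by simp
    then have q: "q \<longlonglongrightarrow> (cocycle \<eta> C u - cocycle \<eta> C v) ** word_prod \<eta> u"
      by (rule tendsto_cancel_near_one[OF c])
    define w where "w = cocycle \<eta> C u - cocycle \<eta> C v"
    have kK: "word_prod (k n) x \<in> K" for n x
      unfolding k_def by (intro word_prod_mem_K orbit_circ_mem[OF y_orbit])
    have "(\<lambda>n. q n ** adj (word_prod (k n) u)) \<longlonglongrightarrow> w ** word_prod \<eta> u ** adj (word_prod \<eta> u)"
      unfolding w_def by (intro mm.tendsto tendsto_intros q tendsto_word_prod k)
    moreover have "w ** word_prod \<eta> u ** adj (word_prod \<eta> u) = w"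
      using K.unitary[OF word_prod_mem_K[OF eta_mem_K, where w = u]] by (simp flip: matrix_mul_assoc)
    moreover have "q n ** adj (word_prod (k n) u)
        = (word_prod (k n) v ** adj (word_prod (k n) u) - mat 1) /\<^sub>R \<epsilon> n" for n
      by (simp add: q_def mm.scaleR_left mm.diff_left K.unitary[OF kK])
    ultimately have "(\<lambda>n. (word_prod (k n) v ** adj (word_prod (k n) u) - mat 1) /\<^sub>R \<epsilon> n) \<longlonglongrightarrow> w"
      by simp
    then have "w \<in> lie_algebra_of K"
      by (rule K.tangent_mem_lie_algebra[OF K.mult_mem[OF kK K.adj_mem[OF kK]] pos \<epsilon>])
    moreover have "w \<in> slice"
    proof -
      have "cocycle \<eta> C x \<in> slice" for x
        by (induction x)
           (simp_all add: subspace_0[OF subspace_slice] subspace_diff[OF subspace_slice] C_slice sandwich_slice)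
      then show ?thesis by (simp add: w_def subspace_diff[OF subspace_slice])
    qed
    ultimately have "w = 0" by (simp add: slice_H_zero lie_algebra_K)
    then show ?thesis by (simp add: w_def u_def v_def)
  qed
  obtain Z where Z: "Z \<in> slice" "\<And>s. Z = C s - \<eta> s ** Z ** \<eta> s"
    using cocycle_fixpoint[OF fin \<eta>_braid C_sq C_braid subspace_slice C_slice sandwich_slice] by blast
  have "E s = Z ** \<eta> s - \<eta> s ** Z" for s
  proof -
    have "Z ** \<eta> s = (C s - \<eta> s ** Z ** \<eta> s) ** \<eta> s" using Z(2)[of s] by simp
    also have "\<dots> = - (E s ** (\<eta> s ** \<eta> s)) - \<eta> s ** Z ** (\<eta> s ** \<eta> s)"
      by (simp only: C_def mm.diff_left mm.minus_left matrix_mul_assoc)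
    also have "\<dots> = E s + \<eta> s ** Z" by (simp add: sq mm.minus_right)
    finally show ?thesis by simp
  qed
  \<comment> \<open>The gauge condition is applied to the fixed point \<open>Z\<close> itself, whose
    gauge variation is \<open>E\<close>.\<close>
  then have "(\<Sum>s\<in>UNIV. E s \<bullet> E s) = 0" using E_gauge[OF Z(1)] by simp
  then have "E s \<bullet> E s = 0" by (simp add: sum_nonneg_eq_0_iff)
  then show ?thesis by simp
qed

end

section \<open>Minimising the defect\<close>

lemma compact_cart:
  fixes A :: "'i::finite \<Rightarrow> 'a::euclidean_space set"
  assumes "\<And>i. compact (A i)"
  shows "compact {x :: 'a^'i. \<forall>i. x $ i \<in> A i}"
proof -
  have "closed (\<Inter>i. (\<lambda>x :: 'a^'i. x $ i) -` A i)"
    by (intro closed_INT ballI continuous_closed_vimage compact_imp_closed assms) simp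
  also have "(\<Inter>i. (\<lambda>x :: 'a^'i. x $ i) -` A i) = {x. \<forall>i. x $ i \<in> A i}" by auto
  finally have closed: "closed {x :: 'a^'i. \<forall>i. x $ i \<in> A i}" .
  have "\<forall>i. \<exists>B. \<forall>x\<in>A i. norm x \<le> B"
    using compact_imp_bounded[OF assms] by (simp add: bounded_iff)
  then obtain B where B: "\<And>i x. x \<in> A i \<Longrightarrow> norm x \<le> B i" unfolding choice_iff by blast
  have "norm x \<le> (\<Sum>i\<in>UNIV. B i)" if "\<forall>i. x $ i \<in> A i" for x :: "'a^'i"
    using that unfolding norm_vec_def by (intro order_trans[OF L2_set_le_sum] sum_mono B) auto
  then have "bounded {x :: 'a^'i. \<forall>i. x $ i \<in> A i}" unfolding bounded_iff by blast
  with closed show ?thesis by (simp add: compact_eq_bounded_closed)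
qed

context skew_reflections
begin

text \<open>The conjugation equation is multiplied out, so no inverse of \<open>mat 1 + c\<close>
  occurs. The expression is defined on the whole compact domain and is affine in \<open>c\<close>
  and in \<open>y\<close> separately.\<close>

definition defect :: "('i \<Rightarrow> 'n cmat) \<Rightarrow> 'n cmat \<Rightarrow> ('n cmat)^'i \<Rightarrow> ('n cmat)^'i" where
  "defect Y c y = (\<chi> s. (mat 1 + c) ** Y s - y $ s ** (mat 1 + c))"

lemma defect_nth [simp]: "defect Y c y $ s = (mat 1 + c) ** Y s - y $ s ** (mat 1 + c)"
  by (simp add: defect_def)

text \<open>Strictness of \<open>norm c < \<delta>\<close> makes \<open>c + t *\<^sub>R z\<close>
  admissible for small \<open>t\<close> of either sign. One \<open>c\<close> serves all generators,
  so only the sum over \<open>s\<close> vanishes.\<close>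

lemma defect_critical_gauge:
  assumes min: "\<And>c'. c' \<in> slice \<Longrightarrow> norm c' \<le> \<delta> \<Longrightarrow> norm (defect Y c y) \<le> norm (defect Y c' y)"
    and c: "c \<in> slice" "norm c < \<delta>" and z: "z \<in> slice"
  shows "(\<Sum>s\<in>UNIV. (defect Y c y $ s) \<bullet> (z ** Y s - y $ s ** z)) = 0"
proof -
  define w :: "('n cmat)^'i" where "w = (\<chi> s. z ** Y s - y $ s ** z)"
  have "defect Y c y \<bullet> w = 0"
  proof (rule first_variation)
    have quotient: "(defect Y (c + t *\<^sub>R z) y - defect Y c y) /\<^sub>R t = w" if "t \<noteq> 0" for t
    proof -
      have "(defect Y (c + t *\<^sub>R z) y - defect Y c y) = t *\<^sub>R w"
        by (simp add: vec_eq_iff[where 'b = 'i] w_def mat_ring scaleR_diff_right)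
      then show ?thesis using that by simp
    qed
    show "((\<lambda>t. (defect Y (c + t *\<^sub>R z) y - defect Y c y) /\<^sub>R t) \<longlongrightarrow> w) (at 0)"
      by (rule Lim_transform_at_0[OF tendsto_const]) (simp add: quotient)
    have "((\<lambda>t. norm (c + t *\<^sub>R z)) \<longlongrightarrow> norm (c + 0 *\<^sub>R z)) (at 0)"
      by (intro tendsto_intros)
    then have "\<forall>\<^sub>F t in at 0. norm (c + t *\<^sub>R z) < \<delta>"
      using c(2) by (intro order_tendstoD(2)) simp
    then show "\<forall>\<^sub>F t in at 0. norm (defect Y c y) \<le> norm (defect Y (c + t *\<^sub>R z) y)"
      by eventually_elim
         (intro min subspace_add[OF subspace_slice] subspace_scale[OF subspace_slice] c z less_imp_le)
  qed
  then show ?thesis by (simp add: inner_vec_def[where 'b = 'i] w_def)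
qed

text \<open>The orbit points vary independently, so a single component may be moved by conjugation
  with \<open>mexp (t *\<^sub>R x)\<close>, which lies in K. This gives a condition for each
  \<open>s\<close> separately.\<close>

lemma defect_critical_orbit:
  assumes min: "\<And>y'. (\<And>s. y' $ s \<in> orbit s) \<Longrightarrow> norm (defect Y c y) \<le> norm (defect Y c y')"
    and y: "\<And>s. y $ s \<in> orbit s" and x: "x \<in> H"
  shows "(defect Y c y $ s) \<bullet> (comm x (y $ s) ** (mat 1 + c)) = 0"
proof -
  define yt where "yt t = mexp (t *\<^sub>R x) ** y $ s ** mexp (- (t *\<^sub>R x))" for t
  define y' :: "real \<Rightarrow> ('n cmat)^'i" where "y' t = (\<chi> j. if j = s then yt t else y $ j)" for t
  define w :: "('n cmat)^'i" where "w = (\<chi> j. if j = s then - (comm x (y $ s) ** (mat 1 + c)) else 0)"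
  have x': "x \<in> lie_algebra_of K" using x by (simp add: lie_algebra_K)
  have "defect Y c y \<bullet> w = 0"
  proof (rule first_variation)
    show "((\<lambda>t. (defect Y c (y' t) - defect Y c y) /\<^sub>R t) \<longlongrightarrow> w) (at 0)"
    proof (rule vec_tendstoI)
      fix j
      show "((\<lambda>t. ((defect Y c (y' t) - defect Y c y) /\<^sub>R t) $ j) \<longlongrightarrow> w $ j) (at 0)"
      proof (cases "j = s")
        case True
        have "((\<lambda>t. - (((yt t - y $ s) /\<^sub>R t) ** (mat 1 + c))) \<longlongrightarrow> - (comm x (y $ s) ** (mat 1 + c))) (at 0)"
          unfolding yt_def by (intro tendsto_intros mm.tendsto mexp_conj_diff_quotient)
        moreover have "((defect Y c (y' t) - defect Y c y) /\<^sub>R t) $ s = - (((yt t - y $ s) /\<^sub>R t) ** (mat 1 + c))" for t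
          by (simp add: y'_def mm.diff_left mm.scaleR_left flip: scaleR_minus_right)
        ultimately show ?thesis by (simp add: True w_def)
      qed (simp add: y'_def w_def)
    qed
    have "y' t $ j \<in> orbit j" for t j
      using orbit_conj[OF y[of s] K.mexp_mem[OF x', of t]] y
      by (simp add: y'_def yt_def K.adj_mexp[OF x'])
    then show "\<forall>\<^sub>F t in at 0. norm (defect Y c y) \<le> norm (defect Y c (y' t))"
      by (intro always_eventually allI min)
  qed
  moreover have "defect Y c y \<bullet> w = (\<Sum>j\<in>UNIV. if j = s then - ((defect Y c y $ s) \<bullet> (comm x (y $ s) ** (mat 1 + c))) else 0)"
    unfolding inner_vec_def[where 'b = 'i] w_def by (intro sum.cong) simp_all
  ultimately show ?thesis by simp
qed

text \<open>Minimise the distance between the gauge-transformed deformation and the product of the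
  K-orbits of the generators. A blow-up at nonzero minima would be a critical infinitesimal
  deformation, which the linearised relations exclude.\<close>

theorem rigidity:
  fixes Y :: "nat \<Rightarrow> 'i \<Rightarrow> 'n cmat" and \<theta> :: "nat \<Rightarrow> real"
  assumes fin: "coxeter_group_finite m"
    and \<eta>_braid: "\<And>s t. word_prod \<eta> (alt s t (m s t)) = word_prod \<eta> (alt t s (m s t))"
    and Y_sq: "\<And>n s. Y n s ** Y n s = - mat 1" and Y: "\<And>s. (\<lambda>n. Y n s) \<longlonglongrightarrow> \<eta> s"
    and \<theta>: "\<theta> \<longlonglongrightarrow> 0"
    and Y_braid: "\<And>n s t. word_prod (\<lambda>a. circ (Y n a) (pi / 2 + \<theta> n)) (alt s t (m s t))
      = word_prod (\<lambda>a. circ (Y n a) (pi / 2 + \<theta> n)) (alt t s (m s t))"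
  obtains r :: "nat \<Rightarrow> nat" and g y where "strict_mono r" "g \<longlonglongrightarrow> mat 1" "\<And>s. (\<lambda>n. y n s) \<longlonglongrightarrow> \<eta> s"
    "\<And>n s. y n s \<in> orbit s" "\<And>n s. g n ** Y (r n) s = y n s ** g n"
proof -
  obtain \<delta> where \<delta>: "0 < \<delta>"
    "\<And>c. c \<in> slice \<Longrightarrow> norm c \<le> \<delta> \<Longrightarrow> (\<And>s. \<exists>y \<in> orbit s. (mat 1 + c) ** \<eta> s = y ** (mat 1 + c)) \<Longrightarrow> c = 0"
    by (rule slice_transversal) blast
  define S where "S = (slice \<inter> cball 0 \<delta>) \<times> {y :: ('n cmat)^'i. \<forall>s. y $ s \<in> orbit s}"
  have "compact S"
    unfolding S_def
    by (intro compact_Times closed_Int_compact closed_subspace subspace_slice compact_cball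
        compact_cart compact_orbit)
  \<comment> \<open>The undeformed point \<open>c = 0\<close>, \<open>y = \<eta>\<close> has defect
    \<open>Y n s - \<eta> s\<close>, which tends to 0 and bounds the minima from above.\<close>
  have base: "(0, \<chi> s. \<eta> s) \<in> S"
    using \<delta>(1) by (simp add: S_def subspace_0[OF subspace_slice] eta_mem_orbit)
  have "\<exists>p\<in>S. \<forall>q\<in>S. norm (defect (Y n) (fst p) (snd p)) \<le> norm (defect (Y n) (fst q) (snd q))" for n
    using \<open>compact S\<close> base unfolding defect_def
    by (intro continuous_attains_inf continuous_intros mm.continuous_on) auto
  then obtain p where p: "\<And>n. p n \<in> S"
    "\<And>n q. q \<in> S \<Longrightarrow> norm (defect (Y n) (fst (p n)) (snd (p n))) \<le> norm (defect (Y n) (fst q) (snd q))"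
    by metis
  define d where "d n = defect (Y n) (fst (p n)) (snd (p n))" for n
  have d0: "d \<longlonglongrightarrow> 0"
  proof -
    have "(\<lambda>n. defect (Y n) 0 (\<chi> s. \<eta> s)) \<longlonglongrightarrow> 0"
    proof (rule vec_tendstoI)
      show "(\<lambda>n. defect (Y n) 0 (\<chi> s. \<eta> s) $ s) \<longlonglongrightarrow> 0 $ s" for s
        using tendsto_diff[OF Y tendsto_const, of s "\<eta> s"] by simp
    qed
    then have "(\<lambda>n. norm (defect (Y n) 0 (\<chi> s. \<eta> s))) \<longlonglongrightarrow> 0" by (rule tendsto_norm_zero)
    moreover have "norm (d n) \<le> norm (defect (Y n) 0 (\<chi> s. \<eta> s))" for n
      using p(2)[OF base, of n] by (simp add: d_def)
    ultimately show ?thesis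
      using Lim_null_comparison[of d "\<lambda>n. norm (defect (Y n) 0 (\<chi> s. \<eta> s))" sequentially] by simp
  qed
  obtain l r0 where l: "l \<in> S" and r0: "strict_mono r0" and pl: "(p \<circ> r0) \<longlonglongrightarrow> l"
    using \<open>compact S\<close> p(1) unfolding compact_def by blast
  define c where "c n = fst (p (r0 n))" for n
  define y where "y n s = snd (p (r0 n)) $ s" for n s
  have c_lim: "c \<longlonglongrightarrow> fst l" and y_lim: "(\<lambda>n. y n s) \<longlonglongrightarrow> snd l $ s" for s
    using tendsto_fst[OF pl] tendsto_vec_nth[OF tendsto_snd[OF pl], of s]
    by (simp_all add: c_def[abs_def] y_def[abs_def] o_def)
  have Yr0: "(\<lambda>n. Y (r0 n) s) \<longlonglongrightarrow> \<eta> s" for s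
    using LIMSEQ_subseq_LIMSEQ[OF Y r0] by (simp add: o_def)
  have dr0: "(\<lambda>n. d (r0 n)) \<longlonglongrightarrow> 0"
    using LIMSEQ_subseq_LIMSEQ[OF d0 r0] by (simp add: o_def)
  have limit_intertwines: "(mat 1 + fst l) ** \<eta> s = snd l $ s ** (mat 1 + fst l)" for s
  proof -
    have "(\<lambda>n. (mat 1 + c n) ** Y (r0 n) s - y n s ** (mat 1 + c n))
        \<longlonglongrightarrow> (mat 1 + fst l) ** \<eta> s - snd l $ s ** (mat 1 + fst l)"
      by (intro tendsto_intros mm.tendsto c_lim y_lim Yr0)
    moreover have "(\<lambda>n. (mat 1 + c n) ** Y (r0 n) s - y n s ** (mat 1 + c n)) \<longlonglongrightarrow> 0"
      using tendsto_vec_nth[OF dr0, of s] by (simp add: d_def c_def y_def)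
    ultimately show ?thesis using LIMSEQ_unique by force
  qed
  \<comment> \<open>A limit of minimisers solves the undeformed equation exactly, and there
    transversality leaves only \<open>c = 0\<close>; the equation then identifies the limit orbit
    points with \<open>\<eta> s\<close>.\<close>
  have "fst l = 0"
    by (rule \<delta>(2)) (use l limit_intertwines in \<open>auto simp: S_def\<close>)
  then have c0: "c \<longlonglongrightarrow> 0" and y0: "(\<lambda>n. y n s) \<longlonglongrightarrow> \<eta> s" for s
    using c_lim y_lim[of s] limit_intertwines[of s] by simp_all
  have y_orbit: "y n s \<in> orbit s" for n s
    using p(1)[of "r0 n"] by (auto simp: S_def y_def mem_Times_iff)
  have c_slice: "c n \<in> slice" "norm (c n) \<le> \<delta>" for n
    using p(1)[of "r0 n"] by (auto simp: S_def c_def mem_Times_iff)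
  have d_nth: "d (r0 n) $ s = (mat 1 + c n) ** Y (r0 n) s - y n s ** (mat 1 + c n)" for n s
    by (simp add: d_def c_def y_def)
  \<comment> \<open>Small minima are not enough: the minimum has to be exactly 0 from some index on,
    so that the conjugation into the orbits is exact.\<close>
  have "finite {n. d (r0 n) \<noteq> 0}"
  proof (rule ccontr)
    assume "infinite {n. d (r0 n) \<noteq> 0}"
    then obtain r1 :: "nat \<Rightarrow> nat" where r1: "strict_mono r1" "\<And>n. d (r0 (r1 n)) \<noteq> 0"
      using infinite_enumerate by blast
    define u where "u n = d (r0 (r1 n)) /\<^sub>R norm (d (r0 (r1 n)))" for n
    have "u n \<in> sphere 0 1" for n using r1(2) by (simp add: u_def)
    then obtain E r2 where E: "E \<in> sphere 0 1" and r2: "strict_mono r2" and uE: "(u \<circ> r2) \<longlonglongrightarrow> E"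
      using compact_sphere[of "0 :: ('n cmat)^'i" 1] unfolding compact_def by blast
    define r where "r = r1 \<circ> r2"
    have r: "strict_mono r" unfolding r_def using r1(1) r2 by (rule strict_mono_o)
    have "E $ s = 0" for s
    proof (rule linearised_relations[where Y = "\<lambda>n. Y (r0 (r n))" and y = "\<lambda>n. y (r n)" and c = "\<lambda>n. c (r n)"
          and \<epsilon> = "\<lambda>n. norm (d (r0 (r n)))" and \<theta> = "\<lambda>n. \<theta> (r0 (r n))" and E = "\<lambda>s. E $ s"])
      show "coxeter_group_finite m" by (rule fin)
      show "(\<lambda>n. Y (r0 (r n)) s) \<longlonglongrightarrow> \<eta> s" for s
        using LIMSEQ_subseq_LIMSEQ[OF Yr0 r] by (simp add: o_def)
      show "(\<lambda>n. \<theta> (r0 (r n))) \<longlonglongrightarrow> 0"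
        using LIMSEQ_subseq_LIMSEQ[OF LIMSEQ_subseq_LIMSEQ[OF \<theta> r0] r] by (simp add: o_def)
      show "(\<lambda>n. c (r n)) \<longlonglongrightarrow> 0"
        using LIMSEQ_subseq_LIMSEQ[OF c0 r] by (simp add: o_def)
      \<comment> \<open>Minimisers on the boundary of the ball could fail to be critical; since
        \<open>c\<close> tends to 0, this is excluded eventually.\<close>
      then have c_small: "\<forall>\<^sub>F n in sequentially. norm (c (r n)) < \<delta>"
        using \<delta>(1) by (intro order_tendstoD(2)[OF tendsto_norm_zero])
      show "(\<lambda>n. y (r n) s) \<longlonglongrightarrow> \<eta> s" for s
        using LIMSEQ_subseq_LIMSEQ[OF y0 r] by (simp add: o_def)
      show "0 < norm (d (r0 (r n)))" for n using r1(2) by (simp add: r_def)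
      show "(\<lambda>n. norm (d (r0 (r n)))) \<longlonglongrightarrow> 0"
        using tendsto_norm_zero[OF LIMSEQ_subseq_LIMSEQ[OF dr0 r]] by (simp add: o_def)
      show "(\<lambda>n. ((mat 1 + c (r n)) ** Y (r0 (r n)) s - y (r n) s ** (mat 1 + c (r n))) /\<^sub>R norm (d (r0 (r n))))
          \<longlonglongrightarrow> E $ s" for s
        using tendsto_vec_nth[OF uE, of s] by (simp add: u_def r_def o_def d_nth)
      show "\<forall>\<^sub>F n in sequentially. (\<Sum>s\<in>UNIV. ((mat 1 + c (r n)) ** Y (r0 (r n)) s - y (r n) s ** (mat 1 + c (r n)))
          \<bullet> (z ** Y (r0 (r n)) s - y (r n) s ** z)) = 0" if z: "z \<in> slice" for z
        using c_small
      proof eventually_elim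
        case (elim n)
        let ?y = "\<chi> s. y (r n) s"
        have "norm (defect (Y (r0 (r n))) (c (r n)) ?y) \<le> norm (defect (Y (r0 (r n))) c' ?y)"
          if "c' \<in> slice" "norm c' \<le> \<delta>" for c'
          using p(2)[of "(c', ?y)" "r0 (r n)"] that y_orbit by (simp add: S_def c_def y_def)
        from defect_critical_gauge[OF this c_slice(1) elim z] show ?case by simp
      qed
      show "((mat 1 + c (r n)) ** Y (r0 (r n)) s - y (r n) s ** (mat 1 + c (r n)))
          \<bullet> (comm x (y (r n) s) ** (mat 1 + c (r n))) = 0" if x: "x \<in> H" for n s x
      proof -
        let ?y = "\<chi> s. y (r n) s"
        have "norm (defect (Y (r0 (r n))) (c (r n)) ?y) \<le> norm (defect (Y (r0 (r n))) (c (r n)) y')"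
          if "\<And>s. y' $ s \<in> orbit s" for y'
          using p(2)[of "(c (r n), y')" "r0 (r n)"] that c_slice by (simp add: S_def c_def y_def)
        from defect_critical_orbit[OF this _ x, of s] show ?thesis by (simp add: y_orbit)
      qed
    qed (fact \<eta>_braid Y_sq Y_braid y_orbit)+
    then have "E = 0" by (simp add: vec_eq_iff[where 'b = 'i])
    then show False using E by simp
  qed
  then obtain N where N: "\<And>n. N \<le> n \<Longrightarrow> d (r0 n) = 0"
    using finite_nat_set_iff_bounded by (metis (mono_tags, lifting) mem_Collect_eq not_le)
  show ?thesis
  proof (rule that)
    have shift: "strict_mono (\<lambda>n :: nat. n + N)" by (simp add: strict_mono_def)
    show "strict_mono (\<lambda>n. r0 (n + N))"
      using strict_mono_o[OF r0 shift] by (simp add: o_def)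
    have "(\<lambda>n. mat 1 + c (n + N)) \<longlonglongrightarrow> mat 1 + 0"
      by (intro tendsto_intros LIMSEQ_ignore_initial_segment c0)
    then show "(\<lambda>n. mat 1 + c (n + N)) \<longlonglongrightarrow> mat 1" by simp
    show "(\<lambda>n. y (n + N) s) \<longlonglongrightarrow> \<eta> s" for s by (rule LIMSEQ_ignore_initial_segment[OF y0])
    show "y (n + N) s \<in> orbit s" for n s by (rule y_orbit)
    show "(mat 1 + c (n + N)) ** Y (r0 (n + N)) s = y (n + N) s ** (mat 1 + c (n + N))" for n s
      using N[of "n + N"] d_nth[of "n + N" s] by simp
  qed
qed

text \<open>Lower semicontinuity of the Lie algebra: limits of Lie algebra elements form a Lie algebra,
  so a unit vector of H orthogonal to all members of the sequence cannot survive in the limit.\<close>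

theorem lie_algebra_eventually:
  fixes y :: "nat \<Rightarrow> 'i \<Rightarrow> 'n cmat"
  assumes y_orbit: "\<And>n s. y n s \<in> orbit s" and y: "\<And>s. (\<lambda>n. y n s) \<longlonglongrightarrow> \<eta> s"
  shows "\<exists>n. lie_algebra_of (closure (circ_group (y n))) = H"
proof (rule ccontr)
  assume neg: "\<not> ?thesis"
  have y_sq: "y n s ** y n s = - mat 1" for n s by (rule orbit_square[OF y_orbit])
  have y_skew: "adj (y n s) = - y n s" for n s by (rule H_skew[OF orbit_mem_H[OF y_orbit]])
  define M where "M n = lie_algebra_of (closure (circ_group (y n)))" for n
  have cug: "closed_unitary_group (closure (circ_group (y n)))" for n
    by (rule closed_unitary_group_closure[OF circ_group.one circ_group_mult adj_circ_group[OF y_skew]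
          unitary_circ_group[OF y_sq y_skew]])
  have subM: "subspace (M n)" and brM: "bracket_closed (M n)" for n
    unfolding M_def
    by (rule closed_unitary_group.subspace_lie_algebra[OF cug]
        closed_unitary_group.bracket_closed_lie_algebra[OF cug])+
  have "circ_group (y n) \<subseteq> K" for n
  proof
    fix A assume "A \<in> circ_group (y n)"
    then show "A \<in> K" by induction (simp_all add: K.one_mem K.mult_mem orbit_circ_mem[OF y_orbit])
  qed
  then have "closure (circ_group (y n)) \<subseteq> K" for n by (simp add: closure_minimal)
  then have "M n \<subseteq> H" for n unfolding M_def lie_algebra_K[symmetric] lie_algebra_of_def by blast
  have "\<exists>X. X \<in> H \<and> norm X = 1 \<and> (\<forall>Z\<in>M n. X \<bullet> Z = 0)" for n
  proof -
    obtain X where X: "X \<in> H" "X \<notin> M n" using neg \<open>M n \<subseteq> H\<close> unfolding M_def by blast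
    obtain a b where ab: "a \<in> span (M n)" "\<And>w. w \<in> span (M n) \<Longrightarrow> orthogonal b w" "X = a + b"
      by (rule orthogonal_subspace_decomp_exists[of "M n" X]) blast
    have spanM: "span (M n) = M n" by (simp add: span_eq_iff subM)
    have "b \<noteq> 0" using X(2) ab spanM by auto
    have "b \<in> H"
      using subspace_diff[OF subspace_real_lie_gen X(1), of a] ab \<open>M n \<subseteq> H\<close> spanM by auto
    then show ?thesis
      using \<open>b \<noteq> 0\<close> ab(2) spanM
      by (intro exI[of _ "b /\<^sub>R norm b"]) (auto simp: orthogonal_def subspace_scale subspace_real_lie_gen)
  qed
  then obtain X where X: "\<And>n. X n \<in> H" "\<And>n. norm (X n) = 1" "\<And>n Z. Z \<in> M n \<Longrightarrow> X n \<bullet> Z = 0"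
    by metis
  have "\<And>n. X n \<in> sphere 0 1" using X(2) by simp
  then obtain l r where l: "l \<in> sphere 0 1" and r: "strict_mono r" and Xl: "(X \<circ> r) \<longlonglongrightarrow> l"
    using compact_sphere[of "0 :: 'n cmat" 1] unfolding compact_def by blast
  have Xl': "(\<lambda>n. X (r n)) \<longlonglongrightarrow> l" using Xl by (simp add: o_def)
  have "l \<in> H"
    by (rule closed_sequentially[OF closed_subspace[OF subspace_real_lie_gen] _ Xl']) (rule X)
  define L where "L = {Z. \<exists>f. (\<forall>n. f n \<in> M n) \<and> f \<longlonglongrightarrow> Z}"
  have LI: "Z \<in> L" if "\<And>n. f n \<in> M n" "f \<longlonglongrightarrow> Z" for f Z using that by (auto simp: L_def)
  have LE: "\<exists>f. (\<forall>n. f n \<in> M n) \<and> f \<longlonglongrightarrow> Z" if "Z \<in> L" for Z using that by (simp add: L_def)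
  have "H \<subseteq> L"
  proof (rule real_lie_gen_least)
    have "y n s \<in> M n" for n s
    proof -
      have "circ (y n s) t \<in> closure (circ_group (y n))" for t
        by (rule subsetD[OF closure_subset circ_mem_circ_group])
      then show ?thesis by (simp add: M_def lie_algebra_of_def mexp_eq_circ[OF y_sq])
    qed
    then show "range \<eta> \<subseteq> L" using LI[OF _ y] by auto
    show "subspace L"
      unfolding subspace_def
    proof (intro conjI ballI allI)
      show "0 \<in> L" by (rule LI[of "\<lambda>_. 0"]) (simp_all add: subspace_0 subM)
      fix a b assume a: "a \<in> L"
      then obtain f where f: "\<forall>n. f n \<in> M n" "f \<longlonglongrightarrow> a" using LE by blast
      show "k *\<^sub>R a \<in> L" for k :: real
        by (rule LI[of "\<lambda>n. k *\<^sub>R f n"]) (use f in \<open>auto intro: tendsto_intros subspace_scale[OF subM]\<close>)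
      assume "b \<in> L"
      then obtain g where g: "\<forall>n. g n \<in> M n" "g \<longlonglongrightarrow> b" using LE by blast
      show "a + b \<in> L"
        by (rule LI[of "\<lambda>n. f n + g n"]) (use f g in \<open>auto intro: tendsto_intros subspace_add[OF subM]\<close>)
    qed
    show "bracket_closed L"
      unfolding bracket_closed_def
    proof (intro ballI)
      fix a b assume "a \<in> L" "b \<in> L"
      then obtain f g where f: "\<forall>n. f n \<in> M n" "f \<longlonglongrightarrow> a" and g: "\<forall>n. g n \<in> M n" "g \<longlonglongrightarrow> b"
        using LE by metis
      have "(\<lambda>n. comm (f n) (g n)) \<longlonglongrightarrow> comm a b"
        unfolding comm_def by (intro tendsto_intros mm.tendsto f g)
      moreover have "comm (f n) (g n) \<in> M n" for n
        using brM f(1) g(1) by (simp add: bracket_closed_def)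
      ultimately show "comm a b \<in> L" by (intro LI)
    qed
  qed
  then obtain f where f: "\<forall>n. f n \<in> M n" "f \<longlonglongrightarrow> l" using LE \<open>l \<in> H\<close> by blast
  have "(\<lambda>n. X (r n) \<bullet> f (r n)) \<longlonglongrightarrow> l \<bullet> l"
    using LIMSEQ_subseq_LIMSEQ[OF f(2) r] by (intro tendsto_inner Xl') (simp add: o_def)
  moreover have "X n \<bullet> f n = 0" for n using X(3) f(1) by simp
  ultimately have "l \<bullet> l = 0" by (simp add: LIMSEQ_const_iff)
  then show False using l by simp
qed

end

section \<open>Unitarisation\<close>

text \<open>The sesquilinear form of \<open>P\<close>, with complex values; the inner product of the
  vector type retains only a real part.\<close>

definition herm :: "'n::finite cmat \<Rightarrow> complex^'n \<Rightarrow> complex^'n \<Rightarrow> complex" where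
  "herm P x y = (\<Sum>i\<in>UNIV. (P *v x) $ i * cnj (y $ i))"

lemma herm_add: "herm (A + B) x y = herm A x y + herm B x y"
  by (simp add: herm_def mv.add_left distrib_right sum.distrib)

lemma herm_sum: "herm (\<Sum>a\<in>Q. f a) x y = (\<Sum>a\<in>Q. herm (f a) x y)"
  by (induction Q rule: infinite_finite_induct) (simp_all add: herm_add, simp_all add: herm_def)

lemma herm_scale: "herm P (c *s x) y = c * herm P x y" "herm P x (c *s y) = cnj c * herm P x y"
  by (simp_all add: herm_def vec.scale sum_distrib_left algebra_simps)

lemma herm_gram: "herm (adj A ** A) x y = (\<Sum>i\<in>UNIV. (A *v x) $ i * cnj ((A *v y) $ i))"
proof -
  have "(\<Sum>i\<in>UNIV. \<Sum>k\<in>UNIV. cnj (A $ k $ i) * v $ k * cnj (y $ i))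
      = (\<Sum>k\<in>UNIV. \<Sum>i\<in>UNIV. cnj (A $ k $ i) * v $ k * cnj (y $ i))" for v :: "complex^'a"
    by (rule sum.swap)
  then have "(\<Sum>i\<in>UNIV. (adj A *v v) $ i * cnj (y $ i)) = (\<Sum>k\<in>UNIV. v $ k * cnj ((A *v y) $ k))"
    for v :: "complex^'a"
    by (simp add: matrix_vector_mult_def adj_def sum_distrib_left sum_distrib_right algebra_simps)
  then show ?thesis by (simp add: herm_def flip: matrix_vector_mul_assoc)
qed

lemma herm_gram_self: "herm (adj A ** A) x x = of_real ((norm (A *v x))\<^sup>2)"
  unfolding herm_gram
  by (simp add: norm_vec_def L2_set_def real_sqrt_pow2 sum_nonneg flip: complex_norm_square)

text \<open>An orthonormal family for the form is built over growing subsets of the index type. Each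
  new vector comes from a kernel instead of a projection formula.\<close>

lemma gram_schmidt:
  fixes P :: "'n::finite cmat"
  assumes sym: "\<And>x y. herm P y x = cnj (herm P x y)"
    and pos: "\<And>x. x \<noteq> 0 \<Longrightarrow> \<exists>r>0. herm P x x = of_real r"
  obtains A :: "'n cmat" where "adj A ** P ** A = mat 1"
proof -
  have "\<exists>a :: 'n \<Rightarrow> complex^'n. \<forall>i\<in>I. \<forall>j\<in>I. herm P (a i) (a j) = (if i = j then 1 else 0)"
    if "finite I" for I :: "'n set"
    using that
  proof induction
    case (insert k I)
    then obtain a :: "'n \<Rightarrow> complex^'n"
      where a: "\<And>i j. i \<in> I \<Longrightarrow> j \<in> I \<Longrightarrow> herm P (a i) (a j) = (if i = j then 1 else 0)"
      by blast
    \<comment> \<open>The rows in \<open>I\<close> encode orthogonality to the vectors already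
      chosen. Row \<open>k\<close> is zero, so \<open>M\<close> is singular and has a nonzero kernel
      vector.\<close>
    define M :: "'n cmat" where
      "M = (\<chi> i j. if i \<in> I then \<Sum>l\<in>UNIV. P $ l $ j * cnj (a i $ l) else 0)"
    have "row k M = 0" using insert.hyps by (simp add: row_def M_def vec_eq_iff)
    then have "det M = 0" by (rule det_zero_row)
    then have "\<not> (\<exists>B. B ** M = mat 1)"
      using invertible_det_nz[of M] invertible_left_inverse[of M] by blast
    then obtain v where v: "v \<noteq> 0" "M *v v = 0" by (auto simp: matrix_left_invertible_ker)
    have orth: "herm P v (a i) = 0" if "i \<in> I" for i
    proof -
      have "(M *v v) $ i = (\<Sum>j\<in>UNIV. \<Sum>l\<in>UNIV. P $ l $ j * v $ j * cnj (a i $ l))"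
        using that by (simp add: M_def matrix_vector_mult_def sum_distrib_left sum_distrib_right algebra_simps)
      also have "\<dots> = herm P v (a i)"
        by (subst sum.swap) (simp add: herm_def matrix_vector_mult_def sum_distrib_right)
      finally show ?thesis using v(2) by simp
    qed
    obtain r where r: "0 < r" "herm P v v = of_real r" using pos[OF v(1)] by blast
    define q where "q = 1 / sqrt r"
    define w where "w = complex_of_real q *s v"
    have ww: "herm P w w = 1"
    proof -
      have "herm P w w = of_real (q * q * r)" by (simp add: w_def herm_scale r(2))
      also have "q * q * r = 1" using r(1) by (simp add: q_def)
      finally show ?thesis by simp
    qed
    have wa: "herm P w (a i) = 0" "herm P (a i) w = 0" if "i \<in> I" for i
      using orth[OF that] sym[of "a i" v] by (simp_all add: w_def herm_scale)
    show ?case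
      using a ww wa insert.hyps by (intro exI[of _ "a(k := w)"]) auto
  qed simp
  from this[of UNIV] obtain a :: "'n \<Rightarrow> complex^'n"
    where a: "\<And>i j. herm P (a i) (a j) = (if i = j then 1 else 0)" by auto
  define A :: "'n cmat" where "A = (\<chi> l j. a j $ l)"
  have "(adj A ** P ** A) $ i $ j = herm P (a j) (a i)" for i j
    by (simp add: A_def adj_def herm_def matrix_matrix_mult_def matrix_vector_mult_def
        sum_distrib_left sum_distrib_right algebra_simps flip: matrix_mul_assoc) (rule sum.swap)
  then have "adj A ** P ** A = mat 1" by (auto simp: vec_eq_iff a mat_def)
  then show ?thesis by (rule that)
qed

lemma word_prod_weq:
  fixes \<rho> :: "'i \<Rightarrow> 'n::finite cmat"
  assumes "\<And>s. \<rho> s ** \<rho> s = mat 1"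
    and "\<And>s t. word_prod \<rho> (alt s t (m s t)) = word_prod \<rho> (alt t s (m s t))"
    and "weq m u v"
  shows "word_prod \<rho> u = word_prod \<rho> v"
  using assms(3)
proof induction
  case (weq_braid s t)
  show ?case by (rule assms(2))
qed (simp_all add: word_prod_append assms(1))

text \<open>Weyl's averaging: \<open>P\<close> sums \<open>adj A ** A\<close> over the finite image
  of W and is an invariant positive form. An orthonormal basis for \<open>P\<close>, taken as
  columns of \<open>A\<close>, conjugates the group into the unitary group; \<open>h\<close> is the
  inverse of \<open>A\<close>.\<close>

lemma unitarisation:
  fixes \<rho> :: "'i \<Rightarrow> 'n::finite cmat"
  assumes fin: "coxeter_group_finite m"
    and sq: "\<And>s. \<rho> s ** \<rho> s = mat 1"
    and braid: "\<And>s t. word_prod \<rho> (alt s t (m s t)) = word_prod \<rho> (alt t s (m s t))"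
  obtains h :: "'n cmat" and h' :: "'n cmat" where "h ** h' = mat 1" "h' ** h = mat 1" "\<And>s. adj (h ** \<rho> s ** h') = h ** \<rho> s ** h'"
proof -
  define Q where "Q = range (word_prod \<rho>)"
  have finQ: "finite Q" unfolding Q_def by (rule weq_imp_finite_range[OF fin word_prod_weq[OF sq braid]])
  define P where "P = (\<Sum>A\<in>Q. adj A ** A)"
  have Pherm: "herm P x y = (\<Sum>A\<in>Q. \<Sum>i\<in>UNIV. (A *v x) $ i * cnj ((A *v y) $ i))" for x y
    by (simp add: P_def herm_sum herm_gram)
  have one: "mat 1 \<in> Q" unfolding Q_def by (rule image_eqI[of _ _ "[]"]) simp_all
  have "herm P y x = cnj (herm P x y)" for x y
    by (simp add: Pherm mult.commute)
  moreover have "\<exists>r>0. herm P x x = of_real r" if "x \<noteq> 0" for x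
  proof (intro exI conjI)
    show "herm P x x = of_real (\<Sum>A\<in>Q. (norm (A *v x))\<^sup>2)"
      by (simp add: P_def herm_sum herm_gram_self)
    show "0 < (\<Sum>A\<in>Q. (norm (A *v x))\<^sup>2)"
      using that one by (intro sum_pos2[OF finQ one]) auto
  qed
  ultimately obtain A where A: "adj A ** P ** A = mat 1" by (rule gram_schmidt)
  have AA: "A ** (adj A ** P) = mat 1" by (rule matrix_left_right_inverse1[OF A])
  have inv: "adj (\<rho> s) ** P ** \<rho> s = P" for s
  proof -
    have QQ: "B ** \<rho> s \<in> Q" if B: "B \<in> Q" for B
    proof -
      obtain w where "B = word_prod \<rho> w" using B by (auto simp: Q_def)
      then have "B ** \<rho> s = word_prod \<rho> (w @ [s])" by (simp add: word_prod_append)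
      then show ?thesis by (auto simp: Q_def)
    qed
    have "adj (\<rho> s) ** P ** \<rho> s = (\<Sum>B\<in>Q. adj (B ** \<rho> s) ** (B ** \<rho> s))"
      unfolding P_def mm.sum_left mm.sum_right by (simp only: adj_mult matrix_mul_assoc)
    \<comment> \<open>Right multiplication by \<open>\<rho> s\<close> permutes \<open>Q\<close> and
      is its own inverse.\<close>
    also have "\<dots> = (\<Sum>B\<in>Q. adj B ** B)"
      by (rule sum.reindex_bij_witness[of _ "\<lambda>B. B ** \<rho> s" "\<lambda>B. B ** \<rho> s"])
         (simp_all add: QQ sq flip: matrix_mul_assoc)
    finally show ?thesis by (simp add: P_def)
  qed
  show ?thesis
  proof (rule that[of "adj A ** P" A])
    show "(adj A ** P) ** A = mat 1" by (rule A)
    show "A ** (adj A ** P) = mat 1" by (rule AA)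
    fix s
    define S where "S = adj A ** P ** \<rho> s ** A"
    have SS: "S ** S = mat 1"
    proof -
      have "S ** S = adj A ** P ** \<rho> s ** (A ** (adj A ** P)) ** \<rho> s ** A"
        by (simp only: S_def matrix_mul_assoc)
      also have "\<dots> = adj A ** P ** (\<rho> s ** \<rho> s) ** A"
        unfolding AA matrix_mul_rid by (simp only: matrix_mul_assoc)
      finally show ?thesis by (simp add: sq A)
    qed
    have P_adj: "adj P = P"
    proof -
      have "adj (\<Sum>A\<in>F. adj A ** A) = (\<Sum>A\<in>F. adj A ** A)" for F :: "'n cmat set"
        by (induction F rule: infinite_finite_induct) (simp_all add: adj_mult)
      then show ?thesis by (simp add: P_def)
    qed
    have "adj S ** S = adj A ** adj (\<rho> s) ** P ** (A ** (adj A ** P)) ** \<rho> s ** A"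
      by (simp only: S_def adj_mult adj_simps P_adj matrix_mul_assoc)
    also have "\<dots> = adj A ** (adj (\<rho> s) ** P ** \<rho> s) ** A"
      unfolding AA matrix_mul_rid by (simp only: matrix_mul_assoc)
    also have "\<dots> = mat 1" by (simp only: inv A)
    finally have "adj S ** S ** S = S" by simp
    \<comment> \<open>A unitary involution is Hermitian.\<close>
    then have "adj S = S" by (simp add: SS flip: matrix_mul_assoc)
    then show "adj (adj A ** P ** \<rho> s ** A) = adj A ** P ** \<rho> s ** A" by (simp add: S_def)
  qed
qed

section \<open>Images of pure and of even words\<close>

lemma length_alt: "length (alt s t k) = k"
  by (induction k arbitrary: s t) simp_all

text \<open>The sign character is well defined: a square has length 2 and the two sides of a braid
  relation have equal length.\<close>

lemma weq_even_length: "weq m u v \<Longrightarrow> even (length u) = even (length v)"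
  by (induction rule: weq.induct) (auto simp: length_alt)

lemma pure_words_subset_even_words: "pure_words m \<subseteq> even_words"
  using weq_even_length by (fastforce simp: pure_words_def even_words_def)

lemma pure_words_append:
  assumes "u \<in> pure_words m" "v \<in> pure_words m"
  shows "u @ v \<in> pure_words m"
proof -
  have "weq m (map fst u @ map fst v @ []) (map fst u @ [] @ [])"
    by (rule weq_ctxt) (use assms in \<open>simp add: pure_words_def\<close>)
  then show ?thesis using assms weq_trans by (fastforce simp: pure_words_def)
qed

lemma replicate_pure_word: "replicate (2 * k) (s, True) \<in> pure_words m"
proof (induction k)
  case 0
  show ?case by (simp add: pure_words_def weq_refl)
next
  case (Suc k)
  have "[(s, True), (s, True)] \<in> pure_words m" by (simp add: pure_words_def weq_sq)
  from pure_words_append[OF this Suc] show ?case by simp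
qed

lemma artin_eval_simps [simp]:
  "artin_eval R [] = mat 1"
  "artin_eval R ((s, b) # w) = (if b then R s else matrix_inv (R s)) ** artin_eval R w"
  by (simp_all add: artin_eval_def)

lemma artin_eval_append: "artin_eval R (u @ v) = artin_eval R u ** artin_eval R v"
  by (simp add: artin_eval_def word_prod_append)

lemma matrix_inv_eqI:
  fixes A :: "'n::finite cmat"
  assumes "A ** B = mat 1"
  shows "matrix_inv A = B"
proof -
  have BA: "B ** A = mat 1" by (rule matrix_left_right_inverse1[OF assms])
  then have "A ** matrix_inv A = mat 1"
    unfolding matrix_inv_def using assms by (metis (mono_tags, lifting) someI_ex)
  then have "B ** A ** matrix_inv A = B" by (simp flip: matrix_mul_assoc)
  then show ?thesis by (simp add: BA)
qed

lemma circ_shift_pi: "circ Y (t + pi) = - circ Y t"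
  by (simp add: circ_def)

text \<open>Kronecker's theorem: the multiples of \<open>2 * \<theta>\<close> are dense modulo
  \<open>2 * pi\<close> because \<open>\<theta> / pi\<close> is irrational.\<close>

lemma closure_multiples_circ:
  assumes irrat: "\<theta> / pi \<notin> \<rat>" and mem: "\<And>k :: nat. circ Y (real k * (2 * \<theta>)) \<in> \<Gamma>"
  shows "circ Y t \<in> closure \<Gamma>"
  unfolding closure_approachable
proof (intro allI impI)
  fix e :: real assume "0 < e"
  have "isCont (circ Y) t" unfolding circ_def[abs_def] by (intro continuous_intros)
  then obtain \<delta> where \<delta>: "0 < \<delta>" "\<And>x. \<bar>x - t\<bar> < \<delta> \<Longrightarrow> dist (circ Y x) (circ Y t) < e"
    using \<open>0 < e\<close> unfolding continuous_at_eps_delta dist_real_def by blast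
  \<comment> \<open>Dividing angles by \<open>2 * pi\<close> turns the claim into one on fractional
    parts of multiples of \<open>\<theta> / pi\<close>. Positivity of \<open>k\<close> makes it a
    natural exponent, and \<open>h\<close> is a number of full turns.\<close>
  obtain h k :: int where k: "0 < k" and hk: "\<bar>of_int k * (\<theta> / pi) - of_int h - t / (2 * pi)\<bar> < \<delta> / (2 * pi)"
    by (rule sequence_of_fractional_parts_is_dense[OF irrat, of "\<delta> / (2 * pi)"]) (use \<delta>(1) in auto)
  define x where "x = real (nat k) * (2 * \<theta>) - 2 * pi * of_int h"
  have "x - t = 2 * pi * (of_int k * (\<theta> / pi) - of_int h - t / (2 * pi))"
    using k by (simp add: x_def field_simps)
  then have "\<bar>x - t\<bar> = 2 * pi * \<bar>of_int k * (\<theta> / pi) - of_int h - t / (2 * pi)\<bar>"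
    by (simp add: abs_mult)
  also have "\<dots> < 2 * pi * (\<delta> / (2 * pi))" using hk by (intro mult_strict_left_mono) auto
  finally have "dist (circ Y x) (circ Y t) < e" by (intro \<delta>(2)) simp
  moreover have "circ Y x = circ Y (real (nat k) * (2 * \<theta>))"
    by (simp add: circ_def x_def cos_diff sin_diff cos_int_2pin sin_int_2pin)
  ultimately show "\<exists>A\<in>\<Gamma>. dist A (circ Y t) < e" using mem[of "nat k"] by metis
qed

text \<open>A letter of the Artin word is \<open>-\<i>\<close> times an element of the circle subgroup, so a pair of
  letters lies in the group generated by these subgroups.\<close>

lemma closure_artin_eval:
  fixes Y :: "'i \<Rightarrow> 'n::finite cmat"
  assumes sq: "\<And>s. Y s ** Y s = - mat 1" and irrat: "\<theta> / pi \<notin> \<rat>"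
  defines "T \<equiv> \<lambda>s. csmult (- \<i>) (circ (Y s) (pi / 2 + \<theta>))"
  shows "closure (artin_eval T ` pure_words m) = closure (circ_group Y)"
    and "closure (artin_eval T ` even_words) = closure (circ_group Y)"
proof -
  \<comment> \<open>The two scalars multiply to -1 and the two angles add up to \<open>pi\<close>,
    where the circle also takes the value -1.\<close>
  have inv: "matrix_inv (T s) = csmult (- \<i>) (circ (Y s) (pi / 2 - \<theta>))" for s
  proof (rule matrix_inv_eqI)
    have "T s ** csmult (- \<i>) (circ (Y s) (pi / 2 - \<theta>)) = - circ (Y s) ((pi / 2 + \<theta>) + (pi / 2 - \<theta>))"
      unfolding T_def circ_add[OF sq] by (simp add: csmult_mult mm.minus_left mm.minus_right)
    also have "\<dots> = mat 1" by (simp add: circ_def)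
    finally show "T s ** csmult (- \<i>) (circ (Y s) (pi / 2 - \<theta>)) = mat 1" .
  qed
  have letter: "\<exists>\<tau>. (if b then T s else matrix_inv (T s)) = csmult (- \<i>) (circ (Y s) \<tau>)" for s b
    using inv by (auto simp: T_def)
  have even: "artin_eval T w \<in> circ_group Y" if "even (length w)" for w
    using that
  proof (induction w rule: induct_list012)
    case (3 x y w)
    obtain s b t c where xy: "x = (s, b)" "y = (t, c)" by force
    obtain \<sigma> \<tau> where "(if b then T s else matrix_inv (T s)) = csmult (- \<i>) (circ (Y s) \<sigma>)"
      "(if c then T t else matrix_inv (T t)) = csmult (- \<i>) (circ (Y t) \<tau>)"
      using letter by metis
    then have "artin_eval T (x # y # w)
        = csmult (- \<i>) (circ (Y s) \<sigma>) ** (csmult (- \<i>) (circ (Y t) \<tau>) ** artin_eval T w)"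
      by (simp only: xy artin_eval_simps)
    \<comment> \<open>The product -1 of the two scalars is absorbed into the first circle as a shift
      by \<open>pi\<close>.\<close>
    also have "\<dots> = circ (Y s) (\<sigma> + pi) ** (circ (Y t) \<tau> ** artin_eval T w)"
      by (simp add: csmult_mult circ_shift_pi mm.minus_left mm.minus_right)
    finally show ?case using 3 by (simp add: circ_group.step)
  qed (simp_all add: circ_group.one)
  have pow: "artin_eval T (replicate (2 * k) (s, True)) = circ (Y s) (real k * (2 * \<theta>))" for s k
  proof (induction k)
    case (Suc k)
    have "T s ** T s = circ (Y s) (2 * \<theta>)"
    proof -
      have "T s ** T s = - circ (Y s) ((pi / 2 + \<theta>) + (pi / 2 + \<theta>))"
        unfolding T_def circ_add[OF sq] by (simp add: csmult_mult mm.minus_left mm.minus_right)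
      also have "(pi / 2 + \<theta>) + (pi / 2 + \<theta>) = 2 * \<theta> + pi" by simp
      finally show ?thesis by (simp add: circ_shift_pi)
    qed
    then have "artin_eval T (replicate (2 * Suc k) (s, True))
        = circ (Y s) (2 * \<theta>) ** artin_eval T (replicate (2 * k) (s, True))"
      by (simp add: matrix_mul_assoc)
    also have "\<dots> = circ (Y s) (2 * \<theta> + real k * (2 * \<theta>))" by (simp only: Suc circ_add[OF sq])
    finally show ?case by (simp add: algebra_simps)
  qed simp
  define \<Gamma> where "\<Gamma> = artin_eval T ` pure_words m"
  have \<Gamma>mult: "A ** B \<in> \<Gamma>" if AB: "A \<in> \<Gamma>" "B \<in> \<Gamma>" for A B
  proof -
    obtain u v where "u \<in> pure_words m" "v \<in> pure_words m" "A = artin_eval T u" "B = artin_eval T v"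
      using AB by (auto simp: \<Gamma>_def)
    then have "u @ v \<in> pure_words m" "A ** B = artin_eval T (u @ v)"
      by (simp_all add: pure_words_append artin_eval_append)
    then show ?thesis unfolding \<Gamma>_def by blast
  qed
  have circ_mem: "circ (Y s) t \<in> closure \<Gamma>" for s t
  proof (rule closure_multiples_circ[OF irrat])
    show "circ (Y s) (real k * (2 * \<theta>)) \<in> \<Gamma>" for k
      unfolding \<Gamma>_def pow[symmetric] by (rule imageI[OF replicate_pure_word])
  qed
  have "mat 1 \<in> closure \<Gamma>" using circ_mem[of undefined 0] by simp
  have "circ_group Y \<subseteq> closure \<Gamma>"
  proof
    fix A assume "A \<in> circ_group Y"
    then show "A \<in> closure \<Gamma>"
      by induction (simp_all add: \<open>mat 1 \<in> closure \<Gamma>\<close> closure_mult_mem[OF \<Gamma>mult] circ_mem)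
  qed
  \<comment> \<open>The inclusions form a cycle through circle group, pure words, even words and
    back, so all three closures coincide.\<close>
  then have lower: "closure (circ_group Y) \<subseteq> closure \<Gamma>" by (simp add: closure_minimal)
  have mid: "closure \<Gamma> \<subseteq> closure (artin_eval T ` even_words)"
    unfolding \<Gamma>_def by (intro closure_mono image_mono pure_words_subset_even_words)
  have "artin_eval T ` even_words \<subseteq> circ_group Y" using even by (auto simp: even_words_def)
  then have upper: "closure (artin_eval T ` even_words) \<subseteq> closure (circ_group Y)" by (rule closure_mono)
  show "closure (artin_eval T ` pure_words m) = closure (circ_group Y)"
    using lower mid upper unfolding \<Gamma>_def by auto
  show "closure (artin_eval T ` even_words) = closure (circ_group Y)"
    using lower mid upper by auto
qed

section \<open>Transport by conjugation\<close>

text \<open>Conjugation by \<open>g\<close> is an algebra automorphism and a homeomorphism but need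
  not respect \<open>adj\<close>. Properties of unitary groups are therefore transported as group,
  topological and Lie-theoretic facts.\<close>

locale inverse_pair =
  fixes g h :: "'n::finite cmat"
  assumes gh: "g ** h = mat 1"
begin

lemma hg: "h ** g = mat 1"
  by (rule matrix_left_right_inverse1[OF gh])

definition cj :: "'n cmat \<Rightarrow> 'n cmat" where
  "cj A = g ** A ** h"

lemma cj_mult: "cj (A ** B) = cj A ** cj B"
proof -
  have "cj A ** cj B = g ** A ** (h ** g) ** B ** h"
    by (simp only: cj_def matrix_mul_assoc)
  then show ?thesis by (simp add: hg cj_def matrix_mul_assoc)
qed

lemma cj_simps:
  "cj 0 = 0" "cj (mat 1) = mat 1" "cj (A + B) = cj A + cj B" "cj (A - B) = cj A - cj B"
  "cj (r *\<^sub>R A) = r *\<^sub>R cj A" "cj (csmult c A) = csmult c (cj A)" "cj (comm A B) = comm (cj A) (cj B)"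
proof -
  show "cj (A - B) = cj A - cj B" for A B by (simp add: cj_def mat_ring)
  then show "cj (comm A B) = comm (cj A) (cj B)" by (simp add: comm_def cj_mult)
qed (simp_all add: cj_def mat_ring gh csmult_mult)

lemma linear_cj: "linear cj"
  by (intro linearI) (simp_all add: cj_simps)

lemma cj_inverse: "h ** cj A ** g = A"
proof -
  have "h ** cj A ** g = (h ** g) ** A ** (h ** g)" by (simp only: cj_def matrix_mul_assoc)
  then show ?thesis by (simp add: hg)
qed

lemma inj_cj: "inj cj"
  using cj_inverse by (metis injI)

lemma cj_eq_iff: "cj A = B \<longleftrightarrow> A = h ** B ** g"
proof
  assume "A = h ** B ** g"
  then have "cj A = (g ** h) ** B ** (g ** h)" by (simp only: cj_def matrix_mul_assoc)
  then show "cj A = B" by (simp add: gh)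
qed (auto simp: cj_inverse)

lemma closure_cj: "closure (cj ` S) = cj ` closure S"
  using closure_injective_linear_image[OF linear_cj inj_cj] by simp

lemma continuous_on_cj: "continuous_on S cj"
  by (rule linear_continuous_on) (simp add: linear_cj linear_conv_bounded_linear[symmetric])

lemma lie_algebra_cj: "lie_algebra_of (cj ` G) = cj ` lie_algebra_of G"
proof -
  have "mexp (t *\<^sub>R cj X) = cj (mexp (t *\<^sub>R X))" for t X
    using mexp_conj[OF hg, of "t *\<^sub>R X"] by (simp add: cj_def mat_ring)
  then have iff: "cj X \<in> lie_algebra_of (cj ` G) \<longleftrightarrow> X \<in> lie_algebra_of G" for X
    by (simp add: lie_algebra_of_def inj_image_mem_iff[OF inj_cj])
  show ?thesis
  proof (intro equalityI subsetI)
    fix Z assume Z: "Z \<in> lie_algebra_of (cj ` G)"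
    have "cj (h ** Z ** g) = Z" by (simp add: cj_eq_iff)
    with Z iff[of "h ** Z ** g"] show "Z \<in> cj ` lie_algebra_of G" by force
  qed (auto simp: iff)
qed

lemma subspace_cj: "subspace L \<Longrightarrow> subspace (cj ` L)"
  by (rule linear_subspace_image[OF linear_cj])

lemma bracket_closed_cj: "bracket_closed L \<Longrightarrow> bracket_closed (cj ` L)"
  by (auto simp: bracket_closed_def cj_simps(7)[symmetric])

lemma matrix_inv_cj:
  assumes "A ** B = mat 1"
  shows "matrix_inv (cj A) = cj (matrix_inv A)"
  using matrix_inv_eqI[of "cj A" "cj B"] matrix_inv_eqI[OF assms] assms
  by (simp add: cj_mult[symmetric] cj_simps)

lemma word_prod_cj: "word_prod (\<lambda>s. cj (f s)) w = cj (word_prod f w)"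
  by (induction w) (simp_all add: cj_simps cj_mult)

lemma artin_eval_cj:
  assumes "\<And>s. \<exists>B. T s ** B = mat 1"
  shows "artin_eval (\<lambda>s. cj (T s)) w = cj (artin_eval T w)"
proof (induction w)
  case (Cons a w)
  obtain s b where a: "a = (s, b)" by force
  have "matrix_inv (cj (T s)) = cj (matrix_inv (T s))"
    using assms[of s] matrix_inv_cj by blast
  then show ?case using Cons by (simp add: a cj_mult)
qed (simp add: cj_simps)

lemma matrix_group_cj:
  assumes "closed_unitary_group G"
  shows "matrix_group (cj ` G)"
  unfolding matrix_group_def
proof (intro conjI ballI)
  interpret closed_unitary_group G by fact
  show "mat 1 \<in> cj ` G" using one_mem by (rule image_eqI[rotated]) (simp add: cj_simps)
  fix A assume "A \<in> cj ` G"
  then obtain B where B: "B \<in> G" "A = cj B" by blast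
  have inv: "A ** cj (adj B) = mat 1"
    using unitary[OF B(1)] by (simp add: B cj_mult[symmetric] cj_simps)
  then show "invertible A" by (auto simp: invertible_right_inverse)
  show "matrix_inv A \<in> cj ` G" using matrix_inv_eqI[OF inv] adj_mem[OF B(1)] by simp
  fix A' assume "A' \<in> cj ` G"
  then show "A ** A' \<in> cj ` G" using B mult_mem by (auto simp: cj_mult[symmetric])
qed

lemma real_lie_iso_cj: "real_lie_iso cj L (cj ` L)"
  by (auto simp: real_lie_iso_def cj_simps bij_betw_def intro: inj_on_subset[OF inj_cj])

lemma complex_lie_iso_cj:
  "complex_lie_iso cj {A + csmult \<i> B | A B. A \<in> L \<and> B \<in> L}
    {A + csmult \<i> B | A B. A \<in> cj ` L \<and> B \<in> cj ` L}"
proof -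
  have "cj ` {A + csmult \<i> B | A B. A \<in> L \<and> B \<in> L} = {A + csmult \<i> B | A B. A \<in> cj ` L \<and> B \<in> cj ` L}"
  proof (intro equalityI subsetI)
    fix x assume "x \<in> {A + csmult \<i> B | A B. A \<in> cj ` L \<and> B \<in> cj ` L}"
    then obtain A B where AB: "A \<in> L" "B \<in> L" "x = cj A + csmult \<i> (cj B)" by blast
    then have "x = cj (A + csmult \<i> B)" by (simp add: cj_simps)
    then show "x \<in> cj ` {A + csmult \<i> B | A B. A \<in> L \<and> B \<in> L}" using AB by blast
  next
    fix x assume "x \<in> cj ` {A + csmult \<i> B | A B. A \<in> L \<and> B \<in> L}"
    then obtain A B where AB: "A \<in> L" "B \<in> L" "x = cj (A + csmult \<i> B)" by blast
    then have "x = cj A + csmult \<i> (cj B)" by (simp add: cj_simps)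
    then show "x \<in> {A + csmult \<i> B | A B. A \<in> cj ` L \<and> B \<in> cj ` L}" using AB by blast
  qed
  then show ?thesis
    by (auto simp: complex_lie_iso_def cj_simps bij_betw_def intro: inj_on_subset[OF inj_cj])
qed

end

section \<open>Complexification\<close>

lemma comm_bilinear:
  "comm (A + B) C = comm A C + comm B C" "comm A (B + C) = comm A B + comm A C"
  "comm (csmult c A) B = csmult c (comm A B)" "comm A (csmult c B) = csmult c (comm A B)"
  by (simp_all add: comm_def mat_ring csmult_mult csmult_diff)

text \<open>With R the real Lie algebra generated by \<open>\<i>\<close> times \<open>X\<close>, the
  set R + iR is complex, closed under brackets, and contains \<open>X\<close> since an element x
  equals -i times ix. This relates the complex algebra to its compact form.\<close>

lemma complex_lie_gen_eq:
  "complex_lie_gen X = {A + csmult \<i> B | A B. A \<in> real_lie_gen (csmult \<i> ` X) \<and> B \<in> real_lie_gen (csmult \<i> ` X)}"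
proof -
  define R where "R = real_lie_gen (csmult \<i> ` X)"
  define C where "C = {A + csmult \<i> B | A B. A \<in> R \<and> B \<in> R}"
  have sub: "subspace R" and br: "\<And>A B. A \<in> R \<Longrightarrow> B \<in> R \<Longrightarrow> comm A B \<in> R"
    using subspace_real_lie_gen bracket_closed_real_lie_gen unfolding R_def bracket_closed_def by blast+
  have CI: "A + csmult \<i> B \<in> C" if "A \<in> R" "B \<in> R" for A B using that by (auto simp: C_def)
  have "complex_subspace C"
    unfolding complex_subspace_def
  proof (intro conjI ballI allI)
    show "0 \<in> C" using CI[of 0 0] sub by (simp add: subspace_0)
    fix x assume "x \<in> C"
    then obtain A B where AB: "A \<in> R" "B \<in> R" "x = A + csmult \<i> B" by (auto simp: C_def)
    show "csmult c x \<in> C" for c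
    proof -
      have "csmult c x = (Re c *\<^sub>R A - Im c *\<^sub>R B) + csmult \<i> (Im c *\<^sub>R A + Re c *\<^sub>R B)"
        unfolding AB(3)
        by (simp add: csmult_def vec_eq_iff complex_eq_iff algebra_simps)
      then show ?thesis
        using AB sub by (simp add: CI subspace_add subspace_diff subspace_scale)
    qed
    fix y assume "y \<in> C"
    then obtain A' B' where AB': "A' \<in> R" "B' \<in> R" "y = A' + csmult \<i> B'" by (auto simp: C_def)
    have "(A + A') + csmult \<i> (B + B') \<in> C" using AB AB' sub by (intro CI subspace_add)
    moreover have "x + y = (A + A') + csmult \<i> (B + B')" by (simp add: AB AB' csmult_add)
    ultimately show "x + y \<in> C" by (simp only:)
  qed
  moreover have "bracket_closed C"
    unfolding bracket_closed_def
  proof (intro ballI)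
    fix x y assume "x \<in> C" "y \<in> C"
    then obtain A B A' B' where AB: "A \<in> R" "B \<in> R" "x = A + csmult \<i> B"
      and AB': "A' \<in> R" "B' \<in> R" "y = A' + csmult \<i> B'" by (auto simp: C_def)
    have "(comm A A' - comm B B') + csmult \<i> (comm A B' + comm B A') \<in> C"
      using AB AB' sub br by (intro CI subspace_add subspace_diff)
    moreover have "comm x y = (comm A A' - comm B B') + csmult \<i> (comm A B' + comm B A')"
      by (simp add: AB AB' comm_bilinear csmult_add)
    ultimately show "comm x y \<in> C" by (simp only:)
  qed
  moreover have "X \<subseteq> C"
  proof
    fix x assume "x \<in> X"
    then have "csmult \<i> x \<in> R" unfolding R_def using real_lie_gen_superset by blast
    then have "0 + csmult \<i> (- csmult \<i> x) \<in> C" using sub by (intro CI) (simp_all add: subspace_0 subspace_neg)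
    then show "x \<in> C" by simp
  qed
  ultimately have "complex_lie_gen X \<subseteq> C" unfolding complex_lie_gen_def by blast
  moreover have "C \<subseteq> complex_lie_gen X"
  proof -
    have gen: "X \<subseteq> complex_lie_gen X" "complex_subspace (complex_lie_gen X)" "bracket_closed (complex_lie_gen X)"
      unfolding complex_lie_gen_def complex_subspace_def bracket_closed_def by blast+
    have "subspace (complex_lie_gen X)"
      using gen(2) unfolding complex_subspace_def subspace_def by (metis csmult_of_real)
    then have "R \<subseteq> complex_lie_gen X"
      unfolding R_def
      by (intro real_lie_gen_least gen(3)) (use gen(1,2) in \<open>auto simp: complex_subspace_def\<close>)
    then show ?thesis using gen(2) unfolding C_def complex_subspace_def by blast
  qed
  ultimately show ?thesis by (simp add: C_def R_def)
qed

context skew_reflections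
begin

text \<open>Arbitrary reflections add nothing to the simple ones: conjugation by
  \<open>\<rho> a\<close> is, up to sign, the sandwich by \<open>\<eta> a\<close>, and H is closed
  under it. Reversing a word inverts its product because the generators are involutions.\<close>

lemma real_lie_gen_reflections:
  fixes h h' :: "'n cmat"
  assumes h: "h' ** h = mat 1" and \<rho>: "\<And>s. \<rho> s = csmult (- \<i>) (h' ** \<eta> s ** h)"
  shows "real_lie_gen (csmult \<i> ` refl_images \<rho>) = (\<lambda>Z. h' ** Z ** h) ` H"
proof -
  interpret inverse_pair h' h by unfold_locales (rule h)
  have \<rho>': "\<rho> s = csmult (- \<i>) (cj (\<eta> s))" for s by (simp add: \<rho> cj_def)
  have "csmult \<i> (word_prod \<rho> w ** \<rho> s ** word_prod \<rho> (rev w)) \<in> cj ` H" for w s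
  proof (induction w)
    case Nil
    show ?case using eta_mem_H[of s] by (simp add: \<rho>')
  next
    case (Cons a w)
    then obtain Z where Z: "Z \<in> H" "csmult \<i> (word_prod \<rho> w ** \<rho> s ** word_prod \<rho> (rev w)) = cj Z" by blast
    have "csmult \<i> (word_prod \<rho> (a # w) ** \<rho> s ** word_prod \<rho> (rev (a # w)))
        = \<rho> a ** csmult \<i> (word_prod \<rho> w ** \<rho> s ** word_prod \<rho> (rev w)) ** \<rho> a"
      by (simp add: word_prod_append csmult_mult matrix_mul_assoc)
    also have "\<dots> = \<rho> a ** cj Z ** \<rho> a" by (simp only: Z(2))
    also have "\<dots> = - cj (\<eta> a ** Z ** \<eta> a)"
      by (simp add: \<rho>' csmult_mult cj_mult mm.minus_left mm.minus_right)
    also have "\<dots> = cj (- (\<eta> a ** Z ** \<eta> a))"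
      using cj_simps(5)[of "- 1" "\<eta> a ** Z ** \<eta> a"] by simp
    finally show ?case
      using sandwich_mem[OF subspace_real_lie_gen bracket_closed_real_lie_gen sq eta_mem_H Z(1), of a]
      by (simp add: subspace_neg[OF subspace_real_lie_gen])
  qed
  then have "csmult \<i> ` refl_images \<rho> \<subseteq> cj ` H" by (auto simp: refl_images_def)
  then have "real_lie_gen (csmult \<i> ` refl_images \<rho>) \<subseteq> cj ` H"
    by (intro real_lie_gen_least subspace_cj bracket_closed_cj subspace_real_lie_gen bracket_closed_real_lie_gen)
  moreover have "H \<subseteq> cj -` real_lie_gen (csmult \<i> ` refl_images \<rho>)"
  proof (rule real_lie_gen_least)
    have "\<rho> s \<in> refl_images \<rho>" for s
      unfolding refl_images_def by (rule CollectI, rule exI[of _ "[]"], rule exI[of _ s]) simp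
    then have "csmult \<i> (\<rho> s) \<in> real_lie_gen (csmult \<i> ` refl_images \<rho>)" for s
      using real_lie_gen_superset by blast
    then show "range \<eta> \<subseteq> cj -` real_lie_gen (csmult \<i> ` refl_images \<rho>)" by (auto simp: \<rho>')
    show "subspace (cj -` real_lie_gen (csmult \<i> ` refl_images \<rho>))"
      by (rule linear_subspace_vimage[OF linear_cj subspace_real_lie_gen])
    show "bracket_closed (cj -` real_lie_gen (csmult \<i> ` refl_images \<rho>))"
      using bracket_closed_real_lie_gen[of "csmult \<i> ` refl_images \<rho>"]
      by (simp add: bracket_closed_def cj_simps)
  qed
  ultimately show ?thesis unfolding cj_def by blast
qed

text \<open>The form is the trace form pulled back to H; after conjugation by a non-unitary matrix
  the Euclidean form itself may lose its invariance.\<close>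

lemma compact_lie_algebra_conj:
  fixes b b' :: "'n cmat"
  assumes b: "b' ** b = mat 1"
  shows "compact_lie_algebra ((\<lambda>Z. b' ** Z ** b) ` H)"
proof -
  interpret inverse_pair b' b by unfold_locales (rule b)
  define B where "B x y = (b ** x ** b') \<bullet> (b ** y ** b')" for x y :: "'n cmat"
  have B_cj: "B (cj x) (cj y) = x \<bullet> y" for x y by (simp add: B_def cj_inverse)
  have "compact_lie_algebra (cj ` H)"
    unfolding compact_lie_algebra_def
  proof (intro exI[of _ B] conjI ballI allI impI)
    fix x y z :: "'n cmat" and c :: real
    show "B x y = B y x" by (simp add: B_def inner_commute)
    show "B (x + y) z = B x z + B y z" by (simp add: B_def mat_ring inner_add_left)
    show "B (c *\<^sub>R x) z = c * B x z" by (simp add: B_def mat_ring)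
    show "0 < B x x" if "x \<in> cj ` H" "x \<noteq> 0"
      using that by (auto simp: B_cj cj_simps)
    show "B (comm x y) z + B y (comm x z) = 0" if xyz: "x \<in> cj ` H" "y \<in> cj ` H" "z \<in> cj ` H"
    proof -
      obtain X Y Z where X: "X \<in> H" "x = cj X" and YZ: "y = cj Y" "z = cj Z" using xyz by blast
      have "comm Y X \<bullet> Z = Y \<bullet> comm X Z" by (rule comm_inner_skew[OF H_skew[OF X(1)]])
      moreover have "comm X Y = - comm Y X" by (simp add: comm_def)
      ultimately show ?thesis by (simp add: X(2) YZ B_cj cj_simps(7)[symmetric])
    qed
  qed
  then show ?thesis unfolding cj_def .
qed

text \<open>In the application \<open>b\<close> belongs to the deformed group and \<open>h\<close>
  to the parameter 1. Conjugation by \<open>h' ** b\<close> matches the two copies of H, and being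
  complex linear it serves for the complexifications as well.\<close>

lemma compact_real_form_conj:
  fixes b b' h h' :: "'n cmat"
  assumes b: "b' ** b = mat 1" and h: "h' ** h = mat 1" and \<rho>: "\<And>s. \<rho> s = csmult (- \<i>) (h' ** \<eta> s ** h)"
  defines "L \<equiv> (\<lambda>Z. b' ** Z ** b) ` H"
  shows "compact_real_form_of L (complex_lie_gen (refl_images \<rho>))"
    and "\<exists>\<phi>. real_lie_iso \<phi> L (real_lie_gen (csmult \<i> ` refl_images \<rho>))"
proof -
  interpret b: inverse_pair b' b by unfold_locales (rule b)
  interpret h: inverse_pair h' h by unfold_locales (rule h)
  have kk: "(h' ** b) ** (b' ** h) = mat 1"
  proof -
    have "(h' ** b) ** (b' ** h) = h' ** (b ** b') ** h" by (simp only: matrix_mul_assoc)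
    then show ?thesis by (simp add: b.hg h)
  qed
  interpret k: inverse_pair "h' ** b" "b' ** h" by unfold_locales (rule kk)
  have L: "L = b.cj ` H" by (simp add: L_def b.cj_def)
  have "k.cj (b.cj Z) = h.cj Z" for Z
  proof -
    have "k.cj (b.cj Z) = h' ** (b ** b') ** Z ** (b ** b') ** h"
      by (simp only: k.cj_def b.cj_def matrix_mul_assoc)
    then show ?thesis by (simp add: b.hg h.cj_def)
  qed
  then have "k.cj ` L = h.cj ` H" by (simp add: L image_image)
  also have "\<dots> = real_lie_gen (csmult \<i> ` refl_images \<rho>)"
    unfolding real_lie_gen_reflections[OF h \<rho>] by (simp add: h.cj_def)
  finally have kL: "k.cj ` L = real_lie_gen (csmult \<i> ` refl_images \<rho>)" .
  show "\<exists>\<phi>. real_lie_iso \<phi> L (real_lie_gen (csmult \<i> ` refl_images \<rho>))"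
    using k.real_lie_iso_cj[of L] unfolding kL by blast
  show "compact_real_form_of L (complex_lie_gen (refl_images \<rho>))"
    unfolding compact_real_form_of_def
  proof (intro conjI ballI impI)
    show "real_subspace L" "bracket_closed L"
      by (simp_all add: L real_subspace_iff b.subspace_cj b.bracket_closed_cj subspace_real_lie_gen
          bracket_closed_real_lie_gen)
    show "compact_lie_algebra L" unfolding L_def by (rule compact_lie_algebra_conj[OF b])
    show "\<exists>\<phi>. complex_lie_iso \<phi> {A + csmult \<i> B |A B. A \<in> L \<and> B \<in> L} (complex_lie_gen (refl_images \<rho>))"
      using k.complex_lie_iso_cj[of L] unfolding kL complex_lie_gen_eq[symmetric] by blast
    fix A assume "A \<in> L" "csmult \<i> A \<in> L"
    then obtain Z Z' where Z: "Z \<in> H" "A = b.cj Z" and Z': "Z' \<in> H" "csmult \<i> A = b.cj Z'"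
      unfolding L by blast
    have "b.cj Z' = b.cj (csmult \<i> Z)" using Z Z' by (simp add: b.cj_simps)
    then have "Z' = csmult \<i> Z" by (rule injD[OF b.inj_cj])
    then have "adj (csmult \<i> Z) = - csmult \<i> Z" using H_skew[OF Z'(1)] by simp
    \<comment> \<open>Multiplication by \<open>\<i>\<close> makes a skew matrix Hermitian, and only
      0 is both.\<close>
    then have "csmult \<i> Z = - csmult \<i> Z" using H_skew[OF Z(1)] by (simp add: adj_csmult)
    then have "csmult \<i> Z = 0" by (simp add: vec_eq_iff)
    then have "csmult (- \<i>) (csmult \<i> Z) = csmult (- \<i>) 0" by (simp only:)
    then show "A = 0" by (simp add: Z b.cj_simps)
  qed
qed

end

section \<open>Hecke algebra representations on the unit circle\<close>

text \<open>If \<open>\<theta> / pi\<close> were \<open>a / b\<close>, then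
  \<open>cis \<theta>\<close> would be a root of unity of order dividing \<open>2 * b\<close>, a
  zero of an integral polynomial.\<close>

lemma not_algebraic_cis_irrational:
  assumes "\<not> algebraic (cis \<theta>)"
  shows "\<theta> / pi \<notin> \<rat>"
proof
  assume "\<theta> / pi \<in> \<rat>"
  then obtain a b :: int where ab: "0 < b" "\<theta> / pi = of_int a / of_int b"
    by (rule Rats_cases') auto
  define k where "k = 2 * nat b"
  have k: "0 < k" "real k = 2 * of_int b" using ab(1) by (simp_all add: k_def)
  have "\<theta> = of_int a / of_int b * pi" using ab(2) by (simp add: field_simps)
  then have "real k * \<theta> = 2 * pi * of_int a" using ab(1) k(2) by simp
  then have "cis \<theta> ^ k = cis (2 * pi * of_int a)" by (simp add: Complex.DeMoivre)
  also have "\<dots> = 1" by (simp add: cis_multiple_2pi)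
  finally have root: "cis \<theta> ^ k = 1" .
  have "algebraic (cis \<theta>)"
  proof (rule algebraicI)
    show "coeff (monom 1 k - 1 :: complex poly) i \<in> \<int>" for i by (simp add: coeff_monom)
    have "coeff (monom 1 k - 1 :: complex poly) k = 1" using k(1) by (simp add: coeff_monom)
    then show "monom 1 k - 1 \<noteq> (0 :: complex poly)" by (metis coeff_0 zero_neq_one)
    show "poly (monom 1 k - 1) (cis \<theta>) = 0" using root by (simp add: poly_monom)
  qed
  with assms show False by simp
qed

text \<open>The quadratic relation allows \<open>R\<close> only the eigenvalues \<open>u\<close> and
  \<open>- inverse u = - cnj u\<close>. \<open>Y\<close> is the affine function of \<open>R\<close>
  that sends these to \<open>\<i>\<close> and \<open>- \<i>\<close>; it exists because they differ
  when \<open>Re u \<noteq> 0\<close>.\<close>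

lemma hecke_skew_unit:
  fixes R :: "'n::finite cmat"
  assumes R: "(R - csmult u (mat 1)) ** (R + csmult (inverse u) (mat 1)) = 0"
    and u: "norm u = 1" "Re u \<noteq> 0"
  defines "Y \<equiv> csmult (\<i> / of_real (Re u)) R + (Im u / Re u) *\<^sub>R mat 1"
  shows "Y ** Y = - mat 1"
proof -
  have "u \<noteq> 0" using u(1) by auto
  have inv: "inverse u = cnj u" using u(1) by (simp add: inverse_complex_def complex_eq_iff cmod_def)
  have "R ** R = csmult (u - inverse u) R + mat 1"
    using R \<open>u \<noteq> 0\<close>
    by (simp add: mat_ring csmult_mult csmult_add csmult_diff algebra_simps)
  then have R2: "R ** R = csmult (2 * \<i> * of_real (Im u)) R + mat 1"
    unfolding inv complex_diff_cnj by (simp add: mult_ac)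
  define a b where "a = \<i> / complex_of_real (Re u)" and "b = complex_of_real (Im u / Re u)"
  have Y: "Y = csmult a R + csmult b (mat 1)"
    by (simp add: Y_def a_def b_def flip: csmult_of_real)
  have "Y ** Y = csmult (a * a) (R ** R) + csmult (a * b + a * b) R + csmult (b * b) (mat 1)"
    unfolding csmult_add(2) by (simp add: Y mat_ring csmult_mult csmult_add(1) mult.commute)
  also have "\<dots> = csmult (a * a * (2 * \<i> * of_real (Im u)) + (a * b + a * b)) R + csmult (a * a + b * b) (mat 1)"
    by (simp add: R2 csmult_add algebra_simps)
  also have "a * a * (2 * \<i> * of_real (Im u)) + (a * b + a * b) = 0"
    using u(2) by (simp add: a_def b_def field_simps)
  also have "a * a + b * b = -1"
  proof -
    have "(Re u)\<^sup>2 + (Im u)\<^sup>2 = 1" using u(1) by (simp add: cmod_power2[symmetric])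
    then have "(Im u)\<^sup>2 - 1 = - (Re u)\<^sup>2" by simp
    moreover have "a * a + b * b = of_real (((Im u)\<^sup>2 - 1) / (Re u)\<^sup>2)"
      by (simp add: a_def b_def power2_eq_square diff_divide_distrib)
    ultimately show ?thesis using u(2) by simp
  qed
  finally show ?thesis by simp
qed

lemma circ_hecke_skew_unit:
  fixes R :: "'n::finite cmat"
  assumes "cos \<theta> \<noteq> 0"
  shows "circ (csmult (\<i> / of_real (cos \<theta>)) R + (sin \<theta> / cos \<theta>) *\<^sub>R mat 1) (pi / 2 + \<theta>) = csmult \<i> R"
  using assms by (simp add: circ_def cos_add sin_add scaleR_add_right csmult_scaleR)

lemma word_prod_csmult: "word_prod (\<lambda>s. csmult c (f s)) w = csmult (c ^ length w) (word_prod f w)"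
  by (induction w) (simp_all add: csmult_mult mult_ac)

lemma tendsto_csmult:
  fixes A :: "'a \<Rightarrow> 'n::finite cmat"
  assumes "(c \<longlongrightarrow> l) F" "(A \<longlongrightarrow> B) F"
  shows "((\<lambda>x. csmult (c x) (A x)) \<longlongrightarrow> csmult l B) F"
  unfolding csmult_def by (intro vec_tendstoI) (simp add: tendsto_mult tendsto_vec_nth assms)

lemma tendsto_laurent_eval:
  assumes "u \<longlonglongrightarrow> l" "l \<noteq> 0"
  shows "(\<lambda>n. laurent_eval P d (u n)) \<longlonglongrightarrow> laurent_eval P d l"
  unfolding laurent_eval_def
  by (intro vec_tendstoI) (use assms in \<open>auto intro!: tendsto_intros\<close>)

lemma complex_irreducible_conj:
  fixes h h' :: "'n::finite cmat"
  assumes irr: "complex_irreducible \<rho>" and hh: "h ** h' = mat 1" and c: "c \<noteq> 0"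
  shows "complex_irreducible (\<lambda>s. csmult c (h ** \<rho> s ** h'))"
  unfolding complex_irreducible_def
proof (rule notI, elim exE conjE)
  fix V :: "(complex^'n) set"
  assume V0: "0 \<in> V" and Vadd: "\<forall>x\<in>V. \<forall>y\<in>V. x + y \<in> V" and Vscale: "\<forall>k. \<forall>x\<in>V. k *s x \<in> V"
    and Vproper: "V \<noteq> {0}" "V \<noteq> UNIV" and Vinv: "\<forall>s. \<forall>x\<in>V. csmult c (h ** \<rho> s ** h') *v x \<in> V"
  have h'h: "h' ** h = mat 1" by (rule matrix_left_right_inverse1[OF hh])
  have hh'x: "h *v (h' *v x) = x" "h' *v (h *v x) = x" for x
    by (simp_all add: matrix_vector_mul_assoc hh h'h)
  define U where "U = {x. h *v x \<in> V}"
  have "0 \<in> U \<and> (\<forall>x\<in>U. \<forall>y\<in>U. x + y \<in> U) \<and> (\<forall>k. \<forall>x\<in>U. k *s x \<in> U)"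
    using V0 Vadd Vscale by (auto simp: U_def mv.add_right vec.scale)
  moreover have "\<rho> s *v x \<in> U" if "x \<in> U" for s x
  proof -
    have "csmult c (h ** \<rho> s ** h') *v (h *v x) \<in> V" using Vinv that by (simp add: U_def)
    then have "inverse c *s (csmult c (h ** \<rho> s ** h') *v (h *v x)) \<in> V" using Vscale by blast
    moreover have "inverse c *s (csmult c (h ** \<rho> s ** h') *v (h *v x)) = h *v (\<rho> s *v x)"
      using c by (simp add: csmult_vec hh'x flip: matrix_vector_mul_assoc)
    ultimately show ?thesis by (simp add: U_def)
  qed
  moreover have "U \<noteq> {0}"
  proof -
    obtain x where "x \<in> V" "x \<noteq> 0" using V0 Vproper(1) by blast
    then have "h' *v x \<in> U" "h' *v x \<noteq> 0" using hh'x(1)[of x] by (auto simp: U_def)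
    then show ?thesis by blast
  qed
  moreover have "U \<noteq> UNIV"
  proof -
    obtain x where "x \<notin> V" using Vproper(2) by blast
    then have "h' *v x \<notin> U" by (simp add: U_def hh'x)
    then show ?thesis by blast
  qed
  moreover have "\<not> (0 \<in> U \<and> (\<forall>x\<in>U. \<forall>y\<in>U. x + y \<in> U) \<and> (\<forall>k. \<forall>x\<in>U. k *s x \<in> U)
      \<and> U \<noteq> {0} \<and> U \<noteq> UNIV \<and> (\<forall>s. \<forall>x\<in>U. \<rho> s *v x \<in> U))"
    using irr unfolding complex_irreducible_def not_ex by (rule spec)
  ultimately show False by auto
qed

lemma eventually_invertible:
  fixes g :: "nat \<Rightarrow> 'n::finite cmat"
  assumes "g \<longlonglongrightarrow> mat 1"
  shows "\<forall>\<^sub>F n in sequentially. invertible (g n)"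
proof -
  have "(\<lambda>n. det (g n)) \<longlonglongrightarrow> det (mat 1 :: 'n cmat)"
    unfolding det_def by (intro tendsto_intros tendsto_vec_nth assms)
  then have "\<forall>\<^sub>F n in sequentially. det (g n) \<noteq> 0"
    by (rule tendsto_imp_eventually_ne) simp
  then show ?thesis by eventually_elim (simp add: invertible_det_nz)
qed

text \<open>If no radius worked, there would be bad parameters \<open>u n\<close> tending to 1.
  Rigidity and semicontinuity, both stated for sequences, produce one index at which all claims
  hold, a contradiction.\<close>

theorem theorem6p11:
  fixes m :: "'i::finite \<Rightarrow> 'i \<Rightarrow> nat"
    and P :: "'i \<Rightarrow> (real poly)^'n::finite^'n"
    and d :: nat
  assumes "coxeter_matrix m"
    and "coxeter_group_finite m"
    and "coxeter_irreducible m"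
    and "hecke_model m P d"
    and "complex_irreducible (\<lambda>s. laurent_eval (P s) d 1)"
  shows "\<exists>\<epsilon>>0. \<forall>u::complex. \<not> algebraic u \<and> norm u = 1 \<and> norm (u - 1) < \<epsilon> \<longrightarrow>
     (\<forall>G \<in> {closure (artin_eval (\<lambda>s. laurent_eval (P s) d u) ` pure_words m),
             closure (artin_eval (\<lambda>s. laurent_eval (P s) d u) ` even_words)}.
        matrix_group G \<and> compact G \<and> connected G
        \<and> compact_real_form_of (lie_algebra_of G)
            (complex_lie_gen (refl_images (\<lambda>s. laurent_eval (P s) d 1)))
        \<and> (\<exists>\<phi>. real_lie_iso \<phi> (lie_algebra_of G)
            (real_lie_gen (csmult \<i> ` refl_images (\<lambda>s. laurent_eval (P s) d 1)))))"
    (is "\<exists>\<epsilon>>0. \<forall>u. ?cond u \<epsilon> \<longrightarrow> (\<forall>G \<in> ?groups u. ?good G)")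
proof (rule ccontr)
  assume neg: "\<not> ?thesis"
  define R where "R u s = laurent_eval (P s) d u" for u s
  define \<rho> where "\<rho> = R 1"
  have quad: "(R q s - csmult q (mat 1)) ** (R q s + csmult (inverse q) (mat 1)) = 0"
    and braid: "word_prod (R q) (alt s t (m s t)) = word_prod (R q) (alt t s (m s t))" if "q \<noteq> 0" for q s t
    using assms(4) that unfolding hecke_model_def R_def by blast+
  have \<rho>_sq: "\<rho> s ** \<rho> s = mat 1" for s
    using quad[of 1 s] by (simp add: \<rho>_def mat_ring)
  have \<rho>_braid: "word_prod \<rho> (alt s t (m s t)) = word_prod \<rho> (alt t s (m s t))" for s t
    unfolding \<rho>_def by (rule braid) simp
  obtain h h' :: "'n cmat" where hh': "h ** h' = mat 1" "h' ** h = mat 1"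
    and hermitian: "\<And>s. adj (h ** \<rho> s ** h') = h ** \<rho> s ** h'"
    using unitarisation[OF assms(2) \<rho>_sq \<rho>_braid] by blast
  interpret h: inverse_pair h h' by unfold_locales (rule hh')
  define \<eta> where "\<eta> s = csmult \<i> (h ** \<rho> s ** h')" for s
  have \<eta>_cj: "\<eta> s = csmult \<i> (h.cj (\<rho> s))" for s by (simp add: \<eta>_def h.cj_def)
  interpret skew_reflections \<eta>
  proof
    show "\<eta> s ** \<eta> s = - mat 1" for s
      by (simp add: \<eta>_cj csmult_mult h.cj_mult[symmetric] \<rho>_sq h.cj_simps)
    show "adj (\<eta> s) = - \<eta> s" for s
      by (simp add: \<eta>_def adj_csmult hermitian)
    show "complex_irreducible \<eta>"
      unfolding \<eta>_def[abs_def]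
      using complex_irreducible_conj[OF _ hh'(1), of \<rho> \<i>] assms(5) by (simp add: \<rho>_def R_def[abs_def])
  qed
  have \<eta>_braid: "word_prod \<eta> (alt s t (m s t)) = word_prod \<eta> (alt t s (m s t))" for s t
    by (simp add: \<eta>_cj[abs_def] word_prod_csmult h.word_prod_cj length_alt \<rho>_braid[of s t])
  have "\<exists>u. ?cond u (inverse (real (Suc n))) \<and> \<not> (\<forall>G \<in> ?groups u. ?good G)" for n
    using neg by (metis inverse_positive_iff_positive of_nat_0_less_iff zero_less_Suc)
  then obtain u where u: "\<And>n. ?cond (u n) (inverse (real (Suc n)))"
    and bad: "\<And>n. \<not> (\<forall>G \<in> ?groups (u n). ?good G)" by metis
  have "(\<lambda>n. u n - 1) \<longlonglongrightarrow> 0"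
    using Lim_null_comparison[of "\<lambda>n. u n - 1" "\<lambda>n. inverse (real (Suc n))" sequentially]
      LIMSEQ_inverse_real_of_nat u by (simp add: less_imp_le)
  then have u_lim: "u \<longlonglongrightarrow> 1" by (rule LIM_zero_cancel)
  \<comment> \<open>The radii are at most 1, so all parameters lie in the open right half-plane and
    division by the real part, which is the cosine of the angle, is legitimate.\<close>
  have re_pos: "0 < Re (u n)" for n
  proof -
    have "norm (u n - 1) < 1" using u[of n] by (auto intro: less_le_trans simp: inverse_le_1_iff)
    then have "\<bar>Re (u n) - 1\<bar> < 1" using abs_Re_le_cmod[of "u n - 1"] by simp
    then show ?thesis by simp
  qed
  have u0: "u n \<noteq> 0" for n using re_pos[of n] by auto
  define \<theta> where "\<theta> n = Arg (u n)" for n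
  have cis_\<theta>: "cis (\<theta> n) = u n" for n
    using u[of n] u0[of n] by (simp add: \<theta>_def cis_Arg sgn_div_norm)
  have cos_\<theta>: "cos (\<theta> n) = Re (u n)" and sin_\<theta>: "sin (\<theta> n) = Im (u n)" for n
    by (simp_all flip: cis_\<theta>)
  have "isCont Arg 1" by (rule continuous_at_Arg) simp
  then have "\<theta> \<longlonglongrightarrow> Arg 1" unfolding \<theta>_def[abs_def] using u_lim by (rule isCont_tendsto_compose)
  then have \<theta>_lim: "\<theta> \<longlonglongrightarrow> 0" by simp
  define Z where "Z n s = csmult (\<i> / of_real (Re (u n))) (R (u n) s) + (Im (u n) / Re (u n)) *\<^sub>R mat 1" for n s
  have Z_sq: "Z n s ** Z n s = - mat 1" for n s
    unfolding Z_def by (rule hecke_skew_unit[OF quad[OF u0]]) (use u[of n] re_pos[of n] in auto)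
  have Z_circ: "circ (Z n s) (pi / 2 + \<theta> n) = csmult \<i> (R (u n) s)" for n s
    using circ_hecke_skew_unit[of "\<theta> n"] re_pos[of n] by (simp add: Z_def cos_\<theta> sin_\<theta>)
  define Y where "Y n s = h.cj (Z n s)" for n s
  have Y_sq: "Y n s ** Y n s = - mat 1" for n s
    using h.cj_simps(5)[of "-1" "mat 1"] by (simp add: Y_def h.cj_mult[symmetric] Z_sq h.cj_simps)
  have Y_lim: "(\<lambda>n. Y n s) \<longlonglongrightarrow> \<eta> s" for s
  proof -
    have "(\<lambda>n. Z n s) \<longlonglongrightarrow> csmult (\<i> / of_real (Re 1)) (\<rho> s) + (Im 1 / Re 1) *\<^sub>R mat 1"
      unfolding Z_def \<rho>_def R_def
      by (intro tendsto_intros tendsto_csmult tendsto_laurent_eval u_lim) auto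
    then have "(\<lambda>n. h ** Z n s ** h') \<longlonglongrightarrow> h ** csmult \<i> (\<rho> s) ** h'"
      by (intro mm.tendsto tendsto_const) simp
    then show ?thesis by (simp add: Y_def h.cj_def \<eta>_def csmult_mult)
  qed
  have Y_circ: "circ (Y n s) (pi / 2 + \<theta> n) = csmult \<i> (h.cj (R (u n) s))" for n s
    using circ_conj[OF hh'(1), of "Z n s" "pi / 2 + \<theta> n"]
    by (simp add: Y_def h.cj_def Z_circ csmult_mult)
  \<comment> \<open>The two sides have equal length, so the factors \<open>\<i>\<close> contribute
    the same scalar to both.\<close>
  have Y_braid: "word_prod (\<lambda>a. circ (Y n a) (pi / 2 + \<theta> n)) (alt s t (m s t))
      = word_prod (\<lambda>a. circ (Y n a) (pi / 2 + \<theta> n)) (alt t s (m s t))" for n s t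
    by (simp add: Y_circ word_prod_csmult h.word_prod_cj length_alt braid[OF u0, of n s t])
  obtain r :: "nat \<Rightarrow> nat" and g y where r: "strict_mono r" and g: "g \<longlonglongrightarrow> mat 1"
    and y_lim: "\<And>s. (\<lambda>n. y n s) \<longlonglongrightarrow> \<eta> s" and y_orbit: "\<And>n s. y n s \<in> orbit s"
    and gY: "\<And>n s. g n ** Y (r n) s = y n s ** g n"
    by (rule rigidity[OF assms(2) \<eta>_braid Y_sq Y_lim \<theta>_lim Y_braid]) blast
  obtain N where N: "\<And>n. N \<le> n \<Longrightarrow> invertible (g n)"
    using eventually_invertible[OF g] unfolding eventually_sequentially by blast
  obtain n0 where "lie_algebra_of (closure (circ_group (y (n0 + N)))) = H"
    using lie_algebra_eventually[of "\<lambda>n. y (n + N)", OF y_orbit LIMSEQ_ignore_initial_segment[OF y_lim]] by blast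
  \<comment> \<open>The shift by \<open>N\<close> ensures that \<open>g k\<close> is invertible. The
    index \<open>k\<close> refers to \<open>y\<close> and \<open>g\<close>; the matching parameter
    is \<open>u (r k)\<close>.\<close>
  define k where "k = n0 + N"
  define C where "C = closure (circ_group (y k))"
  have lie_C: "lie_algebra_of C = H" by (simp add: C_def k_def) fact
  obtain g' where g': "g k ** g' = mat 1" "g' ** g k = mat 1"
    using N[of k] by (auto simp: invertible_def k_def)
  \<comment> \<open>\<open>b\<close> composes the unitarisation at parameter 1 with the rigidity
    conjugation; together they carry the deformed units into the K-orbits.\<close>
  define b b' where "b = g k ** h" and "b' = h' ** g'"
  have b'b: "b' ** b = mat 1"
  proof -
    have "b' ** b = h' ** (g' ** g k) ** h" by (simp only: b_def b'_def matrix_mul_assoc)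
    then show ?thesis by (simp add: g' hh')
  qed
  interpret b: inverse_pair b' b by unfold_locales (rule b'b)
  have y_sq: "y k s ** y k s = - mat 1" for s by (rule orbit_square[OF y_orbit])
  have y_skew: "adj (y k s) = - y k s" for s by (rule H_skew[OF orbit_mem_H[OF y_orbit]])
  have C: "closed_unitary_group C"
    unfolding C_def
    by (rule closed_unitary_group_closure[OF circ_group.one circ_group_mult adj_circ_group[OF y_skew]
          unitary_circ_group[OF y_sq y_skew]])
  define v where "v = u (r k)"
  define t where "t = \<theta> (r k)"
  define T where "T s = csmult (- \<i>) (circ (y k s) (pi / 2 + t))" for s
  have Zy: "Z (r k) s = b.cj (y k s)" for s
  proof -
    have "b.cj (y k s) = h' ** g' ** (y k s ** g k) ** h"
      unfolding b.cj_def unfolding b_def b'_def by (simp only: matrix_mul_assoc)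
    also have "\<dots> = (h' ** (g' ** g k) ** h) ** Z (r k) s ** (h' ** h)"
      by (simp only: gY[symmetric] Y_def h.cj_def matrix_mul_assoc)
    also have "\<dots> = Z (r k) s" by (simp add: g' hh')
    finally show ?thesis by simp
  qed
  have R_T: "R v s = b.cj (T s)" for s
  proof -
    have "csmult \<i> (R v s) = circ (b.cj (y k s)) (pi / 2 + t)"
      using Z_circ[of "r k" s] by (simp add: v_def t_def Zy)
    also have "\<dots> = b.cj (circ (y k s) (pi / 2 + t))"
      using circ_conj[OF b'b] by (simp add: b.cj_def)
    finally have "csmult (- \<i>) (csmult \<i> (R v s)) = csmult (- \<i>) (b.cj (circ (y k s) (pi / 2 + t)))" by simp
    then show ?thesis
      by (simp add: T_def b.cj_def csmult_mult mm.minus_left mm.minus_right)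
  qed
  have T_inv: "\<exists>B. T s ** B = mat 1" for s
  proof (rule exI[of _ "csmult \<i> (circ (y k s) (- (pi / 2 + t)))"])
    show "T s ** csmult \<i> (circ (y k s) (- (pi / 2 + t))) = mat 1"
      unfolding T_def csmult_mult circ_minus[OF y_sq] by simp
  qed
  have eval: "artin_eval (R v) ` S = b.cj ` artin_eval T ` S" for S
    unfolding image_image R_T[abs_def] b.artin_eval_cj[of T, OF T_inv] by simp
  have irrat: "t / pi \<notin> \<rat>"
    by (rule not_algebraic_cis_irrational) (use u[of "r k"] in \<open>simp add: t_def cis_\<theta>\<close>)
  have "closure (artin_eval (R v) ` pure_words m) = b.cj ` C" "closure (artin_eval (R v) ` even_words) = b.cj ` C"
    unfolding eval b.closure_cj C_def T_def closure_artin_eval[of "y k" t, OF y_sq irrat] by (rule refl)+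
  then have groups: "G \<in> ?groups v \<Longrightarrow> G = b.cj ` C" for G unfolding R_def by blast
  have good: "?good (b.cj ` C)"
  proof (intro conjI)
    show "matrix_group (b.cj ` C)" by (rule b.matrix_group_cj[OF C])
    show "compact (b.cj ` C)"
      by (intro compact_continuous_image b.continuous_on_cj closed_unitary_group.compact[OF C])
    show "connected (b.cj ` C)"
      unfolding C_def
      by (intro connected_continuous_image b.continuous_on_cj connected_imp_connected_closure connected_circ_group)
    have lie: "lie_algebra_of (b.cj ` C) = (\<lambda>Z. b' ** Z ** b) ` H"
      unfolding b.lie_algebra_cj lie_C by (intro image_cong) (simp_all add: b.cj_def)
    have \<rho>\<eta>: "laurent_eval (P s) d 1 = csmult (- \<i>) (h' ** \<eta> s ** h)" for s
      using h.cj_inverse[of "\<rho> s"] by (simp add: \<eta>_cj csmult_mult \<rho>_def R_def)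
    show "compact_real_form_of (lie_algebra_of (b.cj ` C))
        (complex_lie_gen (refl_images (\<lambda>s. laurent_eval (P s) d 1)))"
      and "\<exists>\<phi>. real_lie_iso \<phi> (lie_algebra_of (b.cj ` C))
        (real_lie_gen (csmult \<i> ` refl_images (\<lambda>s. laurent_eval (P s) d 1)))"
      unfolding lie by (rule compact_real_form_conj[OF b'b hh'(2) \<rho>\<eta>])+
  qed
  have "\<forall>G \<in> ?groups v. ?good G"
  proof
    fix G assume "G \<in> ?groups v"
    then have "G = b.cj ` C" by (rule groups)
    then show "?good G" using good by (simp only:)
  qed
  with bad[of "r k"] show False by (simp add: v_def)
qed

end
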